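(* Let $\mathcal{E}$ be a locally Cartesian closed category equipped with a probability monad $\mathcal{P}$, and $(\mathbb{T},+,0)$ a monoid in $\mathcal{E}$. By restricting the indexed categories $\mathbf{BunDyn}^{\mathbb{T}}$ and $\int\mathbf{BunDyn}^{\mathbb{T}}$ of open bundle dynamical systems to those systems which preserve measure in the base, one obtains indexed categories $$\mathbf{RBDyn}^{\mathbb{T}}:\mathbf{Poly}_{\mathcal{E}}\times\sum_{b:\mathbf{Poly}_{\mathcal{E}}}\mathbf{Dyn}^{\mathbb{T}}(b)_{\mathcal{P}}\to\mathbf{Cat},\qquad \int\mathbf{RBDyn}^{\mathbb{T}}:\mathbf{Poly}_{\mathcal{E}}\to\prod_{b:\mathbf{Poly}_{\mathcal{E}}}\mathbf{Fib}\big(\mathbf{Dyn}^{\mathbb{T}}(b)_{\mathcal{P}}\big)$$ of open random bundle dynamical systems (fully open random dynamical systems).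
   Context: Polynomials. A polynomial functor on $\mathcal{E}$ is a coproduct of representables $p=\sum_{i:p(1)}y^{p[i]}$, $y^A=\mathcal{E}(A,-)$; equivalently a bundle $p:\sum_{i:p(1)}p[i]\to p(1)$ in $\mathcal{E}$. $\mathbf{Poly}_{\mathcal{E}}\subset[\mathcal{E},\mathcal{E}]$ is the full subcategory on these. A morphism $\varphi:p\to q$ is a pair $\varphi_1:p(1)\to q(1)$, $\varphi^{\#}:\sum_{i:p(1)}q[\varphi_1(i)]\to\sum_{i:p(1)}p[i]$ over $p(1)$. A section of $p$ is $\sigma:p(1)\to\sum_ip[i]$ with $p\circ\sigma=\mathrm{id}$. Open systems. An open dynamical system on $p$ is a tuple $\vartheta=(\vartheta( * ),\vartheta^o,\vartheta^u)$ with state space $\vartheta( * ):\mathcal{E}$ and maps $\vartheta^o:\mathbb{T}\times\vartheta( * )\to p(1)$, $\vartheta^u:\sum_{t:\mathbb{T}}\sum_{w:\vartheta( * )}p[\vartheta^o(t,w)]\to\vartheta( * )$, such that for every section $\sigma$ of $p$ the closure $\vartheta^\sigma(t)=\vartheta^u(t)\circ\vartheta^o(t)^{*}\sigma:\vartheta( * )\to\vartheta( * )$ (with $\vartheta^o(t)^*\sigma$ the pulled-back section) satisfies $\vartheta^\sigma(0)=\mathrm{id}$ and $\vartheta^\sigma(s+t)=\vartheta^\sigma(s)\circ\vartheta^\sigma(t)$. $\mathbf{Dyn}^{\mathbb{T}}(p)$ has these as objects; morphisms $\vartheta\to\psi$ are maps $f:\vartheta( * )\to\psi( * )$ with $f\circ\vartheta^\sigma(t)=\psi^\sigma(t)\circ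 f$ for all $t,\sigma$. For $\varphi:p\to q$, $\mathbf{Dyn}^{\mathbb{T}}(\varphi)$ sends $(S,\vartheta^o,\vartheta^u)$ to $(S,\varphi_1\circ\vartheta^o,\vartheta^u\circ{\vartheta^o}^{*}\varphi^{\#})$ and is the identity on underlying maps. Open measure-preserving systems. An object of $\mathbf{Dyn}^{\mathbb{T}}(b)_{\mathcal{P}}$ is an open dynamical system $\theta$ on $b$ with a measure $\nu:1\to\mathcal{P}\theta( * )$ such that $\mathcal{P}(\theta^\varsigma(t))\circ\nu=\nu$ for every $t$ and every section $\varsigma$ of $b$. Morphisms are morphisms $f$ of the underlying open systems with $\mathcal{P}f\circ\nu=\nu'$. For $\chi:b\to c$ the action $\mathbf{Dyn}^{\mathbb{T}}(b)_{\mathcal{P}}\to\mathbf{Dyn}^{\mathbb{T}}(c)_{\mathcal{P}}$ is as for $\mathbf{Dyn}^{\mathbb{T}}$, with the measure unchanged. Open bundle systems. For $\theta$ an open system over $b$, an object of $\mathbf{BunDyn}^{\mathbb{T}}(p,b,\theta)$ is a pair $(\pi_{\vartheta\theta},\vartheta)$ with $\vartheta\in\mathbf{Dyn}^{\mathbb{T}}(p)$ and $\pi_{\vartheta\theta}:\vartheta( * )\to\theta( * )$ such that $\pi_{\vartheta\theta}\circ\vartheta^\sigma(t)=\theta^\varsigma(t)\circ\pi_{\vartheta\theta}$ for all $t$, sections $\sigma$ of $p$ and $\varsigma$ of $b$. Morphisms $(\pi_{\vartheta\theta},\vartheta)\to(\pi_{\varrho\theta},\varrho)$ are maps $f:\vartheta(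 * )\to\varrho( * )$ with $\pi_{\varrho\theta}\circ f=\pi_{\vartheta\theta}$ and, for all $t,\sigma,\varsigma$, inducing morphisms of bundles $\vartheta^\sigma\to\varrho^\sigma$ over $\theta^\varsigma$ (so $f\circ\vartheta^\sigma(t)=\varrho^\sigma(t)\circ f$). Actions: a morphism $\varphi:p\to q$ acts by $(\pi,\vartheta)\mapsto(\pi,\mathbf{Dyn}^{\mathbb{T}}(\varphi)(\vartheta))$; a morphism $\phi:\theta\to\rho$ of base systems over $b$ acts by $(\pi,\vartheta)\mapsto(\phi\circ\pi,\vartheta)$; a morphism $\chi:b\to c$ acts by regarding $(\pi,\vartheta)$ over $\theta$ as $(\pi,\vartheta)$ over $\mathbf{Dyn}^{\mathbb{T}}(\chi)(\theta)$; each acts as the identity on underlying maps of state spaces. This gives $\mathbf{BunDyn}^{\mathbb{T}}:\mathbf{Poly}_{\mathcal{E}}\times\sum_{b}\mathbf{Dyn}^{\mathbb{T}}(b)\to\mathbf{Cat}$, where $\sum_b$ is the total category (Grothendieck construction) of $b\mapsto\mathbf{Dyn}^{\mathbb{T}}(b)$; $\int\mathbf{BunDyn}^{\mathbb{T}}(p,b)$ is the (op)fibration over $\mathbf{Dyn}^{\mathbb{T}}(b)$ obtained from $\mathbf{BunDyn}^{\mathbb{T}}(p,b,-)$ by the Grothendieck construction. $\mathbf{Fib}(\mathcal{B})$ here denotes (op)fibrations over $\mathcal{B}$. $\mathbf{RBDyn}^{\mathbb{T}}$ and $\int\mathbf{RBDyn}^{\mathbb{T}}$ are defined in the same way with the base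 system $\theta$ (and its morphisms) taken in $\mathbf{Dyn}^{\mathbb{T}}(b)_{\mathcal{P}}$. "Indexed category" means (pseudo)functor into $\mathbf{Cat}$. *)

theory Defs
  imports Main "HOL-Library.FuncSet"
begin

section \<open>Categories and functors\<close>

record ('o, 'a) category =
  Obj :: "'o set"
  Arr :: "'a set"
  Dom :: "'a \<Rightarrow> 'o"
  Cod :: "'a \<Rightarrow> 'o"
  Ident :: "'o \<Rightarrow> 'a"
  Comp :: "'a \<Rightarrow> 'a \<Rightarrow> 'a"  (infixr "\<cdot>\<index>" 70)

definition hom :: "('o, 'a) category \<Rightarrow> 'o \<Rightarrow> 'o \<Rightarrow> 'a set" where
  "hom C x y = {f \<in> Arr C. Dom C f = x \<and> Cod C f = y}"

locale category =
  fixes C :: "('o, 'a) category" (structure)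
  assumes Dom_Obj: "f \<in> Arr C \<Longrightarrow> Dom C f \<in> Obj C"
    and Cod_Obj: "f \<in> Arr C \<Longrightarrow> Cod C f \<in> Obj C"
    and Ident_hom: "x \<in> Obj C \<Longrightarrow> Ident C x \<in> hom C x x"
    and Comp_hom: "f \<in> hom C x y \<Longrightarrow> g \<in> hom C y z \<Longrightarrow> g \<cdot> f \<in> hom C x z"
    and Comp_Ident: "f \<in> hom C x y \<Longrightarrow> f \<cdot> Ident C x = f"
    and Ident_Comp: "f \<in> hom C x y \<Longrightarrow> Ident C y \<cdot> f = f"
    and Comp_assoc: "f \<in> hom C w x \<Longrightarrow> g \<in> hom C x y \<Longrightarrow> h \<in> hom C y z \<Longrightarrow>
      (h \<cdot> g) \<cdot> f = h \<cdot> (g \<cdot> f)"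

record ('o, 'a, 'p, 'b) func =
  Src :: "('o, 'a) category"
  Tgt :: "('p, 'b) category"
  OMap :: "'o \<Rightarrow> 'p"
  AMap :: "'a \<Rightarrow> 'b"

text \<open>The two maps are required to be extensional, so that equality of functors, and hence equality
  of arrows of the category of categories below, is equality on objects and on arrows.\<close>

locale category_functor =
  fixes F :: "('o, 'a, 'p, 'b) func"
  assumes Src_category: "category (Src F)"
    and Tgt_category: "category (Tgt F)"
    and OMap_Obj: "x \<in> Obj (Src F) \<Longrightarrow> OMap F x \<in> Obj (Tgt F)"
    and AMap_hom: "f \<in> hom (Src F) x y \<Longrightarrow> AMap F f \<in> hom (Tgt F) (OMap F x) (OMap F y)"
    and AMap_Ident: "x \<in> Obj (Src F) \<Longrightarrow> AMap F (Ident (Src F) x) = Ident (Tgt F) (OMap F x)"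
    and AMap_Comp: "f \<in> hom (Src F) x y \<Longrightarrow> g \<in> hom (Src F) y z \<Longrightarrow>
      AMap F (g \<cdot>\<^bsub>Src F\<^esub> f) = AMap F g \<cdot>\<^bsub>Tgt F\<^esub> AMap F f"
    and OMap_extensional: "OMap F \<in> extensional (Obj (Src F))"
    and AMap_extensional: "AMap F \<in> extensional (Arr (Src F))"

definition is_functor ::
    "('o, 'a, 'p, 'b) func \<Rightarrow> ('o, 'a) category \<Rightarrow> ('p, 'b) category \<Rightarrow> bool" where
  "is_functor F C D \<longleftrightarrow> category_functor F \<and> Src F = C \<and> Tgt F = D"

definition fun_id :: "('o, 'a) category \<Rightarrow> ('o, 'a, 'o, 'a) func" where
  "fun_id C = \<lparr>Src = C, Tgt = C, OMap = (\<lambda>x \<in> Obj C. x), AMap = (\<lambda>f \<in> Arr C. f)\<rparr>"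

definition fun_comp ::
    "('p, 'b, 'q, 'c) func \<Rightarrow> ('o, 'a, 'p, 'b) func \<Rightarrow> ('o, 'a, 'q, 'c) func" where
  "fun_comp G F = \<lparr>Src = Src F, Tgt = Tgt G,
     OMap = (\<lambda>x \<in> Obj (Src F). OMap G (OMap F x)),
     AMap = (\<lambda>f \<in> Arr (Src F). AMap G (AMap F f))\<rparr>"

definition Cat :: "(('o, 'a) category, ('o, 'a, 'o, 'a) func) category" where
  "Cat = \<lparr>Obj = {C. category C}, Arr = {F. category_functor F}, Dom = Src, Cod = Tgt,
     Ident = fun_id, Comp = fun_comp\<rparr>"

definition prod_cat ::
    "('o, 'a) category \<Rightarrow> ('p, 'b) category \<Rightarrow> ('o \<times> 'p, 'a \<times> 'b) category" where
  "prod_cat C D = \<lparr>Obj = Obj C \<times> Obj D, Arr = Arr C \<times> Arr D,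
     Dom = map_prod (Dom C) (Dom D), Cod = map_prod (Cod C) (Cod D),
     Ident = map_prod (Ident C) (Ident D),
     Comp = (\<lambda>(g, g') (f, f'). (g \<cdot>\<^bsub>C\<^esub> f, g' \<cdot>\<^bsub>D\<^esub> f'))\<rparr>"

definition prod_fun ::
    "('o, 'a, 'p, 'b) func \<Rightarrow> ('q, 'c, 'r, 'd) func \<Rightarrow> ('o \<times> 'q, 'a \<times> 'c, 'p \<times> 'r, 'b \<times> 'd) func" where
  "prod_fun F G = \<lparr>Src = prod_cat (Src F) (Src G), Tgt = prod_cat (Tgt F) (Tgt G),
     OMap = (\<lambda>x \<in> Obj (prod_cat (Src F) (Src G)). map_prod (OMap F) (OMap G) x),
     AMap = (\<lambda>f \<in> Arr (prod_cat (Src F) (Src G)). map_prod (AMap F) (AMap G) f)\<rparr>"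

definition Pi_cat :: "'i set \<Rightarrow> ('i \<Rightarrow> ('o, 'a) category) \<Rightarrow> ('i \<Rightarrow> 'o, 'i \<Rightarrow> 'a) category" where
  "Pi_cat I C = \<lparr>Obj = (\<Pi>\<^sub>E i\<in>I. Obj (C i)), Arr = (\<Pi>\<^sub>E i\<in>I. Arr (C i)),
     Dom = (\<lambda>f. \<lambda>i\<in>I. Dom (C i) (f i)), Cod = (\<lambda>f. \<lambda>i\<in>I. Cod (C i) (f i)),
     Ident = (\<lambda>x. \<lambda>i\<in>I. Ident (C i) (x i)),
     Comp = (\<lambda>g f. \<lambda>i\<in>I. g i \<cdot>\<^bsub>C i\<^esub> f i)\<rparr>"

datatype ('x, 'm) mor = Mor (mor_src: 'x) (mor_tgt: 'x) (mor_map: 'm)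

text \<open>The category with objects \<open>X\<close> whose arrows from \<open>x\<close> to \<open>y\<close> are the elements of \<open>H x y\<close>, tagged
  with their source and target.\<close>

definition tagged_cat ::
    "'x set \<Rightarrow> ('x \<Rightarrow> 'x \<Rightarrow> 'm set) \<Rightarrow> ('x \<Rightarrow> 'm) \<Rightarrow> ('x \<Rightarrow> 'x \<Rightarrow> 'x \<Rightarrow> 'm \<Rightarrow> 'm \<Rightarrow> 'm) \<Rightarrow>
      ('x, ('x, 'm) mor) category" where
  "tagged_cat X H i c = \<lparr>Obj = X, Arr = {Mor x y m |x y m. x \<in> X \<and> y \<in> X \<and> m \<in> H x y},
     Dom = mor_src, Cod = mor_tgt, Ident = (\<lambda>x. Mor x x (i x)),
     Comp = (\<lambda>n m. Mor (mor_src m) (mor_tgt n)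
       (c (mor_src m) (mor_tgt m) (mor_tgt n) (mor_map n) (mor_map m)))\<rparr>"


section \<open>The Grothendieck construction and opfibrations\<close>

definition groth :: "('o, 'a, ('x, 'm) category, ('x, 'm, 'x, 'm) func) func \<Rightarrow>
    ('o \<times> 'x, ('o \<times> 'x, 'a \<times> 'm) mor) category" where
  "groth F = tagged_cat
     {(c, x). c \<in> Obj (Src F) \<and> x \<in> Obj (OMap F c)}
     (\<lambda>(c, x) (d, y). {(f, g). f \<in> hom (Src F) c d \<and> g \<in> hom (OMap F d) (OMap (AMap F f) x) y})
     (\<lambda>(c, x). (Ident (Src F) c, Ident (OMap F c) x))
     (\<lambda>_ _ (e, _) (f', g') (f, g). (f' \<cdot>\<^bsub>Src F\<^esub> f, g' \<cdot>\<^bsub>OMap F e\<^esub> AMap (AMap F f') g))"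

definition groth_proj :: "('o, 'a, ('x, 'm) category, ('x, 'm, 'x, 'm) func) func \<Rightarrow>
    ('o \<times> 'x, ('o \<times> 'x, 'a \<times> 'm) mor, 'o, 'a) func" where
  "groth_proj F = \<lparr>Src = groth F, Tgt = Src F,
     OMap = (\<lambda>x \<in> Obj (groth F). fst x),
     AMap = (\<lambda>m \<in> Arr (groth F). fst (mor_map m))\<rparr>"

text \<open>The functor between total categories induced by a (strictly natural) family of functors
  \<open>\<eta> c\<close> from \<open>F c\<close> to \<open>G c\<close>.\<close>

definition groth_map :: "('o, 'a, ('x, 'm) category, ('x, 'm, 'x, 'm) func) func \<Rightarrow>
    ('o, 'a, ('y, 'n) category, ('y, 'n, 'y, 'n) func) func \<Rightarrow> ('o \<Rightarrow> ('x, 'm, 'y, 'n) func) \<Rightarrow>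
    ('o \<times> 'x, ('o \<times> 'x, 'a \<times> 'm) mor, 'o \<times> 'y, ('o \<times> 'y, 'a \<times> 'n) mor) func" where
  "groth_map F G \<eta> = (let on_obj = (\<lambda>(c, x). (c, OMap (\<eta> c) x)) in
     \<lparr>Src = groth F, Tgt = groth G,
      OMap = (\<lambda>x \<in> Obj (groth F). on_obj x),
      AMap = (\<lambda>m \<in> Arr (groth F). Mor (on_obj (mor_src m)) (on_obj (mor_tgt m))
        (fst (mor_map m), AMap (\<eta> (fst (mor_tgt m))) (snd (mor_map m))))\<rparr>)"

text \<open>For \<open>F : D \<rightarrow> Cat\<close> and \<open>U : C \<rightarrow> D\<close>, the functor over \<open>U\<close> from the total category of \<open>F \<circ> U\<close> to that
  of \<open>F\<close>.\<close>

definition groth_base_change :: "('p, 'b, ('x, 'm) category, ('x, 'm, 'x, 'm) func) func \<Rightarrow>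
    ('o, 'a, 'p, 'b) func \<Rightarrow>
    ('o \<times> 'x, ('o \<times> 'x, 'a \<times> 'm) mor, 'p \<times> 'x, ('p \<times> 'x, 'b \<times> 'm) mor) func" where
  "groth_base_change F U = (let on_obj = map_prod (OMap U) id in
     \<lparr>Src = groth (fun_comp F U), Tgt = groth F,
      OMap = (\<lambda>x \<in> Obj (groth (fun_comp F U)). on_obj x),
      AMap = (\<lambda>m \<in> Arr (groth (fun_comp F U)). Mor (on_obj (mor_src m)) (on_obj (mor_tgt m))
        (map_prod (AMap U) id (mor_map m)))\<rparr>)"

definition opcartesian :: "('o, 'a, 'p, 'b) func \<Rightarrow> 'a \<Rightarrow> bool" where
  "opcartesian F h \<longleftrightarrow> h \<in> Arr (Src F) \<and>
     (\<forall>k \<in> Arr (Src F). \<forall>u \<in> hom (Tgt F) (Cod (Tgt F) (AMap F h)) (Cod (Tgt F) (AMap F k)).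
        Dom (Src F) k = Dom (Src F) h \<and> u \<cdot>\<^bsub>Tgt F\<^esub> AMap F h = AMap F k \<longrightarrow>
        (\<exists>!v. v \<in> hom (Src F) (Cod (Src F) h) (Cod (Src F) k) \<and> v \<cdot>\<^bsub>Src F\<^esub> h = k \<and> AMap F v = u))"

definition opfibration :: "('o, 'a, 'p, 'b) func \<Rightarrow> bool" where
  "opfibration F \<longleftrightarrow> category_functor F \<and>
     (\<forall>x \<in> Obj (Src F). \<forall>f \<in> Arr (Tgt F). Dom (Tgt F) f = OMap F x \<longrightarrow>
        (\<exists>h. opcartesian F h \<and> Dom (Src F) h = x \<and> AMap F h = f))"

text \<open>Opfibrations over \<open>B\<close>; the arrows are the functors over \<open>B\<close> preserving opcartesian arrows.\<close>

definition Fib :: "('p, 'b) category \<Rightarrow>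
    (('o, 'a, 'p, 'b) func, (('o, 'a, 'p, 'b) func, ('o, 'a, 'o, 'a) func) mor) category" where
  "Fib B = tagged_cat
     {F. opfibration F \<and> Tgt F = B}
     (\<lambda>F G. {H. is_functor H (Src F) (Src G) \<and> fun_comp G H = F \<and>
        (\<forall>h. opcartesian F h \<longrightarrow> opcartesian G (AMap H h))})
     (\<lambda>F. fun_id (Src F))
     (\<lambda>_ _ _. fun_comp)"

text \<open>The square with sides \<open>P : X \<rightarrow> A\<close>, \<open>Q : X \<rightarrow> B\<close>, \<open>F : A \<rightarrow> C\<close>, \<open>G : B \<rightarrow> C\<close> is a (strict) pullback of
  categories.\<close>

definition is_cat_pullback :: "('x, 'm, 'o, 'a) func \<Rightarrow> ('x, 'm, 'p, 'b) func \<Rightarrow>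
    ('o, 'a, 'q, 'c) func \<Rightarrow> ('p, 'b, 'q, 'c) func \<Rightarrow> bool" where
  "is_cat_pullback P Q F G \<longleftrightarrow>
     category_functor P \<and> category_functor Q \<and> category_functor F \<and> category_functor G \<and>
     Src P = Src Q \<and> Tgt P = Src F \<and> Tgt Q = Src G \<and> Tgt F = Tgt G \<and> fun_comp F P = fun_comp G Q \<and>
     bij_betw (\<lambda>x. (OMap P x, OMap Q x)) (Obj (Src P))
       {(a, b). a \<in> Obj (Src F) \<and> b \<in> Obj (Src G) \<and> OMap F a = OMap G b} \<and>
     bij_betw (\<lambda>f. (AMap P f, AMap Q f)) (Arr (Src P))
       {(a, b). a \<in> Arr (Src F) \<and> b \<in> Arr (Src G) \<and> AMap F a = AMap G b}"


section \<open>Locally cartesian closed categories\<close>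

definition is_terminal :: "('o, 'a) category \<Rightarrow> 'o \<Rightarrow> bool" where
  "is_terminal C z \<longleftrightarrow> z \<in> Obj C \<and> (\<forall>x \<in> Obj C. \<exists>!f. f \<in> hom C x z)"

definition is_product :: "('o, 'a) category \<Rightarrow> 'o \<Rightarrow> 'o \<Rightarrow> 'a \<times> 'a \<Rightarrow> bool" where
  "is_product C x y = (\<lambda>(p, q). p \<in> hom C (Dom C p) x \<and> q \<in> hom C (Dom C p) y \<and>
     (\<forall>z. \<forall>f \<in> hom C z x. \<forall>g \<in> hom C z y.
        \<exists>!h. h \<in> hom C z (Dom C p) \<and> p \<cdot>\<^bsub>C\<^esub> h = f \<and> q \<cdot>\<^bsub>C\<^esub> h = g))"

text \<open>\<open>e\<close> with evaluation \<open>ev : e \<times> x \<rightarrow> y\<close> is an exponential of \<open>y\<close> by \<open>x\<close>, where \<open>(p, q)\<close> are the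
  projections of \<open>e \<times> x\<close>; the arrow \<open>h\<close> is \<open>g \<times> id\<close>.\<close>

definition is_exponential :: "('o, 'a) category \<Rightarrow> 'o \<Rightarrow> 'o \<Rightarrow> 'o \<Rightarrow> 'a \<times> 'a \<Rightarrow> 'a \<Rightarrow> bool" where
  "is_exponential C x y e = (\<lambda>(p, q) ev. is_product C e x (p, q) \<and> ev \<in> hom C (Dom C p) y \<and>
     (\<forall>z \<in> Obj C. \<forall>p' q'. is_product C z x (p', q') \<longrightarrow> (\<forall>f \<in> hom C (Dom C p') y.
        \<exists>!g. g \<in> hom C z e \<and> (\<exists>h \<in> hom C (Dom C p') (Dom C p).
          p \<cdot>\<^bsub>C\<^esub> h = g \<cdot>\<^bsub>C\<^esub> p' \<and> q \<cdot>\<^bsub>C\<^esub> h = q' \<and> ev \<cdot>\<^bsub>C\<^esub> h = f))))"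

definition cartesian_closed :: "('o, 'a) category \<Rightarrow> bool" where
  "cartesian_closed C \<longleftrightarrow> category C \<and> (\<exists>z. is_terminal C z) \<and>
     (\<forall>x \<in> Obj C. \<forall>y \<in> Obj C. (\<exists>pq. is_product C x y pq) \<and> (\<exists>e pq ev. is_exponential C x y e pq ev))"

definition slice :: "('o, 'a) category \<Rightarrow> 'o \<Rightarrow> ('a, ('a, 'a) mor) category" where
  "slice C b = tagged_cat
     {f \<in> Arr C. Cod C f = b}
     (\<lambda>f g. {h \<in> hom C (Dom C f) (Dom C g). g \<cdot>\<^bsub>C\<^esub> h = f})
     (\<lambda>f. Ident C (Dom C f))
     (\<lambda>_ _ _ k h. k \<cdot>\<^bsub>C\<^esub> h)"

definition locally_cartesian_closed :: "('o, 'a) category \<Rightarrow> bool" where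
  "locally_cartesian_closed C \<longleftrightarrow>
     category C \<and> (\<exists>z. is_terminal C z) \<and> (\<forall>b \<in> Obj C. cartesian_closed (slice C b))"

definition is_pullback :: "('o, 'a) category \<Rightarrow> 'a \<Rightarrow> 'a \<Rightarrow> 'a \<times> 'a \<Rightarrow> bool" where
  "is_pullback C f g = (\<lambda>(p, q).
     p \<in> hom C (Dom C p) (Dom C f) \<and> q \<in> hom C (Dom C p) (Dom C g) \<and> f \<cdot>\<^bsub>C\<^esub> p = g \<cdot>\<^bsub>C\<^esub> q \<and>
     (\<forall>z. \<forall>u \<in> hom C z (Dom C f). \<forall>v \<in> hom C z (Dom C g). f \<cdot>\<^bsub>C\<^esub> u = g \<cdot>\<^bsub>C\<^esub> v \<longrightarrow>
        (\<exists>!h. h \<in> hom C z (Dom C p) \<and> p \<cdot>\<^bsub>C\<^esub> h = u \<and> q \<cdot>\<^bsub>C\<^esub> h = v)))"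

text \<open>Choices of a terminal object, of binary products and of pullbacks. They are meaningful when such
  limits exist, as they do in a locally cartesian closed category: a pullback over \<open>b\<close> is a product
  in the slice over \<open>b\<close>.\<close>

definition one :: "('o, 'a) category \<Rightarrow> 'o" where
  "one C = (SOME z. is_terminal C z)"

definition bang :: "('o, 'a) category \<Rightarrow> 'o \<Rightarrow> 'a" where
  "bang C x = (THE f. f \<in> hom C x (one C))"

definition pr1 :: "('o, 'a) category \<Rightarrow> 'o \<Rightarrow> 'o \<Rightarrow> 'a" where
  "pr1 C x y = fst (SOME pq. is_product C x y pq)"

definition pr2 :: "('o, 'a) category \<Rightarrow> 'o \<Rightarrow> 'o \<Rightarrow> 'a" where
  "pr2 C x y = snd (SOME pq. is_product C x y pq)"

definition prod_obj :: "('o, 'a) category \<Rightarrow> 'o \<Rightarrow> 'o \<Rightarrow> 'o" where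
  "prod_obj C x y = Dom C (pr1 C x y)"

definition pair :: "('o, 'a) category \<Rightarrow> 'a \<Rightarrow> 'a \<Rightarrow> 'a" where
  "pair C f g = (let x = Cod C f; y = Cod C g in
     THE h. h \<in> hom C (Dom C f) (prod_obj C x y) \<and> pr1 C x y \<cdot>\<^bsub>C\<^esub> h = f \<and> pr2 C x y \<cdot>\<^bsub>C\<^esub> h = g)"

text \<open>\<open>id \<times> f : x \<times> a \<rightarrow> x \<times> b\<close> for \<open>f : a \<rightarrow> b\<close>.\<close>

definition times_map :: "('o, 'a) category \<Rightarrow> 'o \<Rightarrow> 'a \<Rightarrow> 'a" where
  "times_map C x f = pair C (pr1 C x (Dom C f)) (f \<cdot>\<^bsub>C\<^esub> pr2 C x (Dom C f))"

definition pb1 :: "('o, 'a) category \<Rightarrow> 'a \<Rightarrow> 'a \<Rightarrow> 'a" where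
  "pb1 C f g = fst (SOME pq. is_pullback C f g pq)"

definition pb2 :: "('o, 'a) category \<Rightarrow> 'a \<Rightarrow> 'a \<Rightarrow> 'a" where
  "pb2 C f g = snd (SOME pq. is_pullback C f g pq)"

definition pb_obj :: "('o, 'a) category \<Rightarrow> 'a \<Rightarrow> 'a \<Rightarrow> 'o" where
  "pb_obj C f g = Dom C (pb1 C f g)"

definition pb_pair :: "('o, 'a) category \<Rightarrow> 'a \<Rightarrow> 'a \<Rightarrow> 'a \<Rightarrow> 'a \<Rightarrow> 'a" where
  "pb_pair C f g u v =
     (THE h. h \<in> hom C (Dom C u) (pb_obj C f g) \<and> pb1 C f g \<cdot>\<^bsub>C\<^esub> h = u \<and> pb2 C f g \<cdot>\<^bsub>C\<^esub> h = v)"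


section \<open>Monads and internal monoids\<close>

text \<open>No property specific to probability monads is used: any monad \<open>(P, \<eta>, \<mu>)\<close> on the category is
  allowed.\<close>

definition is_monad ::
    "('o, 'a) category \<Rightarrow> ('o, 'a, 'o, 'a) func \<Rightarrow> ('o \<Rightarrow> 'a) \<Rightarrow> ('o \<Rightarrow> 'a) \<Rightarrow> bool" where
  "is_monad C P \<eta> \<mu> \<longleftrightarrow> is_functor P C C \<and>
     (\<forall>x \<in> Obj C. \<eta> x \<in> hom C x (OMap P x) \<and> \<mu> x \<in> hom C (OMap P (OMap P x)) (OMap P x)) \<and>
     (\<forall>f \<in> Arr C. AMap P f \<cdot>\<^bsub>C\<^esub> \<eta> (Dom C f) = \<eta> (Cod C f) \<cdot>\<^bsub>C\<^esub> f \<and>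
        AMap P f \<cdot>\<^bsub>C\<^esub> \<mu> (Dom C f) = \<mu> (Cod C f) \<cdot>\<^bsub>C\<^esub> AMap P (AMap P f)) \<and>
     (\<forall>x \<in> Obj C. \<mu> x \<cdot>\<^bsub>C\<^esub> \<eta> (OMap P x) = Ident C (OMap P x) \<and>
        \<mu> x \<cdot>\<^bsub>C\<^esub> AMap P (\<eta> x) = Ident C (OMap P x) \<and>
        \<mu> x \<cdot>\<^bsub>C\<^esub> \<mu> (OMap P x) = \<mu> x \<cdot>\<^bsub>C\<^esub> AMap P (\<mu> x))"

record ('o, 'a) internal_monoid =
  Carrier :: 'o
  Add :: 'a
  Zero :: 'a

text \<open>For \<open>\<alpha> : T \<times> S \<rightarrow> S\<close>, the equations \<open>\<alpha>(0, w) = w\<close> and \<open>\<alpha>(s + t, w) = \<alpha>(s, \<alpha>(t, w))\<close> in the internal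
  language; in the second one \<open>s\<close>, \<open>t\<close>, \<open>w\<close> are the projections of \<open>(T \<times> T) \<times> S\<close>.\<close>

definition zero_acts :: "('o, 'a) category \<Rightarrow> ('o, 'a) internal_monoid \<Rightarrow> 'o \<Rightarrow> 'a \<Rightarrow> bool" where
  "zero_acts C T S \<alpha> \<longleftrightarrow> \<alpha> \<cdot>\<^bsub>C\<^esub> pair C (Zero T \<cdot>\<^bsub>C\<^esub> bang C S) (Ident C S) = Ident C S"

definition sum_acts :: "('o, 'a) category \<Rightarrow> ('o, 'a) internal_monoid \<Rightarrow> 'o \<Rightarrow> 'a \<Rightarrow> bool" where
  "sum_acts C T S \<alpha> \<longleftrightarrow>
    (let TT = prod_obj C (Carrier T) (Carrier T);
         s = pr1 C (Carrier T) (Carrier T) \<cdot>\<^bsub>C\<^esub> pr1 C TT S;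
         t = pr2 C (Carrier T) (Carrier T) \<cdot>\<^bsub>C\<^esub> pr1 C TT S;
         w = pr2 C TT S
     in \<alpha> \<cdot>\<^bsub>C\<^esub> pair C (Add T \<cdot>\<^bsub>C\<^esub> pair C s t) w = \<alpha> \<cdot>\<^bsub>C\<^esub> pair C s (\<alpha> \<cdot>\<^bsub>C\<^esub> pair C t w))"

definition is_action :: "('o, 'a) category \<Rightarrow> ('o, 'a) internal_monoid \<Rightarrow> 'o \<Rightarrow> 'a \<Rightarrow> bool" where
  "is_action C T S \<alpha> \<longleftrightarrow>
     \<alpha> \<in> hom C (prod_obj C (Carrier T) S) S \<and> zero_acts C T S \<alpha> \<and> sum_acts C T S \<alpha>"

text \<open>The left unit law and associativity say that \<open>Add\<close> makes \<open>T\<close> act on itself.\<close>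

definition is_monoid :: "('o, 'a) category \<Rightarrow> ('o, 'a) internal_monoid \<Rightarrow> bool" where
  "is_monoid C T \<longleftrightarrow> Carrier T \<in> Obj C \<and> Zero T \<in> hom C (one C) (Carrier T) \<and>
     is_action C T (Carrier T) (Add T) \<and>
     Add T \<cdot>\<^bsub>C\<^esub> pair C (Ident C (Carrier T)) (Zero T \<cdot>\<^bsub>C\<^esub> bang C (Carrier T)) = Ident C (Carrier T)"


section \<open>Polynomials\<close>

text \<open>A polynomial is an arrow \<open>p\<close> with \<open>Cod p = p(1)\<close> and \<open>Dom p = \<Sum>i. p[i]\<close>. A morphism is a pair
  \<open>(\<phi>\<^sub>1, \<phi>\<^sup>#)\<close> where the domain of \<open>\<phi>\<^sup>#\<close> is the pullback \<open>\<Sum>i. q[\<phi>\<^sub>1 i]\<close> of \<open>q\<close> along \<open>\<phi>\<^sub>1\<close>. For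
  \<open>k : X \<rightarrow> p(1)\<close>, the arrow \<open>base_change C k p q (\<phi>\<^sub>1, \<phi>\<^sup>#)\<close> is \<open>k\<^sup>*\<phi>\<^sup>#\<close>, that is
  \<open>(x, e) \<mapsto> (x, \<phi>\<^sup>#(k x, e))\<close>, from \<open>\<Sum>x. q[\<phi>\<^sub>1 (k x)]\<close> to \<open>\<Sum>x. p[k x]\<close>.\<close>

definition base_change :: "('o, 'a) category \<Rightarrow> 'a \<Rightarrow> 'a \<Rightarrow> 'a \<Rightarrow> 'a \<times> 'a \<Rightarrow> 'a" where
  "base_change C k p q = (\<lambda>(f, fs). let l = f \<cdot>\<^bsub>C\<^esub> k in
     pb_pair C k p (pb1 C l q) (fs \<cdot>\<^bsub>C\<^esub> pb_pair C f q (k \<cdot>\<^bsub>C\<^esub> pb1 C l q) (pb2 C l q)))"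

definition Poly_cat :: "('o, 'a) category \<Rightarrow> ('a, ('a, 'a \<times> 'a) mor) category" where
  "Poly_cat C = tagged_cat
     (Arr C)
     (\<lambda>p q. {(f, fs). f \<in> hom C (Cod C p) (Cod C q) \<and> fs \<in> hom C (pb_obj C f q) (Dom C p) \<and>
        p \<cdot>\<^bsub>C\<^esub> fs = pb1 C f q})
     (\<lambda>p. (Ident C (Cod C p), pb2 C (Ident C (Cod C p)) p))
     (\<lambda>p q r (g, gs) (f, fs). (g \<cdot>\<^bsub>C\<^esub> f, fs \<cdot>\<^bsub>C\<^esub> base_change C f q r (g, gs)))"

definition sections :: "('o, 'a) category \<Rightarrow> 'a \<Rightarrow> 'a set" where
  "sections C p = {\<sigma> \<in> hom C (Cod C p) (Dom C p). p \<cdot>\<^bsub>C\<^esub> \<sigma> = Ident C (Cod C p)}"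

text \<open>The section \<open>k\<^sup>*\<sigma>\<close> of the pullback of \<open>p\<close> along \<open>k\<close>.\<close>

definition pull_section :: "('o, 'a) category \<Rightarrow> 'a \<Rightarrow> 'a \<Rightarrow> 'a \<Rightarrow> 'a" where
  "pull_section C k p \<sigma> = pb_pair C k p (Ident C (Dom C k)) (\<sigma> \<cdot>\<^bsub>C\<^esub> k)"


section \<open>Open dynamical systems\<close>

record ('o, 'a) open_system =
  State :: 'o
  Out :: 'a
  Upd :: 'a

text \<open>The closure \<open>\<theta>\<^sup>\<sigma> : T \<times> S \<rightarrow> S\<close>. Equations required for all \<open>t\<close> are stated for it, that is, for all
  generalized elements \<open>t\<close> of \<open>T\<close>.\<close>

definition closure :: "('o, 'a) category \<Rightarrow> 'a \<Rightarrow> ('o, 'a) open_system \<Rightarrow> 'a \<Rightarrow> 'a" where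
  "closure C p \<theta> \<sigma> = Upd \<theta> \<cdot>\<^bsub>C\<^esub> pull_section C (Out \<theta>) p \<sigma>"

definition is_open_system ::
    "('o, 'a) category \<Rightarrow> ('o, 'a) internal_monoid \<Rightarrow> 'a \<Rightarrow> ('o, 'a) open_system \<Rightarrow> bool" where
  "is_open_system C T p \<theta> \<longleftrightarrow> State \<theta> \<in> Obj C \<and>
     Out \<theta> \<in> hom C (prod_obj C (Carrier T) (State \<theta>)) (Cod C p) \<and>
     Upd \<theta> \<in> hom C (pb_obj C (Out \<theta>) p) (State \<theta>) \<and>
     (\<forall>\<sigma> \<in> sections C p. is_action C T (State \<theta>) (closure C p \<theta> \<sigma>))"

definition equivariant :: "('o, 'a) category \<Rightarrow> ('o, 'a) internal_monoid \<Rightarrow> 'a \<Rightarrow> 'a \<Rightarrow> 'a \<Rightarrow> bool" where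
  "equivariant C T \<alpha> \<beta> f \<longleftrightarrow> f \<cdot>\<^bsub>C\<^esub> \<alpha> = \<beta> \<cdot>\<^bsub>C\<^esub> times_map C (Carrier T) f"

definition Dyn_hom :: "('o, 'a) category \<Rightarrow> ('o, 'a) internal_monoid \<Rightarrow> 'a \<Rightarrow>
    ('o, 'a) open_system \<Rightarrow> ('o, 'a) open_system \<Rightarrow> 'a set" where
  "Dyn_hom C T p \<theta> \<psi> = {f \<in> hom C (State \<theta>) (State \<psi>).
     \<forall>\<sigma> \<in> sections C p. equivariant C T (closure C p \<theta> \<sigma>) (closure C p \<psi> \<sigma>) f}"

definition Dyn_cat :: "('o, 'a) category \<Rightarrow> ('o, 'a) internal_monoid \<Rightarrow> 'a \<Rightarrow>
    (('o, 'a) open_system, (('o, 'a) open_system, 'a) mor) category" where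
  "Dyn_cat C T p = tagged_cat {\<theta>. is_open_system C T p \<theta>} (Dyn_hom C T p)
     (\<lambda>\<theta>. Ident C (State \<theta>)) (\<lambda>_ _ _ g f. g \<cdot>\<^bsub>C\<^esub> f)"

definition reindex :: "('o, 'a) category \<Rightarrow> ('a, 'a \<times> 'a) mor \<Rightarrow>
    ('o, 'a) open_system \<Rightarrow> ('o, 'a) open_system" where
  "reindex C \<phi> \<theta> = \<lparr>State = State \<theta>, Out = fst (mor_map \<phi>) \<cdot>\<^bsub>C\<^esub> Out \<theta>,
     Upd = Upd \<theta> \<cdot>\<^bsub>C\<^esub> base_change C (Out \<theta>) (mor_src \<phi>) (mor_tgt \<phi>) (mor_map \<phi>)\<rparr>"

text \<open>For a function on objects, the functor that applies it to sources and targets and leaves the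
  underlying map unchanged.\<close>

definition tagged_fun :: "('x, ('x, 'm) mor) category \<Rightarrow> ('y, ('y, 'm) mor) category \<Rightarrow> ('x \<Rightarrow> 'y) \<Rightarrow>
    ('x, ('x, 'm) mor, 'y, ('y, 'm) mor) func" where
  "tagged_fun C D h = \<lparr>Src = C, Tgt = D, OMap = (\<lambda>x \<in> Obj C. h x),
     AMap = (\<lambda>m \<in> Arr C. Mor (h (mor_src m)) (h (mor_tgt m)) (mor_map m))\<rparr>"

definition Dyn where
  "Dyn C T = \<lparr>Src = Poly_cat C, Tgt = Cat, OMap = (\<lambda>p \<in> Obj (Poly_cat C). Dyn_cat C T p),
     AMap = (\<lambda>\<phi> \<in> Arr (Poly_cat C).
       tagged_fun (Dyn_cat C T (mor_src \<phi>)) (Dyn_cat C T (mor_tgt \<phi>)) (reindex C \<phi>))\<rparr>"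


section \<open>Open measure-preserving systems\<close>

text \<open>The arrow \<open>\<alpha>(t) : S \<rightarrow> S\<close> for an element \<open>t : 1 \<rightarrow> T\<close>. The monad need not be strong, so it acts on
  \<open>\<alpha>(t)\<close> only for global elements \<open>t\<close>, and invariance of a measure is required for these.\<close>

definition at_time :: "('o, 'a) category \<Rightarrow> 'o \<Rightarrow> 'a \<Rightarrow> 'a \<Rightarrow> 'a" where
  "at_time C S \<alpha> t = \<alpha> \<cdot>\<^bsub>C\<^esub> pair C (t \<cdot>\<^bsub>C\<^esub> bang C S) (Ident C S)"

definition is_measure_preserving :: "('o, 'a) category \<Rightarrow> ('o, 'a) internal_monoid \<Rightarrow>
    ('o, 'a, 'o, 'a) func \<Rightarrow> 'a \<Rightarrow> ('o, 'a) open_system \<times> 'a \<Rightarrow> bool" where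
  "is_measure_preserving C T P b = (\<lambda>(\<theta>, \<nu>). is_open_system C T b \<theta> \<and>
     \<nu> \<in> hom C (one C) (OMap P (State \<theta>)) \<and>
     (\<forall>t \<in> hom C (one C) (Carrier T). \<forall>\<sigma> \<in> sections C b.
        AMap P (at_time C (State \<theta>) (closure C b \<theta> \<sigma>) t) \<cdot>\<^bsub>C\<^esub> \<nu> = \<nu>))"

definition DynP_cat :: "('o, 'a) category \<Rightarrow> ('o, 'a) internal_monoid \<Rightarrow> ('o, 'a, 'o, 'a) func \<Rightarrow> 'a \<Rightarrow>
    (('o, 'a) open_system \<times> 'a, (('o, 'a) open_system \<times> 'a, 'a) mor) category" where
  "DynP_cat C T P b = tagged_cat {\<theta>\<nu>. is_measure_preserving C T P b \<theta>\<nu>}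
     (\<lambda>(\<theta>, \<nu>) (\<rho>, \<kappa>). {f \<in> Dyn_hom C T b \<theta> \<rho>. AMap P f \<cdot>\<^bsub>C\<^esub> \<nu> = \<kappa>})
     (\<lambda>(\<theta>, \<nu>). Ident C (State \<theta>)) (\<lambda>_ _ _ g f. g \<cdot>\<^bsub>C\<^esub> f)"

definition DynP where
  "DynP C T P = \<lparr>Src = Poly_cat C, Tgt = Cat, OMap = (\<lambda>b \<in> Obj (Poly_cat C). DynP_cat C T P b),
     AMap = (\<lambda>\<chi> \<in> Arr (Poly_cat C). tagged_fun (DynP_cat C T P (mor_src \<chi>)) (DynP_cat C T P (mor_tgt \<chi>))
       (map_prod (reindex C \<chi>) id))\<rparr>"

definition forget_measure :: "('o, 'a) category \<Rightarrow> ('o, 'a) internal_monoid \<Rightarrow>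
    ('o, 'a, 'o, 'a) func \<Rightarrow> 'a \<Rightarrow>
    (('o, 'a) open_system \<times> 'a, (('o, 'a) open_system \<times> 'a, 'a) mor,
      ('o, 'a) open_system, (('o, 'a) open_system, 'a) mor) func" where
  "forget_measure C T P b = tagged_fun (DynP_cat C T P b) (Dyn_cat C T b) fst"


section \<open>Open bundle systems\<close>

definition BunDyn_cat :: "('o, 'a) category \<Rightarrow> ('o, 'a) internal_monoid \<Rightarrow> 'a \<Rightarrow> 'a \<Rightarrow>
    ('o, 'a) open_system \<Rightarrow>
    ('a \<times> ('o, 'a) open_system, ('a \<times> ('o, 'a) open_system, 'a) mor) category" where
  "BunDyn_cat C T p b \<theta> = tagged_cat
     {(\<pi>, \<upsilon>). is_open_system C T p \<upsilon> \<and> \<pi> \<in> hom C (State \<upsilon>) (State \<theta>) \<and>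
        (\<forall>\<sigma> \<in> sections C p. \<forall>\<tau> \<in> sections C b.
           equivariant C T (closure C p \<upsilon> \<sigma>) (closure C b \<theta> \<tau>) \<pi>)}
     (\<lambda>(\<pi>, \<upsilon>) (\<pi>', \<omega>). {f \<in> hom C (State \<upsilon>) (State \<omega>). \<pi>' \<cdot>\<^bsub>C\<^esub> f = \<pi> \<and>
        (\<forall>\<sigma> \<in> sections C p. \<forall>\<tau> \<in> sections C b.
           equivariant C T (closure C p \<upsilon> \<sigma>) (closure C p \<omega> \<sigma>) f)})
     (\<lambda>(\<pi>, \<upsilon>). Ident C (State \<upsilon>)) (\<lambda>_ _ _ g f. g \<cdot>\<^bsub>C\<^esub> f)"

text \<open>An arrow of the index category is a pair of \<open>\<phi> : p \<rightarrow> q\<close> and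
  \<open>Mor (b, \<theta>) (c, \<rho>) (\<chi>, Mor (reindex C \<chi> \<theta>) \<rho> f)\<close>. It acts by the composite of the actions of its
  three components: \<open>\<phi>\<close> reindexes the system, \<open>\<chi>\<close> changes neither component of \<open>(\<pi>, \<upsilon>)\<close>, and the
  morphism of base systems is composed with the projection.\<close>

definition BunDyn where
  "BunDyn C T = \<lparr>Src = prod_cat (Poly_cat C) (groth (Dyn C T)), Tgt = Cat,
     OMap = (\<lambda>(p, (b, \<theta>)) \<in> Obj (prod_cat (Poly_cat C) (groth (Dyn C T))). BunDyn_cat C T p b \<theta>),
     AMap = (\<lambda>(\<phi>, m) \<in> Arr (prod_cat (Poly_cat C) (groth (Dyn C T))).
       tagged_fun
         (BunDyn_cat C T (mor_src \<phi>) (fst (mor_src m)) (snd (mor_src m)))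
         (BunDyn_cat C T (mor_tgt \<phi>) (fst (mor_tgt m)) (snd (mor_tgt m)))
         (\<lambda>(\<pi>, \<upsilon>). (mor_map (snd (mor_map m)) \<cdot>\<^bsub>C\<^esub> \<pi>, reindex C \<phi> \<upsilon>)))\<rparr>"

text \<open>The restriction of \<open>BunDyn\<close> to the systems whose base preserves a measure.\<close>

definition RBDyn where
  "RBDyn C T P = fun_comp (BunDyn C T)
     (prod_fun (fun_id (Poly_cat C)) (groth_map (DynP C T P) (Dyn C T) (forget_measure C T P)))"


section \<open>Passing to total categories in the last variable\<close>

text \<open>For \<open>D : B \<rightarrow> Cat\<close>, a functor \<open>F\<close> from \<open>B \<times> groth D\<close> to \<open>Cat\<close>, and objects \<open>p\<close>, \<open>b\<close> of \<open>B\<close>, the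
  functor \<open>F(p, b, -)\<close> from \<open>D b\<close> to \<open>Cat\<close>.\<close>

definition at_fibre where
  "at_fibre F D p b = \<lparr>Src = OMap D b, Tgt = Cat,
     OMap = (\<lambda>x \<in> Obj (OMap D b). OMap F (p, (b, x))),
     AMap = (\<lambda>h \<in> Arr (OMap D b). AMap F (Ident (Src D) p,
       Mor (b, Dom (OMap D b) h) (b, Cod (OMap D b) h) (Ident (Src D) b, h)))\<rparr>"

text \<open>The assignment to \<open>p\<close> of the family, indexed by the objects \<open>b\<close> of \<open>B\<close>, of the opfibrations over
  \<open>D b\<close> given by the Grothendieck construction of \<open>F(p, b, -)\<close>.\<close>

definition fibrewise_groth where
  "fibrewise_groth F D = \<lparr>Src = Src D, Tgt = Pi_cat (Obj (Src D)) (\<lambda>b. Fib (OMap D b)),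
     OMap = (\<lambda>p \<in> Obj (Src D). \<lambda>b \<in> Obj (Src D). groth_proj (at_fibre F D p b)),
     AMap = (\<lambda>\<phi> \<in> Arr (Src D). \<lambda>b \<in> Obj (Src D).
       let F1 = at_fibre F D (Dom (Src D) \<phi>) b; F2 = at_fibre F D (Cod (Src D) \<phi>) b in
       Mor (groth_proj F1) (groth_proj F2)
         (groth_map F1 F2 (\<lambda>x. AMap F (\<phi>, Ident (groth D) (b, x)))))\<rparr>"

definition int_BunDyn where
  "int_BunDyn C T = fibrewise_groth (BunDyn C T) (Dyn C T)"

definition int_RBDyn where
  "int_RBDyn C T P = fibrewise_groth (RBDyn C T P) (DynP C T P)"

definition int_forget_measure where
  "int_forget_measure C T P p b =
     groth_base_change (at_fibre (BunDyn C T) (Dyn C T) p b) (forget_measure C T P b)"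

end

theory Submission
  imports Defs
begin

text \<open>The heart of the matter is the behaviour of closures under reindexing. A morphism \<open>\<phi> : p \<rightarrow> q\<close>
  of polynomials pulls a section \<open>\<sigma>\<close> of \<open>q\<close> back to a section \<open>i \<mapsto> \<phi>\<^sup>#(i, \<sigma> (\<phi>\<^sub>1 i))\<close> of \<open>p\<close>, and
  the closure at \<open>\<sigma>\<close> of the system reindexed along \<open>\<phi>\<close> is the closure of the original system at the
  pulled back section (\<open>closure_reindex\<close>). Every condition on open systems quantifies over all
  sections of the polynomial: the action laws, equivariance, invariance of a measure. So every one
  of them survives reindexing, and the underlying maps of morphisms can be left unchanged. Together
  with the strict functoriality of reindexing, which is a calculation with pullbacks
  (\<open>base_change_Comp\<close>), this makes \<open>Dyn\<close>, \<open>DynP\<close> and \<open>BunDyn\<close> functors into \<open>Cat\<close>. Products and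
  pullbacks of the ambient category come from products in its slices.

  The rest is formal. Forgetting the measure is a strictly natural family of functors from \<open>DynP\<close>
  to \<open>Dyn\<close>; it induces a functor between their total categories, and \<open>RBDyn\<close> is the composite of
  \<open>BunDyn\<close> with it. For the second functor, let \<open>F\<close> be any functor from \<open>B \<times> groth D\<close> to \<open>Cat\<close>. The
  Grothendieck construction of \<open>F(p, b, -)\<close> is an opfibration over \<open>D b\<close>, and a morphism \<open>p \<rightarrow> q\<close>
  induces a functor over \<open>D b\<close>. This functor preserves opcartesian arrows because an arrow of a
  total category is opcartesian exactly if its fibre component is invertible
  (\<open>opcartesian_imp_iso\<close>, \<open>iso_imp_opcartesian\<close>). Hence \<open>fibrewise_groth_functor\<close>, applied to
  \<open>RBDyn\<close>.

  Restricting \<open>F(p, b, -)\<close> along a functor \<open>U\<close> to \<open>D b\<close> pulls its total category back along \<open>U\<close>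
  (\<open>groth_base_change_pullback\<close>), naturally in \<open>F\<close> (\<open>groth_map_base_change\<close>). For the functor \<open>U\<close>
  that forgets the measure this compares the opfibrations of random bundle systems with those of
  bundle systems.\<close>

section \<open>Categories of tagged maps\<close>

lemma hom_iff: "f \<in> hom C x y \<longleftrightarrow> f \<in> Arr C \<and> Dom C f = x \<and> Cod C f = y"
  by (auto simp: hom_def)

lemma Arr_hom: "f \<in> Arr C \<Longrightarrow> f \<in> hom C (Dom C f) (Cod C f)"
  by (simp add: hom_def)

lemma (in category) hom_Obj:
  assumes "f \<in> hom C x y"
  shows "x \<in> Obj C" "y \<in> Obj C"
  using assms Dom_Obj Cod_Obj by (auto simp: hom_iff)

lemma tagged_cat_simps [simp]:
  "Obj (tagged_cat X H i c) = X"
  "Dom (tagged_cat X H i c) = mor_src"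
  "Cod (tagged_cat X H i c) = mor_tgt"
  "Ident (tagged_cat X H i c) x = Mor x x (i x)"
  "n \<cdot>\<^bsub>tagged_cat X H i c\<^esub> m = Mor (mor_src m) (mor_tgt n)
     (c (mor_src m) (mor_tgt m) (mor_tgt n) (mor_map n) (mor_map m))"
  by (simp_all add: tagged_cat_def)

lemma Arr_tagged_cat [simp]:
  "m \<in> Arr (tagged_cat X H i c) \<longleftrightarrow>
     mor_src m \<in> X \<and> mor_tgt m \<in> X \<and> mor_map m \<in> H (mor_src m) (mor_tgt m)"
  by (cases m) (simp add: tagged_cat_def)

lemma hom_tagged_cat:
  "m \<in> hom (tagged_cat X H i c) x y \<longleftrightarrow> (\<exists>f. m = Mor x y f \<and> x \<in> X \<and> y \<in> X \<and> f \<in> H x y)"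
  by (cases m) (auto simp: hom_iff)

lemma tagged_cat_category:
  assumes "\<And>x. x \<in> X \<Longrightarrow> i x \<in> H x x"
    and "\<And>x y z f g. \<lbrakk>x \<in> X; y \<in> X; z \<in> X; f \<in> H x y; g \<in> H y z\<rbrakk> \<Longrightarrow> c x y z g f \<in> H x z"
    and "\<And>x y f. \<lbrakk>x \<in> X; y \<in> X; f \<in> H x y\<rbrakk> \<Longrightarrow> c x x y f (i x) = f"
    and "\<And>x y f. \<lbrakk>x \<in> X; y \<in> X; f \<in> H x y\<rbrakk> \<Longrightarrow> c x y y (i y) f = f"
    and "\<And>w x y z f g h. \<lbrakk>w \<in> X; x \<in> X; y \<in> X; z \<in> X; f \<in> H w x; g \<in> H x y; h \<in> H y z\<rbrakk> \<Longrightarrow>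
      c w x z (c x y z h g) f = c w y z h (c w x y g f)"
  shows "category (tagged_cat X H i c)"
  by unfold_locales (auto simp: hom_tagged_cat assms)

text \<open>When the maps are arrows of an ambient category, composed there, only closure under
  identities and composition has to be checked. The systems below form categories of this kind,
  with the state space as the underlying object \<open>U x\<close>.\<close>

lemma concrete_category:
  assumes "category C"
    and H: "\<And>x y f. \<lbrakk>x \<in> X; y \<in> X; f \<in> H x y\<rbrakk> \<Longrightarrow> f \<in> hom C (U x) (U y)"
    and i: "\<And>x. x \<in> X \<Longrightarrow> i x = Ident C (U x)"
    and "\<And>x. x \<in> X \<Longrightarrow> i x \<in> H x x"
    and "\<And>x y z f g. \<lbrakk>x \<in> X; y \<in> X; z \<in> X; f \<in> H x y; g \<in> H y z\<rbrakk> \<Longrightarrow> g \<cdot>\<^bsub>C\<^esub> f \<in> H x z"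
  shows "category (tagged_cat X H i (\<lambda>_ _ _ g f. g \<cdot>\<^bsub>C\<^esub> f))"
proof -
  interpret category C by fact
  show ?thesis
    by (rule tagged_cat_category) (use assms in \<open>auto intro!: Comp_Ident Ident_Comp Comp_assoc\<close>)
qed

section \<open>Functors\<close>

lemma is_functorD:
  assumes "is_functor F C D"
  shows "Src F = C" "Tgt F = D" "category C" "category D"
    "x \<in> Obj C \<Longrightarrow> OMap F x \<in> Obj D"
    "f \<in> hom C x y \<Longrightarrow> AMap F f \<in> hom D (OMap F x) (OMap F y)"
    "x \<in> Obj C \<Longrightarrow> AMap F (Ident C x) = Ident D (OMap F x)"
    "f \<in> hom C x y \<Longrightarrow> g \<in> hom C y z \<Longrightarrow> AMap F (g \<cdot>\<^bsub>C\<^esub> f) = AMap F g \<cdot>\<^bsub>D\<^esub> AMap F f"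
    "OMap F \<in> extensional (Obj C)" "AMap F \<in> extensional (Arr C)"
    "f \<in> Arr C \<Longrightarrow> AMap F f \<in> Arr D"
    "f \<in> Arr C \<Longrightarrow> Dom D (AMap F f) = OMap F (Dom C f)"
    "f \<in> Arr C \<Longrightarrow> Cod D (AMap F f) = OMap F (Cod C f)"
proof -
  interpret category_functor F using assms by (simp add: is_functor_def)
  have [simp]: "Src F = C" "Tgt F = D" using assms by (auto simp: is_functor_def)
  show "Src F = C" "Tgt F = D" by simp_all
  show "category C" "category D"
    "x \<in> Obj C \<Longrightarrow> OMap F x \<in> Obj D"
    "f \<in> hom C x y \<Longrightarrow> AMap F f \<in> hom D (OMap F x) (OMap F y)"
    "x \<in> Obj C \<Longrightarrow> AMap F (Ident C x) = Ident D (OMap F x)"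
    "f \<in> hom C x y \<Longrightarrow> g \<in> hom C y z \<Longrightarrow> AMap F (g \<cdot>\<^bsub>C\<^esub> f) = AMap F g \<cdot>\<^bsub>D\<^esub> AMap F f"
    "OMap F \<in> extensional (Obj C)" "AMap F \<in> extensional (Arr C)"
    using Src_category Tgt_category OMap_Obj AMap_hom AMap_Ident AMap_Comp OMap_extensional
      AMap_extensional by simp_all
  assume "f \<in> Arr C"
  then have "AMap F f \<in> hom D (OMap F (Dom C f)) (OMap F (Cod C f))"
    using AMap_hom[OF Arr_hom, of f] by simp
  then show "AMap F f \<in> Arr D" "Dom D (AMap F f) = OMap F (Dom C f)"
    "Cod D (AMap F f) = OMap F (Cod C f)" by (auto simp: hom_iff)
qed

lemma is_functorI:
  assumes "Src F = C" "Tgt F = D" "category C" "category D"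
    and "\<And>x. x \<in> Obj C \<Longrightarrow> OMap F x \<in> Obj D"
    and "\<And>f x y. f \<in> hom C x y \<Longrightarrow> AMap F f \<in> hom D (OMap F x) (OMap F y)"
    and "\<And>x. x \<in> Obj C \<Longrightarrow> AMap F (Ident C x) = Ident D (OMap F x)"
    and "\<And>f g x y z. f \<in> hom C x y \<Longrightarrow> g \<in> hom C y z \<Longrightarrow>
      AMap F (g \<cdot>\<^bsub>C\<^esub> f) = AMap F g \<cdot>\<^bsub>D\<^esub> AMap F f"
    and "OMap F \<in> extensional (Obj C)" "AMap F \<in> extensional (Arr C)"
  shows "is_functor F C D"
  unfolding is_functor_def using assms by (auto intro!: category_functor.intro)

lemma func_eqI:
  fixes F G :: "('o, 'a, 'p, 'b) func"
  assumes "Src F = C" "Src G = C" "Tgt F = Tgt G"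
    and "OMap F \<in> extensional (Obj C)" "OMap G \<in> extensional (Obj C)"
    and "AMap F \<in> extensional (Arr C)" "AMap G \<in> extensional (Arr C)"
    and "\<And>x. x \<in> Obj C \<Longrightarrow> OMap F x = OMap G x"
    and "\<And>f. f \<in> Arr C \<Longrightarrow> AMap F f = AMap G f"
  shows "F = G"
proof -
  have "OMap F = OMap G" "AMap F = AMap G" using assms by (auto intro: extensionalityI)
  with assms(1-3) show ?thesis by (cases F, cases G) simp
qed

lemma fun_id_simps [simp]:
  "Src (fun_id C) = C" "Tgt (fun_id C) = C"
  "x \<in> Obj C \<Longrightarrow> OMap (fun_id C) x = x" "f \<in> Arr C \<Longrightarrow> AMap (fun_id C) f = f"
  "OMap (fun_id C) \<in> extensional (Obj C)" "AMap (fun_id C) \<in> extensional (Arr C)"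
  by (simp_all add: fun_id_def)

lemma fun_comp_simps [simp]:
  "Src (fun_comp G F) = Src F" "Tgt (fun_comp G F) = Tgt G"
  "x \<in> Obj (Src F) \<Longrightarrow> OMap (fun_comp G F) x = OMap G (OMap F x)"
  "f \<in> Arr (Src F) \<Longrightarrow> AMap (fun_comp G F) f = AMap G (AMap F f)"
  "OMap (fun_comp G F) \<in> extensional (Obj (Src F))"
  "AMap (fun_comp G F) \<in> extensional (Arr (Src F))"
  by (simp_all add: fun_comp_def)

lemma fun_id_functor:
  assumes "category C"
  shows "is_functor (fun_id C) C C"
proof -
  interpret category C by fact
  show ?thesis
    using Ident_hom Comp_hom Dom_Obj Cod_Obj by (intro is_functorI) (auto simp: hom_iff assms)
qed

lemma fun_comp_functor:
  assumes F: "is_functor F B C" and G: "is_functor G C D"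
  shows "is_functor (fun_comp G F) B D"
proof (intro is_functorI)
  note [simp] = is_functorD(1,2)[OF F] is_functorD(1,2)[OF G]
  interpret B: category B using is_functorD(3)[OF F] .
  show "category B" by unfold_locales
  show "category D" using is_functorD(4)[OF G] .
  fix f x y assume f: "f \<in> hom B x y"
  then have [simp]: "f \<in> Arr B" "x \<in> Obj B" "y \<in> Obj B" using B.hom_Obj[OF f]
    by (auto simp: hom_iff)
  show "AMap (fun_comp G F) f \<in> hom D (OMap (fun_comp G F) x) (OMap (fun_comp G F) y)"
    using is_functorD(6)[OF G is_functorD(6)[OF F f]] by simp
  fix g z assume g: "g \<in> hom B y z"
  then have [simp]: "g \<in> Arr B" "g \<cdot>\<^bsub>B\<^esub> f \<in> Arr B" using B.Comp_hom[OF f g] by (auto simp: hom_iff)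
  show "AMap (fun_comp G F) (g \<cdot>\<^bsub>B\<^esub> f) = AMap (fun_comp G F) g \<cdot>\<^bsub>D\<^esub> AMap (fun_comp G F) f"
    using is_functorD(8)[OF F f g] is_functorD(8)[OF G is_functorD(6)[OF F f]
        is_functorD(6)[OF F g]]
    by simp
next
  fix x assume x: "x \<in> Obj B"
  interpret B: category B using is_functorD(3)[OF F] .
  have i: "Ident B x \<in> Arr B" using B.Ident_hom[OF x] by (simp add: hom_iff)
  show "AMap (fun_comp G F) (Ident B x) = Ident D (OMap (fun_comp G F) x)"
    using is_functorD(5,7)[OF F x] is_functorD(7)[OF G] x i is_functorD(1)[OF F] by simp
qed (use is_functorD[OF F] is_functorD[OF G] fun_comp_simps(5,6)[of G F] in auto)

lemma fun_comp_assoc: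
  assumes F: "is_functor F A B" and G: "is_functor G B C"
  shows "fun_comp (fun_comp H G) F = fun_comp H (fun_comp G F)"
  using is_functorD[OF F] is_functorD[OF G] fun_comp_simps(5,6)[of _ F] fun_comp_simps(5,6)[of _
      "fun_comp G F"]
  by (intro func_eqI[where C = A]) auto

lemma fun_comp_fun_id:
  assumes F: "is_functor F C D"
  shows "fun_comp F (fun_id C) = F" "fun_comp (fun_id D) F = F"
  using is_functorD[OF F] fun_comp_simps(5,6)[of _ F] fun_comp_simps(5,6)[of _ "fun_id C"]
  by (auto intro!: func_eqI[where C = C])

lemma Cat_simps [simp]:
  "C \<in> Obj Cat \<longleftrightarrow> category C" "Dom Cat = Src" "Cod Cat = Tgt" "Ident Cat = fun_id"
  "Comp Cat = fun_comp" "F \<in> Arr Cat \<longleftrightarrow> category_functor F"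
  "F \<in> hom Cat C D \<longleftrightarrow> is_functor F C D"
  by (auto simp: Cat_def is_functor_def hom_def)

lemma Cat_category: "category Cat"
proof unfold_locales
qed (auto simp: fun_id_functor fun_comp_fun_id intro: fun_comp_functor
    fun_comp_assoc category_functor.Src_category category_functor.Tgt_category)

lemma prod_cat_simps [simp]:
  "Obj (prod_cat C D) = Obj C \<times> Obj D" "Arr (prod_cat C D) = Arr C \<times> Arr D"
  "Dom (prod_cat C D) (f, g) = (Dom C f, Dom D g)"
  "Cod (prod_cat C D) (f, g) = (Cod C f, Cod D g)"
  "Ident (prod_cat C D) (x, y) = (Ident C x, Ident D y)"
  "(f', g') \<cdot>\<^bsub>prod_cat C D\<^esub> (f, g) = (f' \<cdot>\<^bsub>C\<^esub> f, g' \<cdot>\<^bsub>D\<^esub> g)"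
  by (simp_all add: prod_cat_def)

lemma hom_prod_cat [simp]:
  "(f, g) \<in> hom (prod_cat C D) (x, y) (x', y') \<longleftrightarrow> f \<in> hom C x x' \<and> g \<in> hom D y y'"
  by (auto simp: hom_iff)

lemma prod_cat_category:
  assumes "category C" "category D"
  shows "category (prod_cat C D)"
proof -
  interpret C: category C by fact
  interpret D: category D by fact
  show ?thesis
    by unfold_locales
      (auto simp: C.Dom_Obj D.Dom_Obj C.Cod_Obj D.Cod_Obj C.Ident_hom D.Ident_hom C.Comp_Ident
        D.Comp_Ident C.Ident_Comp D.Ident_Comp intro: C.Comp_hom D.Comp_hom C.Comp_assoc
            D.Comp_assoc)
qed

lemma prod_fun_simps [simp]:
  "Src (prod_fun F G) = prod_cat (Src F) (Src G)" "Tgt (prod_fun F G) = prod_cat (Tgt F) (Tgt G)"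
  "x \<in> Obj (Src F) \<Longrightarrow> y \<in> Obj (Src G) \<Longrightarrow> OMap (prod_fun F G) (x, y) = (OMap F x, OMap G y)"
  "f \<in> Arr (Src F) \<Longrightarrow> g \<in> Arr (Src G) \<Longrightarrow> AMap (prod_fun F G) (f, g) = (AMap F f, AMap G g)"
  "OMap (prod_fun F G) \<in> extensional (Obj (Src F) \<times> Obj (Src G))"
  "AMap (prod_fun F G) \<in> extensional (Arr (Src F) \<times> Arr (Src G))"
  by (auto simp: prod_fun_def)

lemma prod_fun_functor:
  assumes F: "is_functor F C D" and G: "is_functor G C' D'"
  shows "is_functor (prod_fun F G) (prod_cat C C') (prod_cat D D')"
proof -
  interpret C: category C using is_functorD(3)[OF F] .
  interpret C': category C' using is_functorD(3)[OF G] .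
  have FG [simp]: "Src F = C" "Tgt F = D" "Src G = C'" "Tgt G = D'"
    using is_functorD(1,2)[OF F] is_functorD(1,2)[OF G] by auto
  show ?thesis
  proof (rule is_functorI)
    fix f x y assume "f \<in> hom (prod_cat C C') x y"
    moreover obtain f1 f2 x1 x2 y1 y2 where [simp]: "f = (f1, f2)" "x = (x1, x2)" "y = (y1, y2)"
      by (cases f, cases x, cases y)
    ultimately have f: "f1 \<in> hom C x1 y1" "f2 \<in> hom C' x2 y2" by auto
    note [simp] = C.hom_Obj[OF f(1)] C'.hom_Obj[OF f(2)]
    have [simp]: "f1 \<in> Arr C" "f2 \<in> Arr C'" using f by (auto simp: hom_iff)
    show "AMap (prod_fun F G) f \<in> hom (prod_cat D D') (OMap (prod_fun F G) x)
        (OMap (prod_fun F G) y)"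
      using is_functorD(6)[OF F f(1)] is_functorD(6)[OF G f(2)] by simp
    fix g z assume "g \<in> hom (prod_cat C C') y z"
    moreover obtain g1 g2 z1 z2 where [simp]: "g = (g1, g2)" "z = (z1, z2)" by (cases g, cases z)
    ultimately have g: "g1 \<in> hom C y1 z1" "g2 \<in> hom C' y2 z2" by auto
    have [simp]: "g1 \<in> Arr C" "g2 \<in> Arr C'" "g1 \<cdot>\<^bsub>C\<^esub> f1 \<in> Arr C" "g2 \<cdot>\<^bsub>C'\<^esub> f2 \<in> Arr C'"
      using g C.Comp_hom[OF f(1) g(1)] C'.Comp_hom[OF f(2) g(2)] by (auto simp: hom_iff)
    show "AMap (prod_fun F G) (g \<cdot>\<^bsub>prod_cat C C'\<^esub> f) =
        AMap (prod_fun F G) g \<cdot>\<^bsub>prod_cat D D'\<^esub> AMap (prod_fun F G) f"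
      using is_functorD(8)[OF F f(1) g(1)] is_functorD(8)[OF G f(2) g(2)] by simp
  next
    fix x assume x: "x \<in> Obj (prod_cat C C')"
    have [simp]: "Ident C y \<in> Arr C" if "y \<in> Obj C" for y
      using C.Ident_hom[OF that] by (simp add: hom_iff)
    have [simp]: "Ident C' y \<in> Arr C'" if "y \<in> Obj C'" for y
      using C'.Ident_hom[OF that] by (simp add: hom_iff)
    show "AMap (prod_fun F G) (Ident (prod_cat C C') x) =
        Ident (prod_cat D D') (OMap (prod_fun F G) x)"
      using x is_functorD(7)[OF F] is_functorD(7)[OF G] by auto
  qed (use is_functorD[OF F] is_functorD[OF G] prod_fun_simps(5,6)[of F G]
      in \<open>auto simp: prod_cat_category\<close>)
qed

lemma Pi_cat_cong:
  assumes "\<And>i. i \<in> I \<Longrightarrow> C i = D i"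
  shows "Pi_cat I C = Pi_cat I D"
  unfolding Pi_cat_def using assms by (auto cong: PiE_cong restrict_cong)

lemma hom_Pi_catI:
  assumes "f \<in> extensional I" "x \<in> extensional I" "y \<in> extensional I"
    and "\<And>i. i \<in> I \<Longrightarrow> f i \<in> hom (C i) (x i) (y i)"
  shows "f \<in> hom (Pi_cat I C) x y"
  using assms by (auto simp: hom_iff Pi_cat_def PiE_def intro!: extensionalityI[where A = I])

lemma hom_Pi_catD:
  assumes "f \<in> hom (Pi_cat I C) x y" "i \<in> I"
  shows "f i \<in> hom (C i) (x i) (y i)"
  using assms by (auto simp: hom_iff Pi_cat_def)

lemma Pi_cat_category:
  assumes C: "\<And>i. i \<in> I \<Longrightarrow> category (C i)"
  shows "category (Pi_cat I C)"
proof -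
  have ext: "f \<in> extensional I" "x \<in> extensional I" "y \<in> extensional I"
    if "f \<in> hom (Pi_cat I C) x y" for f x y
    using that by (auto simp: hom_iff Pi_cat_def PiE_def)
  note D = hom_Pi_catD and [simp] = Pi_cat_def
  show ?thesis
  proof
    fix x assume "x \<in> Obj (Pi_cat I C)"
    then show "Ident (Pi_cat I C) x \<in> hom (Pi_cat I C) x x"
      by (intro hom_Pi_catI) (auto simp: PiE_def intro!: category.Ident_hom[OF C])
  next
    fix f x y g z assume f: "f \<in> hom (Pi_cat I C) x y" and g: "g \<in> hom (Pi_cat I C) y z"
    show "g \<cdot>\<^bsub>Pi_cat I C\<^esub> f \<in> hom (Pi_cat I C) x z"
      using ext[OF f] ext[OF g]
      by (intro hom_Pi_catI) (auto intro: category.Comp_hom[OF C] D[OF f] D[OF g])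
  next
    fix f x y assume f: "f \<in> hom (Pi_cat I C) x y"
    show "f \<cdot>\<^bsub>Pi_cat I C\<^esub> Ident (Pi_cat I C) x = f" "Ident (Pi_cat I C) y \<cdot>\<^bsub>Pi_cat I C\<^esub> f = f"
      using ext[OF f] category.Comp_Ident[OF C D[OF f]] category.Ident_Comp[OF C D[OF f]]
      by (auto intro!: extensionalityI[where A = I])
  next
    fix f w x g y h z
    assume f: "f \<in> hom (Pi_cat I C) w x" and g: "g \<in> hom (Pi_cat I C) x y"
      and h: "h \<in> hom (Pi_cat I C) y z"
    show "(h \<cdot>\<^bsub>Pi_cat I C\<^esub> g) \<cdot>\<^bsub>Pi_cat I C\<^esub> f = h \<cdot>\<^bsub>Pi_cat I C\<^esub> (g \<cdot>\<^bsub>Pi_cat I C\<^esub> f)"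
      using category.Comp_assoc[OF C D[OF f] D[OF g] D[OF h]]
      by (auto intro!: extensionalityI[where A = I])
  qed (auto simp: PiE_def Pi_iff category.Dom_Obj[OF C] category.Cod_Obj[OF C])
qed

lemma tagged_fun_simps [simp]:
  "Src (tagged_fun C D h) = C" "Tgt (tagged_fun C D h) = D"
  "x \<in> Obj C \<Longrightarrow> OMap (tagged_fun C D h) x = h x"
  "m \<in> Arr C \<Longrightarrow> AMap (tagged_fun C D h) m = Mor (h (mor_src m)) (h (mor_tgt m)) (mor_map m)"
  "OMap (tagged_fun C D h) \<in> extensional (Obj C)" "AMap (tagged_fun C D h) \<in> extensional (Arr C)"
  by (simp_all add: tagged_fun_def)

lemma tagged_fun_functor:
  assumes C: "C = tagged_cat X H i (\<lambda>_ _ _. k)" and D: "D = tagged_cat Y H' i' (\<lambda>_ _ _. k)"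
    and cat: "category C" "category D"
    and h: "\<And>x. x \<in> X \<Longrightarrow> h x \<in> Y" "\<And>x. x \<in> X \<Longrightarrow> i' (h x) = i x"
      "\<And>x y m. \<lbrakk>x \<in> X; y \<in> X; m \<in> H x y\<rbrakk> \<Longrightarrow> m \<in> H' (h x) (h y)"
  shows "is_functor (tagged_fun C D h) C D"
proof -
  interpret C: category C by fact
  have Id: "Ident C x \<in> Arr C" if "x \<in> X" for x
    using C.Ident_hom[of x] that by (auto simp: hom_iff C)
  have Co: "g \<cdot>\<^bsub>C\<^esub> f \<in> Arr C" if "f \<in> hom C x y" "g \<in> hom C y z" for f g x y z
    using C.Comp_hom[OF that] by (simp add: hom_iff)
  show ?thesis
  proof (rule is_functorI)
    fix f x y assume f: "f \<in> hom C x y"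
    then show "AMap (tagged_fun C D h) f \<in> hom D (OMap (tagged_fun C D h) x)
        (OMap (tagged_fun C D h) y)"
      by (auto simp: C D h hom_tagged_cat)
    fix g z assume g: "g \<in> hom C y z"
    show "AMap (tagged_fun C D h) (g \<cdot>\<^bsub>C\<^esub> f) =
        AMap (tagged_fun C D h) g \<cdot>\<^bsub>D\<^esub> AMap (tagged_fun C D h) f"
      using Co[OF f g] f g by (auto simp: C D h hom_tagged_cat)
  qed (use cat h Id tagged_fun_simps(5)[of C D h] in \<open>auto simp: C D simp del: Arr_tagged_cat\<close>)
qed

lemma tagged_fun_id:
  assumes "C = tagged_cat X H i k" "\<And>x. x \<in> X \<Longrightarrow> h x = x"
  shows "tagged_fun C C h = fun_id C"
  using assms tagged_fun_simps(5)[of C C h] fun_id_simps(5)[of C]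
  by (intro func_eqI[where C = C]) (auto simp: mor.expand)

lemma tagged_fun_comp:
  assumes "is_functor (tagged_fun B C h) B C" "B = tagged_cat X H i l"
    "\<And>x. x \<in> X \<Longrightarrow> k (h x) = j x"
  shows "fun_comp (tagged_fun C D k) (tagged_fun B C h) = tagged_fun B D j"
  using is_functorD(5,11)[OF assms(1)] assms(2,3) tagged_fun_simps(5)[of B D j]
     fun_comp_simps(5,6)[of "tagged_fun C D k" "tagged_fun B C h"]
  by (intro func_eqI[where C = B]) auto

section \<open>The Grothendieck construction\<close>

locale indexed_category =
  fixes F :: "('o, 'a, ('x, 'm) category, ('x, 'm, 'x, 'm) func) func" and B
  assumes F: "is_functor F B Cat"
begin

sublocale base: category B
  using is_functorD(3)[OF F] .

lemma Src_F [simp]: "Src F = B"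
  using is_functorD(1)[OF F] .

lemma fibre_category: "c \<in> Obj B \<Longrightarrow> category (OMap F c)"
  using is_functorD(5)[OF F] by simp

lemma push_functor: "f \<in> hom B c d \<Longrightarrow> is_functor (AMap F f) (OMap F c) (OMap F d)"
  using is_functorD(6)[OF F] by simp

lemma push_obj: "f \<in> hom B c d \<Longrightarrow> x \<in> Obj (OMap F c) \<Longrightarrow> OMap (AMap F f) x \<in> Obj (OMap F d)"
  using is_functorD(5)[OF push_functor] .

lemma push_hom: "f \<in> hom B c d \<Longrightarrow> g \<in> hom (OMap F c) x y \<Longrightarrow>
    AMap (AMap F f) g \<in> hom (OMap F d) (OMap (AMap F f) x) (OMap (AMap F f) y)"
  using is_functorD(6)[OF push_functor] .

lemma push_Ident:
  assumes "c \<in> Obj B"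
  shows "x \<in> Obj (OMap F c) \<Longrightarrow> OMap (AMap F (Ident B c)) x = x"
    "g \<in> hom (OMap F c) x y \<Longrightarrow> AMap (AMap F (Ident B c)) g = g"
  using is_functorD(7)[OF F assms] by (auto simp: hom_iff)

lemma push_Comp:
  assumes "f \<in> hom B c d" "f' \<in> hom B d e"
  shows "x \<in> Obj (OMap F c) \<Longrightarrow>
      OMap (AMap F (f' \<cdot>\<^bsub>B\<^esub> f)) x = OMap (AMap F f') (OMap (AMap F f) x)"
    "g \<in> hom (OMap F c) x y \<Longrightarrow>
      AMap (AMap F (f' \<cdot>\<^bsub>B\<^esub> f)) g = AMap (AMap F f') (AMap (AMap F f) g)"
  using is_functorD(8)[OF F assms] is_functorD(1)[OF push_functor[OF assms(1)]]
  by (auto simp: hom_iff)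

lemma groth_simps [simp]:
  "(c, x) \<in> Obj (groth F) \<longleftrightarrow> c \<in> Obj B \<and> x \<in> Obj (OMap F c)"
  "Dom (groth F) m = mor_src m" "Cod (groth F) m = mor_tgt m"
  "Ident (groth F) (c, x) = Mor (c, x) (c, x) (Ident B c, Ident (OMap F c) x)"
  "Mor (d', y') (e, z) (f', g') \<cdot>\<^bsub>groth F\<^esub> Mor (c, x) (d, y) (f, g) =
    Mor (c, x) (e, z) (f' \<cdot>\<^bsub>B\<^esub> f, g' \<cdot>\<^bsub>OMap F e\<^esub> AMap (AMap F f') g)"
  by (simp_all add: groth_def)

lemma hom_groth:
  "m \<in> hom (groth F) (c, x) (d, y) \<longleftrightarrow> (\<exists>f g. m = Mor (c, x) (d, y) (f, g) \<and> x \<in> Obj (OMap F c) \<and>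
     f \<in> hom B c d \<and> g \<in> hom (OMap F d) (OMap (AMap F f) x) y)"
  using base.hom_Obj category.hom_Obj[OF fibre_category]
  by (fastforce simp: groth_def hom_tagged_cat)

lemma groth_homE:
  assumes "m \<in> hom (groth F) X Y"
  obtains c x d y f g where "X = (c, x)" "Y = (d, y)" "m = Mor (c, x) (d, y) (f, g)"
    "f \<in> hom B c d" "g \<in> hom (OMap F d) (OMap (AMap F f) x) y" "x \<in> Obj (OMap F c)"
    "y \<in> Obj (OMap F d)" "c \<in> Obj B" "d \<in> Obj B"
proof -
  obtain c x d y where [simp]: "X = (c, x)" "Y = (d, y)" by (cases X, cases Y)
  obtain f g where m: "m = Mor (c, x) (d, y) (f, g)" "x \<in> Obj (OMap F c)" "f \<in> hom B c d"
    "g \<in> hom (OMap F d) (OMap (AMap F f) x) y"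
    using assms by (auto simp: hom_groth)
  have "c \<in> Obj B" "d \<in> Obj B" using base.hom_Obj[OF m(3)] by auto
  moreover from this have "y \<in> Obj (OMap F d)" using category.hom_Obj[OF fibre_category m(4)]
    by auto
  ultimately show thesis using that m by auto
qed

lemma groth_homI:
  "x \<in> Obj (OMap F c) \<Longrightarrow> f \<in> hom B c d \<Longrightarrow> g \<in> hom (OMap F d) (OMap (AMap F f) x) y \<Longrightarrow>
    Mor (c, x) (d, y) (f, g) \<in> hom (groth F) (c, x) (d, y)"
  by (auto simp: hom_groth)

lemma groth_category: "category (groth F)"
proof
  fix m assume "m \<in> Arr (groth F)"
  then have "m \<in> hom (groth F) (mor_src m) (mor_tgt m)" by (simp add: hom_iff)
  then show "Dom (groth F) m \<in> Obj (groth F)" "Cod (groth F) m \<in> Obj (groth F)"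
    by (auto elim!: groth_homE)
next
  fix X assume "X \<in> Obj (groth F)"
  then show "Ident (groth F) X \<in> hom (groth F) X X"
    by (cases X) (auto intro!: groth_homI base.Ident_hom category.Ident_hom[OF fibre_category]
        simp: push_Ident)
next
  fix m X Y assume "m \<in> hom (groth F) X Y"
  then show "m \<cdot>\<^bsub>groth F\<^esub> Ident (groth F) X = m" "Ident (groth F) Y \<cdot>\<^bsub>groth F\<^esub> m = m"
  proof (atomize(full), elim groth_homE)
    fix c x d y f g
    assume [simp]: "X = (c, x)" "Y = (d, y)" "m = Mor (c, x) (d, y) (f, g)"
      and f: "f \<in> hom B c d" and g: "g \<in> hom (OMap F d) (OMap (AMap F f) x) y"
      and [simp]: "x \<in> Obj (OMap F c)" "y \<in> Obj (OMap F d)" "c \<in> Obj B" "d \<in> Obj B"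
    interpret d: category "OMap F d" by (simp add: fibre_category)
    show "m \<cdot>\<^bsub>groth F\<^esub> Ident (groth F) X = m \<and> Ident (groth F) Y \<cdot>\<^bsub>groth F\<^esub> m = m"
      using base.Comp_Ident[OF f] base.Ident_Comp[OF f] d.Comp_Ident[OF g] d.Ident_Comp[OF g]
        is_functorD(7)[OF push_functor[OF f]] push_Ident(2)[OF _ g] by simp
  qed
next
  fix m X Y n Z assume "m \<in> hom (groth F) X Y" "n \<in> hom (groth F) Y Z"
  then show "n \<cdot>\<^bsub>groth F\<^esub> m \<in> hom (groth F) X Z"
  proof (elim groth_homE, hypsubst)
    fix c x d y f g d' y' e z f' g'
    assume f: "f \<in> hom B c d" and g: "g \<in> hom (OMap F d) (OMap (AMap F f) x) y"
      and x: "x \<in> Obj (OMap F c)" and "y \<in> Obj (OMap F d)" "c \<in> Obj B" "d \<in> Obj B"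
      and eq: "(d, y) = (d', y')"
      and f': "f' \<in> hom B d' e" and g': "g' \<in> hom (OMap F e) (OMap (AMap F f') y') z"
      and e: "e \<in> Obj B"
    from eq have [simp]: "d' = d" "y' = y" by auto
    note f' = f'[simplified] and g' = g'[simplified]
    interpret e: category "OMap F e" using e by (simp add: fibre_category)
    show "Mor (d', y') (e, z) (f', g') \<cdot>\<^bsub>groth F\<^esub> Mor (c, x) (d, y) (f, g) \<in> hom (groth F) (c,
        x) (e, z)"
      using push_hom[OF f' g] x e.Comp_hom[OF _ g'] base.Comp_hom[OF f f']
      by (auto intro!: groth_homI simp: push_Comp[OF f f'])
  qed
next
  fix m1 W X m2 Y m3 Z
  assume m: "m1 \<in> hom (groth F) W X" "m2 \<in> hom (groth F) X Y" "m3 \<in> hom (groth F) Y Z"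
  from m(1) obtain b w c x f1 g1 where 1: "W = (b, w)" "X = (c, x)"
      "m1 = Mor (b, w) (c, x) (f1, g1)"
    "f1 \<in> hom B b c" "g1 \<in> hom (OMap F c) (OMap (AMap F f1) w) x" "w \<in> Obj (OMap F b)"
    by (rule groth_homE)
  from m(2) 1 obtain d y f2 g2 where 2: "Y = (d, y)" "m2 = Mor (c, x) (d, y) (f2, g2)"
    "f2 \<in> hom B c d" "g2 \<in> hom (OMap F d) (OMap (AMap F f2) x) y" "x \<in> Obj (OMap F c)"
    by (auto elim: groth_homE)
  from m(3) 2 obtain e z f3 g3 where 3: "Z = (e, z)" "m3 = Mor (d, y) (e, z) (f3, g3)"
    "f3 \<in> hom B d e" "g3 \<in> hom (OMap F e) (OMap (AMap F f3) y) z" "y \<in> Obj (OMap F d)" "e \<in> Obj B"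
    by (auto elim: groth_homE)
  interpret e: category "OMap F e" using 3 by (simp add: fibre_category)
  note h21 = push_hom[OF 2(3) 1(5)]
  show "(m3 \<cdot>\<^bsub>groth F\<^esub> m2) \<cdot>\<^bsub>groth F\<^esub> m1 = m3 \<cdot>\<^bsub>groth F\<^esub> (m2 \<cdot>\<^bsub>groth F\<^esub> m1)"
    using 1(1-3) 2(1,2) 3(1,2) base.Comp_assoc[OF 1(4) 2(3) 3(3)] push_Comp(2)[OF 2(3) 3(3) 1(5)]
      is_functorD(8)[OF push_functor[OF 3(3)] h21 2(4)]
      e.Comp_assoc[OF push_hom[OF 3(3) h21] push_hom[OF 3(3) 2(4)] 3(4)] by simp
qed

lemma Arr_grothE:
  assumes "m \<in> Arr (groth F)"
  obtains c x d y f g where "m = Mor (c, x) (d, y) (f, g)"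
    "f \<in> hom B c d" "g \<in> hom (OMap F d) (OMap (AMap F f) x) y" "x \<in> Obj (OMap F c)"
    "y \<in> Obj (OMap F d)" "c \<in> Obj B" "d \<in> Obj B"
  using Arr_hom[OF assms] by (elim groth_homE) (use that in auto)

lemma groth_proj_simps [simp]:
  "Src (groth_proj F) = groth F" "Tgt (groth_proj F) = B"
  "X \<in> Obj (groth F) \<Longrightarrow> OMap (groth_proj F) X = fst X"
  "m \<in> Arr (groth F) \<Longrightarrow> AMap (groth_proj F) m = fst (mor_map m)"
  "OMap (groth_proj F) \<in> extensional (Obj (groth F))"
  "AMap (groth_proj F) \<in> extensional (Arr (groth F))"
  by (simp_all add: groth_proj_def)

lemma groth_proj_functor: "is_functor (groth_proj F) (groth F) B"
proof (rule is_functorI)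
  interpret G: category "groth F" by (rule groth_category)
  fix m X Y assume m: "m \<in> hom (groth F) X Y"
  then have [simp]: "m \<in> Arr (groth F)" by (simp add: hom_iff)
  show "AMap (groth_proj F) m \<in> hom B (OMap (groth_proj F) X) (OMap (groth_proj F) Y)"
    using m by (auto simp: G.hom_Obj[OF m] elim!: groth_homE)
  fix n Z assume n: "n \<in> hom (groth F) Y Z"
  then have [simp]: "n \<in> Arr (groth F)" "n \<cdot>\<^bsub>groth F\<^esub> m \<in> Arr (groth F)"
    using G.Comp_hom[OF m n] by (auto simp: hom_iff)
  show "AMap (groth_proj F) (n \<cdot>\<^bsub>groth F\<^esub> m) = AMap (groth_proj F) n \<cdot>\<^bsub>B\<^esub> AMap (groth_proj F) m"
    using m n by (simp, elim groth_homE) auto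
next
  interpret G: category "groth F" by (rule groth_category)
  fix X assume X: "X \<in> Obj (groth F)"
  have "Ident (groth F) X \<in> Arr (groth F)" using G.Ident_hom[OF X] by (simp add: hom_iff)
  then show "AMap (groth_proj F) (Ident (groth F) X) = Ident B (OMap (groth_proj F) X)"
    using X by (cases X) simp
qed (auto simp: groth_category base.category_axioms)

text \<open>Factoring \<open>(f, id)\<close> through an opcartesian \<open>(f, g)\<close> gives a left inverse of \<open>g\<close>. It is a right
  inverse as well, because \<open>(f, g)\<close> factors through itself in only one way.\<close>

lemma opcartesian_imp_iso:
  assumes op: "opcartesian (groth_proj F) (Mor (c, x) (d, y) (f, g))"
  shows "Mor (c, x) (d, y) (f, g) \<in> hom (groth F) (c, x) (d, y)"
    "\<exists>g' \<in> hom (OMap F d) y (OMap (AMap F f) x).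
      g' \<cdot>\<^bsub>OMap F d\<^esub> g = Ident (OMap F d) (OMap (AMap F f) x) \<and> g \<cdot>\<^bsub>OMap F d\<^esub> g' = Ident (OMap F d)
          y"
proof -
  let ?h = "Mor (c, x) (d, y) (f, g)"
  let ?x = "OMap (AMap F f) x"
  have hA: "?h \<in> Arr (groth F)" using op by (simp add: opcartesian_def)
  then show h: "?h \<in> hom (groth F) (c, x) (d, y)" by (simp add: hom_iff)
  then have x: "x \<in> Obj (OMap F c)" and f: "f \<in> hom B c d" and g: "g \<in> hom (OMap F d) ?x y"
    by (auto simp: hom_groth)
  have d: "d \<in> Obj B" and "f \<in> Arr B" using base.hom_Obj[OF f] f by (auto simp: hom_iff)
  interpret d: category "OMap F d" using d by (rule fibre_category)
  note Idd = base.Ident_hom[OF d]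
  \<comment> \<open>Factorizations of \<open>(f, k)\<close> through \<open>h\<close> over the identity of \<open>d\<close> are, by \<open>fib\<close> and \<open>gen\<close>, the
    same as factorizations of \<open>k\<close> through \<open>g\<close> in the fibre over \<open>d\<close>.\<close>
  have fac: "\<exists>!v. v \<in> hom (groth F) (d, y) (d, z) \<and> v \<cdot>\<^bsub>groth F\<^esub> ?h = Mor (c, x) (d, z) (f, k) \<and>
      AMap (groth_proj F) v = Ident B d" if k: "k \<in> hom (OMap F d) ?x z" for k z
  proof -
    have "Mor (c, x) (d, z) (f, k) \<in> Arr (groth F)"
      using groth_homI[OF x f k] by (simp add: hom_iff)
    with op[unfolded opcartesian_def, THEN conjunct2, THEN bspec, THEN bspec, of
        "Mor (c, x) (d, z) (f, k)" "Ident B d"]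
    show ?thesis using hA f Idd base.Ident_Comp[OF f] by (auto simp: hom_iff)
  qed
  have fib: "\<exists>w \<in> hom (OMap F d) y z. v = Mor (d, y) (d, z) (Ident B d, w) \<and> w \<cdot>\<^bsub>OMap F d\<^esub> g = k"
    if v: "v \<in> hom (groth F) (d, y) (d, z)" "v \<cdot>\<^bsub>groth F\<^esub> ?h = Mor (c, x) (d, z) (f, k)"
      "AMap (groth_proj F) v = Ident B d" for v z k
  proof -
    from v(1) obtain u w where v': "v = Mor (d, y) (d, z) (u, w)" "y \<in> Obj (OMap F d)"
      "w \<in> hom (OMap F d) (OMap (AMap F u) y) z" by (auto simp: hom_groth)
    have "v \<in> Arr (groth F)" using v(1) by (simp add: hom_iff)
    with v v' show ?thesis using push_Ident[OF d] push_Ident(2)[OF d g] by auto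
  qed
  have gen: "Mor (d, y) (d, z) (Ident B d, w) \<in> hom (groth F) (d, y) (d, z) \<and>
      Mor (d, y) (d, z) (Ident B d, w) \<cdot>\<^bsub>groth F\<^esub> ?h = Mor (c, x) (d, z) (f, w \<cdot>\<^bsub>OMap F d\<^esub> g) \<and>
      AMap (groth_proj F) (Mor (d, y) (d, z) (Ident B d, w)) = Ident B d"
    if w: "w \<in> hom (OMap F d) y z" for w z
  proof -
    have "y \<in> Obj (OMap F d)" using d.hom_Obj[OF w] by simp
    then have m: "Mor (d, y) (d, z) (Ident B d, w) \<in> hom (groth F) (d, y) (d, z)"
      using w by (intro groth_homI) (auto simp: Idd push_Ident[OF d])
    then have "Mor (d, y) (d, z) (Ident B d, w) \<in> Arr (groth F)" by (simp add: hom_iff)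
    with m show ?thesis using base.Ident_Comp[OF f] push_Ident(2)[OF d g] by simp
  qed
  have "Ident (OMap F d) ?x \<in> hom (OMap F d) ?x ?x" using d.Ident_hom d.hom_Obj[OF g] by simp
  from fac[OF this] fib obtain g' where g': "g' \<in> hom (OMap F d) y ?x"
    "g' \<cdot>\<^bsub>OMap F d\<^esub> g = Ident (OMap F d) ?x" by blast
  let ?e = "g \<cdot>\<^bsub>OMap F d\<^esub> g'" and ?i = "Ident (OMap F d) y"
  have e: "?e \<in> hom (OMap F d) y y" using d.Comp_hom[OF g'(1) g] .
  have i: "?i \<in> hom (OMap F d) y y" using d.Ident_hom d.hom_Obj[OF g] by simp
  have eg: "?e \<cdot>\<^bsub>OMap F d\<^esub> g = g" "?i \<cdot>\<^bsub>OMap F d\<^esub> g = g"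
    using d.Comp_assoc[OF g g'(1) g] g'(2) d.Comp_Ident[OF g] d.Ident_Comp[OF g] by auto
  have "Mor (d, y) (d, y) (Ident B d, ?e) = Mor (d, y) (d, y) (Ident B d, ?i)"
    by (rule ex1E[OF fac[OF g]], rule trans[OF _ sym])
      (use gen[OF e, unfolded eg] gen[OF i, unfolded eg] in blast)+
  then show "\<exists>g' \<in> hom (OMap F d) y ?x. g' \<cdot>\<^bsub>OMap F d\<^esub> g = Ident (OMap F d) ?x \<and>
      g \<cdot>\<^bsub>OMap F d\<^esub> g' = Ident (OMap F d) y"
    using g' by auto
qed

text \<open>Factorizations are obtained by composing with the inverse of \<open>g\<close>. Together with its converse,
  this makes opcartesian arrows stable under functors between the fibres, which preserve inverses.\<close>

lemma iso_imp_opcartesian: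
  assumes h: "Mor (c, x) (d, y) (f, g) \<in> hom (groth F) (c, x) (d, y)"
    and g': "g' \<in> hom (OMap F d) y (OMap (AMap F f) x)"
      "g' \<cdot>\<^bsub>OMap F d\<^esub> g = Ident (OMap F d) (OMap (AMap F f) x)"
      "g \<cdot>\<^bsub>OMap F d\<^esub> g' = Ident (OMap F d) y"
  shows "opcartesian (groth_proj F) (Mor (c, x) (d, y) (f, g))"
proof -
  let ?h = "Mor (c, x) (d, y) (f, g)"
  let ?x = "OMap (AMap F f) x"
  from h have x: "x \<in> Obj (OMap F c)" and f: "f \<in> hom B c d" and g: "g \<in> hom (OMap F d) ?x y"
    by (auto simp: hom_groth)
  have hA: "?h \<in> Arr (groth F)" using h by (simp add: hom_iff)
  have "\<exists>!v. v \<in> hom (groth F) (d, y) (mor_tgt k) \<and> v \<cdot>\<^bsub>groth F\<^esub> ?h = k \<and> AMap (groth_proj F) v = u"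
    if k: "k \<in> Arr (groth F)" and u: "u \<in> hom B d (Cod B (AMap (groth_proj F) k))"
      and uf: "u \<cdot>\<^bsub>B\<^esub> f = AMap (groth_proj F) k" and src: "mor_src k = (c, x)" for k u
  proof -
    from k src obtain e z j where k': "k = Mor (c, x) (e, z) (u \<cdot>\<^bsub>B\<^esub> f, j)"
      "u \<cdot>\<^bsub>B\<^esub> f \<in> hom B c e" "j \<in> hom (OMap F e) (OMap (AMap F (u \<cdot>\<^bsub>B\<^esub> f)) x) z" "e \<in> Obj B"
      using uf[symmetric] by (auto elim!: Arr_grothE)
    with u uf[symmetric] have u: "u \<in> hom B d e" by (simp add: hom_iff)
    interpret e: category "OMap F e" using k'(4) by (rule fibre_category)
    have ux: "OMap (AMap F (u \<cdot>\<^bsub>B\<^esub> f)) x = OMap (AMap F u) ?x" using push_Comp(1)[OF f u x] .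
    note U = push_functor[OF u]
    note j = k'(3)[unfolded ux]
    interpret d: category "OMap F d" by (rule is_functorD(3)[OF U])
    let ?w = "j \<cdot>\<^bsub>OMap F e\<^esub> AMap (AMap F u) g'"
    have w: "?w \<in> hom (OMap F e) (OMap (AMap F u) y) z"
      using e.Comp_hom[OF push_hom[OF u g'(1)] j] .
    have y: "y \<in> Obj (OMap F d)" using d.hom_Obj[OF g] by simp
    have Ug: "AMap (AMap F u) g' \<cdot>\<^bsub>OMap F e\<^esub> AMap (AMap F u) g =
        Ident (OMap F e) (OMap (AMap F u) ?x)"
      "AMap (AMap F u) g \<cdot>\<^bsub>OMap F e\<^esub> AMap (AMap F u) g' = Ident (OMap F e) (OMap (AMap F u) y)"
      using is_functorD(8)[OF U g g'(1)] is_functorD(8)[OF U g'(1) g] g'(2,3) is_functorD(7)[OF U]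
        d.hom_Obj[OF g] by auto
    have wg: "?w \<cdot>\<^bsub>OMap F e\<^esub> AMap (AMap F u) g = j"
      using e.Comp_assoc[OF push_hom[OF u g] push_hom[OF u g'(1)] j] Ug(1) e.Comp_Ident[OF j]
        by simp
    show ?thesis
    proof (rule ex1I[where a = "Mor (d, y) (e, z) (u, ?w)"])
      have "Mor (d, y) (e, z) (u, ?w) \<in> hom (groth F) (d, y) (e, z)" by (rule groth_homI[OF y u w])
      then show "Mor (d, y) (e, z) (u, ?w) \<in> hom (groth F) (d, y) (mor_tgt k) \<and>
          Mor (d, y) (e, z) (u, ?w) \<cdot>\<^bsub>groth F\<^esub> ?h = k \<and>
          AMap (groth_proj F) (Mor (d, y) (e, z) (u, ?w)) = u"
        using wg k'(1) by (auto simp: hom_iff)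
    next
      fix v assume v: "v \<in> hom (groth F) (d, y) (mor_tgt k) \<and> v \<cdot>\<^bsub>groth F\<^esub> ?h = k \<and>
          AMap (groth_proj F) v = u"
      then have "v \<in> Arr (groth F)" by (simp add: hom_iff)
      with v k'(1) obtain w' where v': "v = Mor (d, y) (e, z) (u, w')"
        and w': "w' \<in> hom (OMap F e) (OMap (AMap F u) y) z" by (auto simp: hom_groth)
      with v k'(1) have wj: "w' \<cdot>\<^bsub>OMap F e\<^esub> AMap (AMap F u) g = j" by simp
      have "w' = ?w"
        using e.Comp_assoc[OF push_hom[OF u g'(1)] push_hom[OF u g] w'] Ug(2) e.Comp_Ident[OF w'] wj
        by simp
      with v' show "v = Mor (d, y) (e, z) (u, ?w)" by simp
    qed
  qed
  then show ?thesis using hA f by (auto simp: opcartesian_def hom_iff)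
qed

lemma groth_proj_opfibration: "opfibration (groth_proj F)"
proof -
  have "\<exists>h. opcartesian (groth_proj F) h \<and> mor_src h = (c, x) \<and> AMap (groth_proj F) h = f"
    if c: "c \<in> Obj B" "x \<in> Obj (OMap F c)" and f: "f \<in> Arr B" "Dom B f = c" for c x f
  proof -
    let ?d = "Cod B f" and ?y = "OMap (AMap F f) x"
    have f': "f \<in> hom B c ?d" using f by (simp add: hom_iff)
    interpret d: category "OMap F ?d" by (intro fibre_category base.Cod_Obj f)
    note i = d.Ident_hom[OF push_obj[OF f' c(2)]]
    have h: "Mor (c, x) (?d, ?y) (f, Ident (OMap F ?d) ?y) \<in> hom (groth F) (c, x) (?d, ?y)"
      by (rule groth_homI[OF c(2) f' i])
    \<comment> \<open>The identity of the pushed forward object is invertible, so \<open>(f, id)\<close> is an opcartesian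
      lift.\<close>
    show ?thesis
      using iso_imp_opcartesian[OF h i] d.Comp_Ident[OF i] h
      by (intro exI[of _ "Mor (c, x) (?d, ?y) (f, Ident (OMap F ?d) ?y)"]) (simp add: hom_iff)
  qed
  then show ?thesis
    using groth_proj_functor by (auto simp: opfibration_def is_functor_def)
qed

end

section \<open>Strictly natural families\<close>

text \<open>Naturality is equality of functors, not natural isomorphism: the fibre component of an arrow
  of the total category starts at a pushed forward object, so the component functors can be applied
  to it only if they commute with pushing forward on the nose.\<close>

definition strictly_natural :: "('o, 'a, ('x, 'm) category, ('x, 'm, 'x, 'm) func) func \<Rightarrow>
    ('o, 'a, ('y, 'n) category, ('y, 'n, 'y, 'n) func) func \<Rightarrow> ('o \<Rightarrow> ('x, 'm, 'y, 'n) func) \<Rightarrow>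
        bool" where
  "strictly_natural F G \<eta> \<longleftrightarrow>
     (\<forall>c \<in> Obj (Src F). is_functor (\<eta> c) (OMap F c) (OMap G c)) \<and>
     (\<forall>f \<in> Arr (Src F). fun_comp (\<eta> (Cod (Src F) f)) (AMap F f) = fun_comp (AMap G f)
         (\<eta> (Dom (Src F) f)))"

locale indexed_functor = F: indexed_category F B + G: indexed_category G B
  for F :: "('o, 'a, ('x, 'm) category, ('x, 'm, 'x, 'm) func) func"
    and G :: "('o, 'a, ('y, 'n) category, ('y, 'n, 'y, 'n) func) func" and B +
  fixes \<eta> :: "'o \<Rightarrow> ('x, 'm, 'y, 'n) func"
  assumes nat: "strictly_natural F G \<eta>"
begin

lemma component: "c \<in> Obj B \<Longrightarrow> is_functor (\<eta> c) (OMap F c) (OMap G c)"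
  using nat by (simp add: strictly_natural_def)

lemma component_push:
  assumes f: "f \<in> hom B c d"
  shows "x \<in> Obj (OMap F c) \<Longrightarrow> OMap (\<eta> d) (OMap (AMap F f) x) = OMap (AMap G f) (OMap (\<eta> c) x)"
    "g \<in> hom (OMap F c) x y \<Longrightarrow> AMap (\<eta> d) (AMap (AMap F f) g) = AMap (AMap G f) (AMap (\<eta> c) g)"
proof -
  have c: "c \<in> Obj B" using F.base.hom_Obj[OF f] by simp
  have n: "fun_comp (\<eta> d) (AMap F f) = fun_comp (AMap G f) (\<eta> c)"
    using nat f by (auto simp: strictly_natural_def hom_iff)
  have [simp]: "Src (AMap F f) = OMap F c" "Src (\<eta> c) = OMap F c"
    using is_functorD(1)[OF F.push_functor[OF f]] is_functorD(1)[OF component[OF c]] by auto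
  show "OMap (\<eta> d) (OMap (AMap F f) x) = OMap (AMap G f) (OMap (\<eta> c) x)" if "x \<in> Obj (OMap F c)"
    using arg_cong[OF n, of "\<lambda>H. OMap H x"] that by simp
  show "AMap (\<eta> d) (AMap (AMap F f) g) = AMap (AMap G f) (AMap (\<eta> c) g)" if "g \<in> hom (OMap F c) x y"
    using arg_cong[OF n, of "\<lambda>H. AMap H g"] that by (simp add: hom_iff)
qed

lemma groth_map_simps [simp]:
  "Src (groth_map F G \<eta>) = groth F" "Tgt (groth_map F G \<eta>) = groth G"
  "(c, x) \<in> Obj (groth F) \<Longrightarrow> OMap (groth_map F G \<eta>) (c, x) = (c, OMap (\<eta> c) x)"
  "Mor (c, x) (d, y) (f, g) \<in> Arr (groth F) \<Longrightarrow> AMap (groth_map F G \<eta>) (Mor (c, x) (d, y) (f, g)) =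
     Mor (c, OMap (\<eta> c) x) (d, OMap (\<eta> d) y) (f, AMap (\<eta> d) g)"
  "OMap (groth_map F G \<eta>) \<in> extensional (Obj (groth F))"
  "AMap (groth_map F G \<eta>) \<in> extensional (Arr (groth F))"
  by (simp_all add: groth_map_def Let_def del: F.groth_simps)

lemma groth_map_functor: "is_functor (groth_map F G \<eta>) (groth F) (groth G)"
proof (rule is_functorI)
  interpret GF: category "groth F" by (rule F.groth_category)
  show "category (groth F)" "category (groth G)" by (rule F.groth_category G.groth_category)+
  fix m X Y assume m: "m \<in> hom (groth F) X Y"
  then obtain c x d y f g where m': "X = (c, x)" "Y = (d, y)" "m = Mor (c, x) (d, y) (f, g)"
    and f: "f \<in> hom B c d" and g: "g \<in> hom (OMap F d) (OMap (AMap F f) x) y"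
    and o: "x \<in> Obj (OMap F c)" "y \<in> Obj (OMap F d)" "c \<in> Obj B" "d \<in> Obj B"
    by (rule F.groth_homE)
  have mA: "Mor (c, x) (d, y) (f, g) \<in> Arr (groth F)" using m m' by (simp add: hom_iff)
  have g': "AMap (\<eta> d) g \<in> hom (OMap G d) (OMap (AMap G f) (OMap (\<eta> c) x)) (OMap (\<eta> d) y)"
    using is_functorD(6)[OF component[OF o(4)] g] component_push(1)[OF f o(1)] by simp
  show "AMap (groth_map F G \<eta>) m \<in> hom (groth G) (OMap (groth_map F G \<eta>) X) (OMap (groth_map F G \<eta>)
      Y)"
    using G.groth_homI[OF _ f g'] is_functorD(5)[OF component[OF o(3)] o(1)] m' mA o by simp
  fix n Z assume n: "n \<in> hom (groth F) Y Z"
  then obtain e z f' h where n': "Z = (e, z)" "n = Mor (d, y) (e, z) (f', h)"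
    and f': "f' \<in> hom B d e" and h: "h \<in> hom (OMap F e) (OMap (AMap F f') y) z" "e \<in> Obj B"
    using m' by (auto elim!: F.groth_homE)
  have nA: "Mor (d, y) (e, z) (f', h) \<in> Arr (groth F)" using n unfolding n' m'(2)
    by (simp add: hom_iff)
  have A: "n \<cdot>\<^bsub>groth F\<^esub> m \<in> Arr (groth F)" using GF.Comp_hom[OF m n] by (simp add: hom_iff)
  show "AMap (groth_map F G \<eta>) (n \<cdot>\<^bsub>groth F\<^esub> m) =
      AMap (groth_map F G \<eta>) n \<cdot>\<^bsub>groth G\<^esub> AMap (groth_map F G \<eta>) m"
    using is_functorD(8)[OF component[OF h(2)] F.push_hom[OF f' g] h(1)] component_push(2)[OF f' g]
      A m' n' mA nA by simp
next
  interpret GF: category "groth F" by (rule F.groth_category)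
  fix X assume X: "X \<in> Obj (groth F)"
  have "Ident (groth F) X \<in> Arr (groth F)" using GF.Ident_hom[OF X] by (simp add: hom_iff)
  then show "AMap (groth_map F G \<eta>) (Ident (groth F) X) =
      Ident (groth G) (OMap (groth_map F G \<eta>) X)"
    using X is_functorD(7)[OF component] by (cases X) simp
next
  fix X assume "X \<in> Obj (groth F)"
  then show "OMap (groth_map F G \<eta>) X \<in> Obj (groth G)"
    using is_functorD(5)[OF component] by (cases X) simp
qed (simp_all)

lemma groth_map_over_base: "fun_comp (groth_proj G) (groth_map F G \<eta>) = groth_proj F"
proof (rule func_eqI[where C = "groth F"])
  note GM = is_functorD[OF groth_map_functor]
  fix X assume X: "X \<in> Obj (groth F)"
  then show "OMap (fun_comp (groth_proj G) (groth_map F G \<eta>)) X = OMap (groth_proj F) X"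
    using GM(5)[OF X] by (cases X) simp
next
  note GM = is_functorD[OF groth_map_functor]
  fix m assume m: "m \<in> Arr (groth F)"
  show "AMap (fun_comp (groth_proj G) (groth_map F G \<eta>)) m = AMap (groth_proj F) m"
    by (rule F.Arr_grothE[OF m]) (use m GM(11)[OF m] in auto)
qed (use fun_comp_simps(5,6)[of "groth_proj G" "groth_map F G \<eta>"] in auto)

text \<open>The component functors preserve inverses in the fibres.\<close>

lemma groth_map_opcartesian:
  assumes "opcartesian (groth_proj F) h"
  shows "opcartesian (groth_proj G) (AMap (groth_map F G \<eta>) h)"
proof -
  obtain c x d y f g where h: "h = Mor (c, x) (d, y) (f, g)"
    by (metis mor.exhaust surj_pair)
  note hh = F.opcartesian_imp_iso[OF assms[unfolded h]]
  from hh(1) have f: "f \<in> hom B c d" and x: "x \<in> Obj (OMap F c)"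
    and g: "g \<in> hom (OMap F d) (OMap (AMap F f) x) y" by (auto simp: F.hom_groth)
  have o: "c \<in> Obj B" "d \<in> Obj B" using F.base.hom_Obj[OF f] by auto
  note E = component[OF o(2)]
  interpret d: category "OMap F d" by (rule is_functorD(3)[OF E])
  obtain g' where g': "g' \<in> hom (OMap F d) y (OMap (AMap F f) x)"
    "g' \<cdot>\<^bsub>OMap F d\<^esub> g = Ident (OMap F d) (OMap (AMap F f) x)"
        "g \<cdot>\<^bsub>OMap F d\<^esub> g' = Ident (OMap F d) y"
    using hh(2) by auto
  have hA: "Mor (c, x) (d, y) (f, g) \<in> Arr (groth F)" using hh(1) by (simp add: hom_iff)
  have oy: "y \<in> Obj (OMap F d)" using d.hom_Obj[OF g] by simp
  have "Mor (c, OMap (\<eta> c) x) (d, OMap (\<eta> d) y) (f, AMap (\<eta> d) g) \<in>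
      hom (groth G) (c, OMap (\<eta> c) x) (d, OMap (\<eta> d) y)"
    using is_functorD(6)[OF groth_map_functor hh(1)] hA o x oy by simp
  moreover have "AMap (\<eta> d) g' \<in> hom (OMap G d) (OMap (\<eta> d) y) (OMap (AMap G f) (OMap (\<eta> c) x))"
    using is_functorD(6)[OF E g'(1)] component_push(1)[OF f x] by simp
  moreover have
    "AMap (\<eta> d) g' \<cdot>\<^bsub>OMap G d\<^esub> AMap (\<eta> d) g = Ident (OMap G d) (OMap (AMap G f) (OMap (\<eta> c) x))"
    "AMap (\<eta> d) g \<cdot>\<^bsub>OMap G d\<^esub> AMap (\<eta> d) g' = Ident (OMap G d) (OMap (\<eta> d) y)"
    using is_functorD(8)[OF E g g'(1)] is_functorD(8)[OF E g'(1) g] g'(2,3) is_functorD(7)[OF E]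
      component_push(1)[OF f x] d.hom_Obj[OF g] by auto
  ultimately show ?thesis using G.iso_imp_opcartesian hA h by simp
qed

end

lemma (in indexed_category) groth_map_id:
  assumes "\<And>c. c \<in> Obj B \<Longrightarrow> \<eta> c = fun_id (OMap F c)"
  shows "groth_map F F \<eta> = fun_id (groth F)"
proof (rule func_eqI[where C = "groth F"])
  fix X assume "X \<in> Obj (groth F)"
  then show "OMap (groth_map F F \<eta>) X = OMap (fun_id (groth F)) X"
    by (cases X) (simp add: groth_map_def Let_def assms)
next
  fix m assume "m \<in> Arr (groth F)"
  then show "AMap (groth_map F F \<eta>) m = AMap (fun_id (groth F)) m"
    by (rule Arr_grothE) (use \<open>m \<in> Arr (groth F)\<close> in \<open>auto simp: groth_map_def Let_def assms
        hom_iff\<close>)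
qed (auto simp: groth_map_def Let_def)

lemma groth_map_comp:
  assumes "indexed_functor F G B \<eta>" "indexed_functor G H B \<theta>"
    and \<zeta>: "\<And>c. c \<in> Obj B \<Longrightarrow> \<zeta> c = fun_comp (\<theta> c) (\<eta> c)"
  shows "fun_comp (groth_map G H \<theta>) (groth_map F G \<eta>) = groth_map F H \<zeta>"
proof -
  interpret FG: indexed_functor F G B \<eta> by fact
  interpret GH: indexed_functor G H B \<theta> by fact
  note FGm = is_functorD[OF FG.groth_map_functor]
  have S [simp]: "Src (\<eta> c) = OMap F c" if "c \<in> Obj B" for c
    using is_functorD(1)[OF FG.component[OF that]] .
  show ?thesis
  proof (rule func_eqI[where C = "groth F"])
    fix X assume X: "X \<in> Obj (groth F)"
    then show "OMap (fun_comp (groth_map G H \<theta>) (groth_map F G \<eta>)) X = OMap (groth_map F H \<zeta>) X"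
      using FGm(5)[OF X] by (cases X) (auto simp: groth_map_def[of F H] Let_def \<zeta>)
  next
    fix m assume m: "m \<in> Arr (groth F)"
    show "AMap (fun_comp (groth_map G H \<theta>) (groth_map F G \<eta>)) m = AMap (groth_map F H \<zeta>) m"
      by (rule FG.F.Arr_grothE[OF m]) (use m FGm(11)[OF m] in \<open>auto simp: groth_map_def[of F H]
          Let_def \<zeta> hom_iff\<close>)
  qed (use fun_comp_simps(5,6)[of "groth_map G H \<theta>" "groth_map F G \<eta>"] in
      \<open>auto simp: groth_map_def[of F H] Let_def\<close>)
qed

section \<open>The category of opfibrations\<close>

lemma opcartesian_Arr: "opcartesian F h \<Longrightarrow> h \<in> Arr (Src F)"
  by (simp add: opcartesian_def)

lemma Fib_category: "category (Fib B)"
  unfolding Fib_def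
proof (rule tagged_cat_category, unfold mem_Collect_eq, goal_cases)
  case (1 F)
  then have F: "is_functor F (Src F) B" by (simp add: opfibration_def is_functor_def)
  show ?case
    using fun_id_functor[OF is_functorD(3)[OF F]] fun_comp_fun_id(1)[OF F]
    by (simp add: opcartesian_Arr)
next
  case (2 F G K H1 H2)
  then have H: "is_functor H1 (Src F) (Src G)" "is_functor H2 (Src G) (Src K)" by auto
  have "AMap (fun_comp H2 H1) h = AMap H2 (AMap H1 h)" if "opcartesian F h" for h
    using opcartesian_Arr[OF that] is_functorD(1)[OF H(1)] by simp
  then show ?case
    using 2 fun_comp_functor[OF H] fun_comp_assoc[OF H, of K] by simp
next
  case (3 F G H)
  then show ?case using fun_comp_fun_id(1)[of H "Src F" "Src G"] by simp
next
  case (4 F G H)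
  then show ?case using fun_comp_fun_id(2)[of H "Src F" "Src G"] by simp
next
  case (5 F1 F2 F3 F4 H1 H2 H3)
  then show ?case
    using fun_comp_assoc[of H1 "Src F1" "Src F2" H2 "Src F3" H3] by simp
qed

lemma hom_Fib: "m \<in> hom (Fib B) F G \<longleftrightarrow> (\<exists>H. m = Mor F G H \<and> opfibration F \<and> Tgt F = B \<and>
    opfibration G \<and> Tgt G = B \<and> is_functor H (Src F) (Src G) \<and> fun_comp G H = F \<and>
    (\<forall>h. opcartesian F h \<longrightarrow> opcartesian G (AMap H h)))"
  by (auto simp: Fib_def hom_tagged_cat)

lemma Fib_simps [simp]:
  "F \<in> Obj (Fib B) \<longleftrightarrow> opfibration F \<and> Tgt F = B" "Dom (Fib B) = mor_src" "Cod (Fib B) = mor_tgt"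
  "Ident (Fib B) F = Mor F F (fun_id (Src F))"
  "Mor G K H' \<cdot>\<^bsub>Fib B\<^esub> Mor F G' H = Mor F K (fun_comp H' H)"
  by (auto simp: Fib_def)

lemma groth_map_Fib:
  fixes F G :: "('o, 'a, ('x, 'm) category, ('x, 'm, 'x, 'm) func) func"
  assumes "indexed_functor F G B \<eta>"
  shows "Mor (groth_proj F) (groth_proj G) (groth_map F G \<eta>) \<in>
    hom (Fib B) (groth_proj F) (groth_proj G)"
proof -
  interpret indexed_functor F G B \<eta> by fact
  show ?thesis
    by (simp add: hom_Fib F.groth_proj_opfibration G.groth_proj_opfibration groth_map_functor
        groth_map_over_base groth_map_opcartesian)
qed

section \<open>Change of base\<close>

context indexed_category
begin

context
  fixes U :: "('p, 'b, 'o, 'a) func" and A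
  assumes U: "is_functor U A B"
begin

lemma base_change_indexed: "indexed_category (fun_comp F U) A"
  using fun_comp_functor[OF U F] by unfold_locales

interpretation FU: indexed_category "fun_comp F U" A by (rule base_change_indexed)

lemma base_change_fibre:
  shows "c \<in> Obj A \<Longrightarrow> OMap (fun_comp F U) c = OMap F (OMap U c)"
    "f \<in> hom A c d \<Longrightarrow> AMap (fun_comp F U) f = AMap F (AMap U f)"
  using is_functorD(1)[OF U] by (auto simp: hom_iff)

lemma groth_base_change_simps:
  "Src (groth_base_change F U) = groth (fun_comp F U)" "Tgt (groth_base_change F U) = groth F"
  "(c, x) \<in> Obj (groth (fun_comp F U)) \<Longrightarrow> OMap (groth_base_change F U) (c, x) = (OMap U c, x)"
  "Mor (c, x) (d, y) (f, g) \<in> Arr (groth (fun_comp F U)) \<Longrightarrow>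
     AMap (groth_base_change F U) (Mor (c, x) (d, y) (f, g)) =
     Mor (OMap U c, x) (OMap U d, y) (AMap U f, g)"
  "OMap (groth_base_change F U) \<in> extensional (Obj (groth (fun_comp F U)))"
  "AMap (groth_base_change F U) \<in> extensional (Arr (groth (fun_comp F U)))"
  by (simp_all add: groth_base_change_def Let_def del: FU.groth_simps)

lemma groth_base_change_functor: "is_functor (groth_base_change F U) (groth (fun_comp F U))
    (groth F)"
proof (rule is_functorI)
  interpret GF: category "groth (fun_comp F U)" by (rule FU.groth_category)
  note UD = is_functorD[OF U]
  note simps = groth_base_change_simps base_change_fibre
  show "category (groth (fun_comp F U))" "category (groth F)"
    by (rule FU.groth_category groth_category)+
  fix m X Y assume m: "m \<in> hom (groth (fun_comp F U)) X Y"
  then obtain c x d y f g where m': "X = (c, x)" "Y = (d, y)" "m = Mor (c, x) (d, y) (f, g)"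
    and f: "f \<in> hom A c d"
    and g: "g \<in> hom (OMap F (OMap U d)) (OMap (AMap F (AMap U f)) x) y"
    and o: "x \<in> Obj (OMap F (OMap U c))" "y \<in> Obj (OMap F (OMap U d))" "c \<in> Obj A" "d \<in> Obj A"
    by (elim FU.groth_homE) (simp add: base_change_fibre)
  have mA: "Mor (c, x) (d, y) (f, g) \<in> Arr (groth (fun_comp F U))" using m m' by (simp add: hom_iff)
  show "AMap (groth_base_change F U) m \<in>
      hom (groth F) (OMap (groth_base_change F U) X) (OMap (groth_base_change F U) Y)"
    using groth_homI[OF o(1) UD(6)[OF f] g] m' mA o by (simp add: simps)
  fix n Z assume n: "n \<in> hom (groth (fun_comp F U)) Y Z"
  then obtain e z f' h where n': "Z = (e, z)" "n = Mor (d, y) (e, z) (f', h)"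
    and f': "f' \<in> hom A d e" and e: "e \<in> Obj A"
    using m' by (auto elim!: FU.groth_homE)
  have nA: "Mor (d, y) (e, z) (f', h) \<in> Arr (groth (fun_comp F U))" using n unfolding n' m'(2)
    by (simp add: hom_iff)
  have A: "n \<cdot>\<^bsub>groth (fun_comp F U)\<^esub> m \<in> Arr (groth (fun_comp F U))"
    using GF.Comp_hom[OF m n] by (simp add: hom_iff)
  show "AMap (groth_base_change F U) (n \<cdot>\<^bsub>groth (fun_comp F U)\<^esub> m) =
      AMap (groth_base_change F U) n \<cdot>\<^bsub>groth F\<^esub> AMap (groth_base_change F U) m"
    using UD(8)[OF f f'] A m' n' mA nA e by (simp add: simps base_change_fibre(2)[OF f'])
next
  interpret GF: category "groth (fun_comp F U)" by (rule FU.groth_category)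
  fix X assume X: "X \<in> Obj (groth (fun_comp F U))"
  have "Ident (groth (fun_comp F U)) X \<in> Arr (groth (fun_comp F U))"
    using GF.Ident_hom[OF X] by (simp add: hom_iff)
  then show "AMap (groth_base_change F U) (Ident (groth (fun_comp F U)) X) =
      Ident (groth F) (OMap (groth_base_change F U) X)"
    using X is_functorD(7)[OF U] by (cases X) (auto simp: groth_base_change_simps base_change_fibre)
next
  fix X assume "X \<in> Obj (groth (fun_comp F U))"
  then show "OMap (groth_base_change F U) X \<in> Obj (groth F)"
    using is_functorD(5)[OF U] by (cases X) (auto simp: groth_base_change_simps base_change_fibre)
qed (simp_all add: groth_base_change_simps)

text \<open>An object of the total category of \<open>F \<circ> U\<close> over \<open>a\<close> is an object of the fibre \<open>F (U a)\<close>, that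
  is, an object of the total category of \<open>F\<close> over \<open>U a\<close>; likewise for arrows. So an arrow is
  recovered from its two images: \<open>lift\<close> keeps the fibre component of the second and replaces its
  base component by the first.\<close>

lemma groth_base_change_pullback:
  "is_cat_pullback (groth_proj (fun_comp F U)) (groth_base_change F U) U (groth_proj F)"
proof -
  note UD = is_functorD[OF U]
  note Q = is_functorD[OF groth_base_change_functor]
  note bc = groth_base_change_simps base_change_fibre
  have comm: "fun_comp U (groth_proj (fun_comp F U)) =
      fun_comp (groth_proj F) (groth_base_change F U)"
  proof (rule func_eqI[where C = "groth (fun_comp F U)"])
    fix X assume X: "X \<in> Obj (groth (fun_comp F U))"
    then show "OMap (fun_comp U (groth_proj (fun_comp F U))) X =
        OMap (fun_comp (groth_proj F) (groth_base_change F U)) X"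
      using Q(5)[OF X] by (cases X) (simp add: bc del: FU.groth_simps groth_simps)
  next
    fix m assume m: "m \<in> Arr (groth (fun_comp F U))"
    show "AMap (fun_comp U (groth_proj (fun_comp F U))) m =
        AMap (fun_comp (groth_proj F) (groth_base_change F U)) m"
      by (rule FU.Arr_grothE[OF m]) (use m Q(11)[OF m] in \<open>auto simp: bc\<close>)
  qed (use fun_comp_simps(5,6)[of U "groth_proj (fun_comp F U)"]
        fun_comp_simps(5,6)[of "groth_proj F" "groth_base_change F U"] UD(2) in \<open>auto simp: bc\<close>)
  have obj: "bij_betw (\<lambda>X. (OMap (groth_proj (fun_comp F U)) X, OMap (groth_base_change F U) X))
      (Obj (groth (fun_comp F U)))
      {(a, Y). a \<in> Obj A \<and> Y \<in> Obj (groth F) \<and> OMap U a = OMap (groth_proj F) Y}"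
    by (rule bij_betw_byWitness[where f' = "\<lambda>(a, Y). (a, snd Y)"])
      (auto simp: bc UD(5) simp del: bc(1,2))
  define lift where "lift = (\<lambda>(a, n :: ('o \<times> 'x, 'a \<times> 'm) mor).
    Mor (Dom A a, snd (mor_src n)) (Cod A a, snd (mor_tgt n)) (a, snd (mor_map n)))"
  have [simp]: "lift (a, n) = Mor (Dom A a, snd (mor_src n)) (Cod A a, snd (mor_tgt n)) (a,
      snd (mor_map n))"
    for a n by (simp add: lift_def)
  have arr: "bij_betw (\<lambda>m. (AMap (groth_proj (fun_comp F U)) m, AMap (groth_base_change F U) m))
      (Arr (groth (fun_comp F U)))
      {(a, n). a \<in> Arr A \<and> n \<in> Arr (groth F) \<and> AMap U a = AMap (groth_proj F) n}"
  proof (rule bij_betw_byWitness[where f' = lift])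
    show "\<forall>m \<in> Arr (groth (fun_comp F U)). lift (AMap (groth_proj (fun_comp F U)) m,
        AMap (groth_base_change F U) m) = m"
    proof
      fix m assume m: "m \<in> Arr (groth (fun_comp F U))"
      show "lift (AMap (groth_proj (fun_comp F U)) m, AMap (groth_base_change F U) m) = m"
        by (rule FU.Arr_grothE[OF m]) (use m in \<open>auto simp: bc hom_iff\<close>)
    qed
    have inv: "lift (a, n) \<in> Arr (groth (fun_comp F U)) \<and>
        AMap (groth_base_change F U) (lift (a, n)) = n"
      if a: "a \<in> Arr A" and n: "n \<in> Arr (groth F)" and eq: "AMap U a = AMap (groth_proj F) n"
        for a n
    proof -
      obtain c x d y f g where n': "n = Mor (c, x) (d, y) (f, g)" "f \<in> hom B c d"
        "g \<in> hom (OMap F d) (OMap (AMap F f) x) y" "x \<in> Obj (OMap F c)" "d \<in> Obj B"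
        by (rule Arr_grothE[OF n])
      have [simp]: "f = AMap U a" using eq n n' by simp
      have a': "a \<in> hom A (Dom A a) (Cod A a)" using a by (rule Arr_hom)
      then have [simp]: "OMap U (Dom A a) = c" "OMap U (Cod A a) = d"
        using UD(12,13)[OF a] n'(2) by (auto simp: hom_iff)
      have o: "Dom A a \<in> Obj A" "Cod A a \<in> Obj A" using FU.base.hom_Obj[OF a'] .
      have "Mor (Dom A a, x) (Cod A a, y) (a, g) \<in> hom (groth (fun_comp F U)) (Dom A a, x) (Cod A a,
          y)"
        using n' o a' by (intro FU.groth_homI) (auto simp: bc(7) bc(8)[OF a'])
      then show ?thesis using n'(1) by (simp add: bc(4) hom_iff)
    qed
    show "\<forall>an \<in> {(a, n). a \<in> Arr A \<and> n \<in> Arr (groth F) \<and> AMap U a = AMap (groth_proj F) n}.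
        (AMap (groth_proj (fun_comp F U)) (lift an), AMap (groth_base_change F U) (lift an)) = an"
      using inv by auto
    show "lift `
        {(a, n). a \<in> Arr A \<and> n \<in> Arr (groth F) \<and> AMap U a = AMap (groth_proj F) n} \<subseteq>
        Arr (groth (fun_comp F U))"
      using inv by auto
    show "(\<lambda>m. (AMap (groth_proj (fun_comp F U)) m, AMap (groth_base_change F U) m)) `
        Arr (groth (fun_comp F U)) \<subseteq> {(a, n). a \<in> Arr A \<and> n \<in> Arr (groth F) \<and> AMap U a = AMap
            (groth_proj F) n}"
    proof clarify
      fix m assume m: "m \<in> Arr (groth (fun_comp F U))"
      have "AMap U (AMap (groth_proj (fun_comp F U)) m) =
          AMap (groth_proj F) (AMap (groth_base_change F U) m)"
        using arg_cong[OF comm, of "\<lambda>H. AMap H m"] m by (simp add: bc)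
      then show "AMap (groth_proj (fun_comp F U)) m \<in> Arr A \<and>
          AMap (groth_base_change F U) m \<in> Arr (groth F) \<and>
          AMap U (AMap (groth_proj (fun_comp F U)) m) = AMap (groth_proj F)
              (AMap (groth_base_change F U) m)"
        using Q(11)[OF m] is_functorD(11)[OF FU.groth_proj_functor m] by simp
    qed
  qed
  show ?thesis
    using comm obj arr UD(1,2) Q(1,2) groth_proj_functor FU.groth_proj_functor
        groth_base_change_functor U
    by (simp add: is_cat_pullback_def is_functor_def del: groth_simps FU.groth_simps)
qed

end

end

section \<open>Passing to total categories in the last variable\<close>

text \<open>The arrows of \<open>groth D\<close> over the identity of \<open>b\<close> form a copy of \<open>D b\<close>, since pushing forward
  along an identity is the identity. \<open>F(p, b, -)\<close> is the restriction of \<open>F\<close> to this copy.\<close>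

locale indexed_over_total = D: indexed_category D B
  for D :: "('o, 'a, ('x, 'm) category, ('x, 'm, 'x, 'm) func) func" and B +
  fixes F :: "('o \<times> 'o \<times> 'x, 'a \<times> ('o \<times> 'x, 'a \<times> 'm) mor,
      ('y, 'n) category, ('y, 'n, 'y, 'n) func) func"
  assumes F: "is_functor F (prod_cat B (groth D)) Cat"
begin

abbreviation vertical where
  "vertical b h \<equiv> Mor (b, Dom (OMap D b) h) (b, Cod (OMap D b) h) (Ident B b, h)"

lemma vertical_hom:
  assumes b: "b \<in> Obj B" and h: "h \<in> hom (OMap D b) x y"
  shows "vertical b h \<in> hom (groth D) (b, x) (b, y)"
proof -
  have "vertical b h = Mor (b, x) (b, y) (Ident B b, h)" using h by (simp add: hom_iff)
  then show ?thesis
    using category.hom_Obj[OF D.fibre_category[OF b] h] D.push_Ident[OF b] h D.base.Ident_hom[OF b]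
    by (simp add: D.groth_homI)
qed

lemma at_fibre_simps [simp]:
  "Src (at_fibre F D p b) = OMap D b" "Tgt (at_fibre F D p b) = Cat"
  "x \<in> Obj (OMap D b) \<Longrightarrow> OMap (at_fibre F D p b) x = OMap F (p, (b, x))"
  "h \<in> Arr (OMap D b) \<Longrightarrow> AMap (at_fibre F D p b) h = AMap F (Ident B p, vertical b h)"
  "OMap (at_fibre F D p b) \<in> extensional (Obj (OMap D b))"
  "AMap (at_fibre F D p b) \<in> extensional (Arr (OMap D b))"
  by (simp_all add: at_fibre_def)

lemma at_fibre_indexed:
  assumes p: "p \<in> Obj B" and b: "b \<in> Obj B"
  shows "indexed_category (at_fibre F D p b) (OMap D b)"
proof
  interpret b: category "OMap D b" by (rule D.fibre_category[OF b])
  note FD = is_functorD[OF F]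
  note ip = D.base.Ident_hom[OF p] and ib = D.base.Ident_hom[OF b]
  show "is_functor (at_fibre F D p b) (OMap D b) Cat"
  proof (rule is_functorI)
    show "category (OMap D b)" by unfold_locales
    show "category (Cat :: (('y, 'n) category, ('y, 'n, 'y, 'n) func) category)"
      by (rule Cat_category)
    fix f x y assume f: "f \<in> hom (OMap D b) x y"
    note vf = vertical_hom[OF b f]
    have fA: "f \<in> Arr (OMap D b)" "x \<in> Obj (OMap D b)" "y \<in> Obj (OMap D b)"
      using f b.hom_Obj[OF f] by (auto simp: hom_iff)
    show "AMap (at_fibre F D p b) f \<in> hom Cat (OMap (at_fibre F D p b) x) (OMap (at_fibre F D p b)
        y)"
      using FD(6)[of "(Ident B p, vertical b f)" "(p, (b, x))" "(p, (b, y))"] ip vf fA by simp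
    fix g z assume g: "g \<in> hom (OMap D b) y z"
    have gA: "g \<in> Arr (OMap D b)" "g \<cdot>\<^bsub>OMap D b\<^esub> f \<in> hom (OMap D b) x z"
      using g b.Comp_hom[OF f g] by (auto simp: hom_iff)
    have "vertical b g \<cdot>\<^bsub>groth D\<^esub> vertical b f = vertical b (g \<cdot>\<^bsub>OMap D b\<^esub> f)"
      using D.base.Ident_Comp[OF ib] D.push_Ident(2)[OF b f] f g gA by (simp add: hom_iff)
    then show "AMap (at_fibre F D p b) (g \<cdot>\<^bsub>OMap D b\<^esub> f) =
        AMap (at_fibre F D p b) g \<cdot>\<^bsub>Cat\<^esub> AMap (at_fibre F D p b) f"
      using FD(8)[of "(Ident B p, vertical b f)" "(p, (b, x))" "(p, (b, y))"
          "(Ident B p, vertical b g)" "(p, (b, z))"] ip vf vertical_hom[OF b g] fA gA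
        D.base.Ident_Comp[OF ip] by (simp add: hom_iff[of _ "OMap D b"])
  next
    fix x assume x: "x \<in> Obj (OMap D b)"
    note ix = b.Ident_hom[OF x]
    have "vertical b (Ident (OMap D b) x) = Ident (groth D) (b, x)" using ix by (simp add: hom_iff)
    then show "AMap (at_fibre F D p b) (Ident (OMap D b) x) = Ident Cat (OMap (at_fibre F D p b) x)"
      using FD(7)[of "(p, (b, x))"] ix p b x by (simp add: hom_iff)
  next
    fix x assume x: "x \<in> Obj (OMap D b)"
    then show "OMap (at_fibre F D p b) x \<in> Obj Cat"
      using FD(5)[of "(p, (b, x))"] p b by simp
  qed auto
qed

text \<open>A morphism in the first variable acts at the identity of \<open>(b, x)\<close>. This is natural in \<open>x\<close>
  because \<open>(\<phi>, id)\<close> and \<open>(id, h)\<close> commute in the product.\<close>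

lemma at_fibre_indexed_functor:
  assumes \<phi>: "\<phi> \<in> hom B p q" and b: "b \<in> Obj B"
  shows "indexed_functor (at_fibre F D p b) (at_fibre F D q b) (OMap D b)
    (\<lambda>x. AMap F (\<phi>, Ident (groth D) (b, x)))"
proof -
  interpret b: category "OMap D b" by (rule D.fibre_category[OF b])
  interpret GD: category "groth D" by (rule D.groth_category)
  note FD = is_functorD[OF F]
  have pq: "p \<in> Obj B" "q \<in> Obj B" using D.base.hom_Obj[OF \<phi>] .
  note Id = GD.Ident_hom[of "(b, x)" for x]
  have nat: "strictly_natural (at_fibre F D p b) (at_fibre F D q b)
      (\<lambda>x. AMap F (\<phi>, Ident (groth D) (b, x)))"
    unfolding strictly_natural_def at_fibre_simps(1)
  proof (intro conjI ballI)
    fix x assume x: "x \<in> Obj (OMap D b)"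
    then show "is_functor (AMap F (\<phi>, Ident (groth D) (b, x))) (OMap (at_fibre F D p b) x)
        (OMap (at_fibre F D q b) x)"
      using FD(6)[of "(\<phi>, Ident (groth D) (b, x))" "(p, (b, x))" "(q, (b, x))"] \<phi> Id[of x] b
      by (simp del: D.groth_simps(4))
  next
    fix h assume hA: "h \<in> Arr (OMap D b)"
    define x y where "x = Dom (OMap D b) h" and "y = Cod (OMap D b) h"
    have h: "h \<in> hom (OMap D b) x y" using Arr_hom[OF hA] by (simp add: x_def y_def)
    have xy: "(b, x) \<in> Obj (groth D)" "(b, y) \<in> Obj (groth D)" using b.hom_Obj[OF h] b by auto
    have vh: "vertical b h \<in> hom (groth D) (b, x) (b, y)" by (rule vertical_hom[OF b h])
    have "fun_comp (AMap F (\<phi>, Ident (groth D) (b, y))) (AMap F (Ident B p, vertical b h)) =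
        AMap F (\<phi>, vertical b h)"
      using FD(8)[of "(Ident B p, vertical b h)" "(p, (b, x))" "(p, (b, y))"
          "(\<phi>, Ident (groth D) (b, y))" "(q, (b, y))"] D.base.Ident_hom[OF pq(1)] vh \<phi>
              GD.Ident_hom[OF xy(2)]
        D.base.Comp_Ident[OF \<phi>] GD.Ident_Comp[OF vh] by (simp del: D.groth_simps(4))
    moreover have "fun_comp (AMap F (Ident B q, vertical b h)) (AMap F (\<phi>, Ident (groth D) (b, x)))
        =
        AMap F (\<phi>, vertical b h)"
      using FD(8)[of "(\<phi>, Ident (groth D) (b, x))" "(p, (b, x))" "(q, (b, x))"
          "(Ident B q, vertical b h)" "(q, (b, y))"] D.base.Ident_hom[OF pq(2)] vh \<phi>
              GD.Ident_hom[OF xy(1)]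
        D.base.Ident_Comp[OF \<phi>] GD.Comp_Ident[OF vh] by (simp del: D.groth_simps(4))
    ultimately show "fun_comp (AMap F (\<phi>, Ident (groth D) (b, Cod (OMap D b) h)))
        (AMap (at_fibre F D p b) h) =
        fun_comp (AMap (at_fibre F D q b) h) (AMap F (\<phi>, Ident (groth D) (b, Dom (OMap D b) h)))"
      using hA by (simp add: x_def y_def del: D.groth_simps(4))
  qed
  show ?thesis
    using at_fibre_indexed[OF pq(1) b] at_fibre_indexed[OF pq(2) b] nat
    by (intro indexed_functor.intro indexed_functor_axioms.intro)
qed

lemma fibrewise_groth_functor:
  "is_functor (fibrewise_groth F D) B (Pi_cat (Obj B) (\<lambda>b. Fib (OMap D b)))"
proof (rule is_functorI)
  interpret GD: category "groth D" by (rule D.groth_category)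
  note FD = is_functorD[OF F]
  note [simp] = fibrewise_groth_def Let_def
  let ?I = "fibrewise_groth F D"
  show "Src ?I = B" "Tgt ?I = Pi_cat (Obj B) (\<lambda>b. Fib (OMap D b))" by simp_all
  show "category B" by unfold_locales
  show "category (Pi_cat (Obj B) (\<lambda>b. Fib (OMap D b)))" by (intro Pi_cat_category Fib_category)
  fix p assume p: "p \<in> Obj B"
  have op: "opfibration (groth_proj (at_fibre F D p b))" if "b \<in> Obj B" for b
    using indexed_category.groth_proj_opfibration[OF at_fibre_indexed[OF p that]] .
  show "OMap ?I p \<in> Obj (Pi_cat (Obj B) (\<lambda>b. Fib (OMap D b)))"
    using p op by (auto simp: Pi_cat_def groth_proj_def)
  note ip = D.base.Ident_hom[OF p]
  have "groth_map (at_fibre F D p b) (at_fibre F D p b) (\<lambda>x. AMap F (Ident B p,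
      Ident (groth D) (b, x))) =
      fun_id (groth (at_fibre F D p b))" if b: "b \<in> Obj B" for b
  proof (rule indexed_category.groth_map_id[OF at_fibre_indexed[OF p b]])
    fix x assume "x \<in> Obj (OMap D b)"
    then show "AMap F (Ident B p, Ident (groth D) (b, x)) = fun_id (OMap (at_fibre F D p b) x)"
      using FD(7)[of "(p, (b, x))"] p b by simp
  qed
  then show "AMap ?I (Ident B p) = Ident (Pi_cat (Obj B) (\<lambda>b. Fib (OMap D b))) (OMap ?I p)"
    using p ip by (auto simp: Pi_cat_def hom_iff groth_proj_def[of "at_fibre F D p _"]
        intro!: restrict_ext)
next
  interpret GD: category "groth D" by (rule D.groth_category)
  note FD = is_functorD[OF F]
  let ?I = "fibrewise_groth F D"
  have app: "AMap ?I \<phi> = (\<lambda>b \<in> Obj B. Mor (groth_proj (at_fibre F D p b))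
      (groth_proj (at_fibre F D q b))
      (groth_map (at_fibre F D p b) (at_fibre F D q b) (\<lambda>x. AMap F (\<phi>, Ident (groth D) (b, x)))))"
    if "\<phi> \<in> hom B p q" for \<phi> p q
    using that by (simp add: fibrewise_groth_def hom_iff Let_def)
  fix \<phi> p q assume \<phi>: "\<phi> \<in> hom B p q"
  have pq: "p \<in> Obj B" "q \<in> Obj B" using D.base.hom_Obj[OF \<phi>] .
  show "AMap ?I \<phi> \<in> hom (Pi_cat (Obj B) (\<lambda>b. Fib (OMap D b))) (OMap ?I p) (OMap ?I q)"
    unfolding app[OF \<phi>] using pq groth_map_Fib[OF at_fibre_indexed_functor[OF \<phi>]]
    by (intro hom_Pi_catI) (auto simp: fibrewise_groth_def)
  fix \<psi> r assume \<psi>: "\<psi> \<in> hom B q r"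
  have "fun_comp
      (groth_map (at_fibre F D q b) (at_fibre F D r b) (\<lambda>x. AMap F (\<psi>, Ident (groth D) (b, x))))
      (groth_map (at_fibre F D p b) (at_fibre F D q b) (\<lambda>x. AMap F (\<phi>, Ident (groth D) (b, x)))) =
      groth_map (at_fibre F D p b) (at_fibre F D r b)
          (\<lambda>x. AMap F (\<psi> \<cdot>\<^bsub>B\<^esub> \<phi>, Ident (groth D) (b, x)))"
    if b: "b \<in> Obj B" for b
  proof (rule groth_map_comp[OF at_fibre_indexed_functor[OF \<phi> b] at_fibre_indexed_functor[OF \<psi> b]])
    fix x assume x: "x \<in> Obj (OMap D b)"
    then have i: "Ident (groth D) (b, x) \<in> hom (groth D) (b, x) (b, x)" using b
      by (intro GD.Ident_hom) simp
    show "AMap F (\<psi> \<cdot>\<^bsub>B\<^esub> \<phi>, Ident (groth D) (b, x)) =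
        fun_comp (AMap F (\<psi>, Ident (groth D) (b, x))) (AMap F (\<phi>, Ident (groth D) (b, x)))"
      using FD(8)[of "(\<phi>, Ident (groth D) (b, x))" "(p, (b, x))" "(q, (b, x))"
          "(\<psi>, Ident (groth D) (b, x))" "(r, (b, x))"] \<phi> \<psi> i GD.Ident_Comp[OF i]
      by (simp del: D.groth_simps(4))
  qed
  then show "AMap ?I (\<psi> \<cdot>\<^bsub>B\<^esub> \<phi>) = AMap ?I \<psi> \<cdot>\<^bsub>Pi_cat (Obj B) (\<lambda>b. Fib (OMap D b))\<^esub> AMap ?I \<phi>"
    unfolding app[OF \<phi>] app[OF \<psi>] app[OF D.base.Comp_hom[OF \<phi> \<psi>]]
    by (auto simp: Pi_cat_def intro!: restrict_ext)
qed (simp_all add: fibrewise_groth_def)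

end

section \<open>Restriction along a strictly natural family\<close>

lemma (in indexed_category) groth_map_cong:
  assumes "\<And>c. c \<in> Obj B \<Longrightarrow> \<eta> c = \<eta>' c"
  shows "groth_map F G \<eta> = groth_map F G \<eta>'"
proof (rule func_eqI[where C = "groth F"])
  fix X assume "X \<in> Obj (groth F)"
  then show "OMap (groth_map F G \<eta>) X = OMap (groth_map F G \<eta>') X"
    by (cases X) (simp add: groth_map_def Let_def assms)
next
  fix m assume m: "m \<in> Arr (groth F)"
  show "AMap (groth_map F G \<eta>) m = AMap (groth_map F G \<eta>') m"
    by (rule Arr_grothE[OF m]) (use m in \<open>auto simp: groth_map_def Let_def assms hom_iff\<close>)
qed (auto simp: groth_map_def Let_def)

context indexed_functor
begin

lemma base_change_indexed_functor:
  assumes U: "is_functor U A B"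
  shows "indexed_functor (fun_comp F U) (fun_comp G U) A (\<lambda>x. \<eta> (OMap U x))"
proof (intro indexed_functor.intro indexed_functor_axioms.intro F.base_change_indexed[OF U]
    G.base_change_indexed[OF U])
  note UD = is_functorD[OF U]
  show "strictly_natural (fun_comp F U) (fun_comp G U) (\<lambda>x. \<eta> (OMap U x))"
    using nat UD(5,11,12,13) by (simp add: strictly_natural_def UD(1,2))
        (metis F.Src_F UD(11,12,13))
qed

text \<open>Both sides apply \<open>U\<close> to the base and \<open>\<eta>\<close>, taken at the image under \<open>U\<close>, to the fibre.\<close>

lemma groth_map_base_change:
  assumes U: "is_functor U A B"
  shows "fun_comp (groth_base_change G U) (groth_map (fun_comp F U) (fun_comp G U)
      (\<lambda>x. \<eta> (OMap U x))) =
    fun_comp (groth_map F G \<eta>) (groth_base_change F U)"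
proof -
  interpret U: indexed_functor "fun_comp F U" "fun_comp G U" A "\<lambda>x. \<eta> (OMap U x)"
    by (rule base_change_indexed_functor[OF U])
  note MD = is_functorD[OF U.groth_map_functor]
  note QD = is_functorD[OF F.groth_base_change_functor[OF U]]
  note bc = F.groth_base_change_simps[OF U] G.groth_base_change_simps[OF U]
  show ?thesis
  proof (rule func_eqI[where C = "groth (fun_comp F U)"])
    fix X assume X: "X \<in> Obj (groth (fun_comp F U))"
    obtain c x where [simp]: "X = (c, x)" by (cases X)
    have "OMap U c \<in> Obj B" "x \<in> Obj (OMap F (OMap U c))"
      using QD(5)[OF X] X bc(3)[of c x] by auto
    then show "OMap (fun_comp (groth_base_change G U) (groth_map (fun_comp F U) (fun_comp G U)
        (\<lambda>x. \<eta> (OMap U x)))) X =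
        OMap (fun_comp (groth_map F G \<eta>) (groth_base_change F U)) X"
      using X MD(5)[OF X] bc(3)[of c x] bc(9)[of c "OMap (\<eta> (OMap U c)) x"] QD(1)
        U.groth_map_simps(3)[of c x] by simp
  next
    fix m assume m: "m \<in> Arr (groth (fun_comp F U))"
    obtain c x d y f g where [simp]: "m = Mor (c, x) (d, y) (f, g)"
      by (rule U.F.Arr_grothE[OF m])
    show "AMap (fun_comp (groth_base_change G U) (groth_map (fun_comp F U) (fun_comp G U)
        (\<lambda>x. \<eta> (OMap U x)))) m =
        AMap (fun_comp (groth_map F G \<eta>) (groth_base_change F U)) m"
      using m MD(11)[OF m] QD(11)[OF m] bc(4,10) QD(1) by simp
  qed (use fun_comp_simps(5,6)[of "groth_base_change G U"
      "groth_map (fun_comp F U) (fun_comp G U) (\<lambda>x. \<eta> (OMap U x))"]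
      fun_comp_simps(5,6)[of "groth_map F G \<eta>" "groth_base_change F U"] QD(1) bc in auto)
qed

end

text \<open>A functor on \<open>B \<times> groth D\<close> restricts along \<open>\<alpha> : D' \<rightarrow> D\<close> to one on \<open>B \<times> groth D'\<close>. In each
  fibre this is composition with the component of \<open>\<alpha>\<close>, so total categories change by pullback.\<close>

locale restricted_indexed = indexed_over_total D B F + \<alpha>: indexed_functor D' D B \<alpha>
  for D :: "('o, 'a, ('x, 'm) category, ('x, 'm, 'x, 'm) func) func"
    and D' :: "('o, 'a, ('z, 'k) category, ('z, 'k, 'z, 'k) func) func" and B \<alpha>
    and F :: "('o \<times> 'o \<times> 'x, 'a \<times> ('o \<times> 'x, 'a \<times> 'm) mor,
      ('y, 'n) category, ('y, 'n, 'y, 'n) func) func"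
begin

definition "restricted = fun_comp F (prod_fun (fun_id B) (groth_map D' D \<alpha>))"

lemma restricted_functor: "is_functor restricted (prod_cat B (groth D')) Cat"
  unfolding restricted_def
  using fun_comp_functor[OF prod_fun_functor[OF fun_id_functor \<alpha>.groth_map_functor] F]
    D.base.category_axioms by blast

sublocale R: indexed_over_total D' B restricted
  using restricted_functor by unfold_locales

lemma restricted_simps:
  "p \<in> Obj B \<Longrightarrow> X \<in> Obj (groth D') \<Longrightarrow> OMap restricted (p, X) = OMap F (p, OMap (groth_map D' D \<alpha>) X)"
  "\<phi> \<in> Arr B \<Longrightarrow> m \<in> Arr (groth D') \<Longrightarrow> AMap restricted (\<phi>, m) = AMap F (\<phi>, AMap (groth_map D' D \<alpha>) m)"
  by (auto simp: restricted_def simp del: \<alpha>.F.groth_simps)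

lemma at_fibre_restricted:
  assumes p: "p \<in> Obj B" and b: "b \<in> Obj B"
  shows "at_fibre restricted D' p b = fun_comp (at_fibre F D p b) (\<alpha> b)"
proof (rule func_eqI[where C = "OMap D' b"])
  note A = \<alpha>.component[OF b]
  note AD = is_functorD[OF A]
  show "Src (at_fibre restricted D' p b) = OMap D' b" "Src (fun_comp (at_fibre F D p b) (\<alpha> b)) =
      OMap D' b"
    "Tgt (at_fibre restricted D' p b) = Tgt (fun_comp (at_fibre F D p b) (\<alpha> b))"
    by (simp_all add: AD(1))
  fix x assume x: "x \<in> Obj (OMap D' b)"
  then show "OMap (at_fibre restricted D' p b) x = OMap (fun_comp (at_fibre F D p b) (\<alpha> b)) x"
    using p b AD(1,5) by (simp add: restricted_simps)
next
  note A = \<alpha>.component[OF b]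
  note AD = is_functorD[OF A]
  fix h assume h: "h \<in> Arr (OMap D' b)"
  have "Ident B p \<in> Arr B" using D.base.Ident_hom[OF p] by (simp add: hom_iff)
  moreover have "R.vertical b h \<in> Arr (groth D')"
    using R.vertical_hom[OF b Arr_hom[OF h]] by (simp add: hom_iff)
  ultimately show "AMap (at_fibre restricted D' p b) h = AMap (fun_comp (at_fibre F D p b) (\<alpha> b)) h"
    using h AD(1) AD(11,12,13)[OF h] by (simp add: restricted_simps)
qed (use fun_comp_simps(5,6)[of "at_fibre F D p b" "\<alpha> b"] is_functorD(1)[OF \<alpha>.component[OF b]] in
    auto)

lemma restricted_pullback:
  assumes p: "p \<in> Obj B" and b: "b \<in> Obj B"
  shows "is_cat_pullback (OMap (fibrewise_groth restricted D') p b)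
    (groth_base_change (at_fibre F D p b) (\<alpha> b)) (\<alpha> b) (OMap (fibrewise_groth F D) p b)"
  using indexed_category.groth_base_change_pullback[OF at_fibre_indexed[OF p b] \<alpha>.component[OF b]] p
      b
  by (simp add: fibrewise_groth_def at_fibre_restricted)

lemma restricted_square:
  assumes \<phi>: "\<phi> \<in> hom B p q" and b: "b \<in> Obj B"
  shows "fun_comp (groth_base_change (at_fibre F D q b) (\<alpha> b))
      (mor_map (AMap (fibrewise_groth restricted D') \<phi> b)) =
    fun_comp (mor_map (AMap (fibrewise_groth F D) \<phi> b)) (groth_base_change (at_fibre F D p b)
        (\<alpha> b))"
proof -
  have pq: "p \<in> Obj B" "q \<in> Obj B" using D.base.hom_Obj[OF \<phi>] .
  have \<phi>': "\<phi> \<in> Arr B" "Dom B \<phi> = p" "Cod B \<phi> = q" using \<phi> by (auto simp: hom_iff)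
  interpret P: indexed_functor "at_fibre F D p b" "at_fibre F D q b" "OMap D b"
    "\<lambda>x. AMap F (\<phi>, Ident (groth D) (b, x))" by (rule at_fibre_indexed_functor[OF \<phi> b])
  note A = \<alpha>.component[OF b]
  interpret RP: indexed_category "at_fibre restricted D' p b" "OMap D' b"
    by (rule R.at_fibre_indexed[OF pq(1) b])
  interpret GD: category "groth D'" by (rule \<alpha>.F.groth_category)
  have "groth_map (at_fibre restricted D' p b) (at_fibre restricted D' q b)
        (\<lambda>x. AMap restricted (\<phi>, Ident (groth D') (b, x))) =
      groth_map (at_fibre restricted D' p b) (at_fibre restricted D' q b)
        (\<lambda>x. AMap F (\<phi>, Ident (groth D) (b, OMap (\<alpha> b) x)))"
  proof (rule RP.groth_map_cong)
    fix x assume x: "x \<in> Obj (OMap D' b)"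
    then have o: "(b, x) \<in> Obj (groth D')" using b by simp
    have "Ident (groth D') (b, x) \<in> Arr (groth D')" using GD.Ident_hom[OF o] by (simp add: hom_iff)
    then show "AMap restricted (\<phi>, Ident (groth D') (b, x)) =
        AMap F (\<phi>, Ident (groth D) (b, OMap (\<alpha> b) x))"
      using \<phi>' is_functorD(7)[OF \<alpha>.groth_map_functor o] o
        by (simp add: restricted_simps del: \<alpha>.F.groth_simps D.groth_simps)
  qed
  then show ?thesis
    using P.groth_map_base_change[OF A] \<phi>' b pq
    by (simp add: fibrewise_groth_def Let_def at_fibre_restricted)
qed

end

section \<open>Chosen products and pullbacks\<close>

locale category_with_limits = category C for C :: "('o, 'a) category" (structure) +
  assumes product_exists: "x \<in> Obj C \<Longrightarrow> y \<in> Obj C \<Longrightarrow> \<exists>pq. is_product C x y pq"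
    and pullback_exists: "f \<in> hom C x z \<Longrightarrow> g \<in> hom C y z \<Longrightarrow> \<exists>pq. is_pullback C f g pq"

lemma (in category) slice_product_is_pullback:
  assumes f: "f \<in> hom C x z" and g: "g \<in> hom C y z" and PQ: "is_product (slice C z) f g PQ"
  shows "is_pullback C f g (mor_map (fst PQ), mor_map (snd PQ))"
proof -
  let ?S = "slice C z"
  have hom_slice: "m \<in> hom ?S k l \<longleftrightarrow> (\<exists>h. m = Mor k l h \<and> k \<in> Arr C \<and> Cod C k = z \<and> l \<in> Arr C \<and>
      Cod C l = z \<and> h \<in> hom C (Dom C k) (Dom C l) \<and> l \<cdot> h = k)" for m k l
    by (auto simp: slice_def hom_tagged_cat)
  obtain P Q where [simp]: "PQ = (P, Q)" by (cases PQ)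
  have d: "Dom ?S = mor_src" by (simp add: slice_def)
  define k where "k = mor_src P"
  have PQ': "P \<in> hom ?S k f" "Q \<in> hom ?S k g"
    and univ: "\<And>w F G. F \<in> hom ?S w f \<Longrightarrow> G \<in> hom ?S w g \<Longrightarrow>
      \<exists>!H. H \<in> hom ?S w k \<and> P \<cdot>\<^bsub>?S\<^esub> H = F \<and> Q \<cdot>\<^bsub>?S\<^esub> H = G"
    using PQ by (auto simp: is_product_def d k_def)
  obtain p q where P: "P = Mor k f p" "Q = Mor k g q" and k: "k \<in> Arr C" "Cod C k = z"
    and p: "p \<in> hom C (Dom C k) (Dom C f)" "f \<cdot> p = k"
    and q: "q \<in> hom C (Dom C k) (Dom C g)" "g \<cdot> q = k"
    using PQ' by (auto simp: hom_slice)
  have [simp]: "Dom C f = x" "Dom C g = y" "f \<in> Arr C" "g \<in> Arr C" "Cod C f = z" "Cod C g = z"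
    using f g by (auto simp: hom_iff)
  have comp: "P \<cdot>\<^bsub>?S\<^esub> Mor l k h = Mor l f (p \<cdot> h)" "Q \<cdot>\<^bsub>?S\<^esub> Mor l k h = Mor l g (q \<cdot> h)" for l h
    by (simp_all add: slice_def P)
  have "\<exists>!h. h \<in> hom C w (Dom C k) \<and> p \<cdot> h = u \<and> q \<cdot> h = v"
    if u: "u \<in> hom C w x" and v: "v \<in> hom C w y" and uv: "f \<cdot> u = g \<cdot> v" for w u v
  proof -
    define l where "l = f \<cdot> u"
    have l: "l \<in> Arr C" "Dom C l = w" "Cod C l = z" using Comp_hom[OF u f]
      by (auto simp: l_def hom_iff)
    have L: "Mor l k h \<in> hom ?S l k \<and> P \<cdot>\<^bsub>?S\<^esub> Mor l k h = Mor l f u \<and> Q \<cdot>\<^bsub>?S\<^esub> Mor l k h =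
        Mor l g v \<longleftrightarrow>
        h \<in> hom C w (Dom C k) \<and> p \<cdot> h = u \<and> q \<cdot> h = v" for h
      using Comp_assoc[OF _ p(1)[simplified] f, of h w] p(2) k l
        by (auto simp: hom_slice comp l_def)
    have "Mor l f u \<in> hom ?S l f" "Mor l g v \<in> hom ?S l g"
      using u v uv l by (auto simp: hom_slice l_def)
    then obtain H where H: "H \<in> hom ?S l k \<and> P \<cdot>\<^bsub>?S\<^esub> H = Mor l f u \<and> Q \<cdot>\<^bsub>?S\<^esub> H = Mor l g v"
      and uniq: "\<And>H'. H' \<in> hom ?S l k \<and> P \<cdot>\<^bsub>?S\<^esub> H' = Mor l f u \<and> Q \<cdot>\<^bsub>?S\<^esub> H' = Mor l g v \<Longrightarrow> H' = H"
      using univ[of "Mor l f u" l "Mor l g v"] by (auto elim!: ex1E)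
    from H obtain h where h: "H = Mor l k h" by (auto simp: hom_slice)
    show ?thesis
    proof (rule ex1I[of _ h])
      show "h \<in> hom C w (Dom C k) \<and> p \<cdot> h = u \<and> q \<cdot> h = v" using H L h by blast
    next
      fix h' assume "h' \<in> hom C w (Dom C k) \<and> p \<cdot> h' = u \<and> q \<cdot> h' = v"
      then have "Mor l k h' = H" using L uniq by blast
      then show "h' = h" using h by simp
    qed
  qed
  moreover have "Dom C p = Dom C k" using p(1) by (simp add: hom_iff)
  ultimately show ?thesis using p q by (simp add: is_pullback_def P)
qed

text \<open>Over a terminal object the compatibility condition in the definition of a pullback is void.\<close>

lemma (in category) pullback_over_terminal:
  assumes z: "is_terminal C z" and f: "f \<in> hom C x z" and g: "g \<in> hom C y z"
  and PQ: "is_pullback C f g PQ"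
  shows "is_product C x y PQ"
proof -
  have "f \<cdot> u = g \<cdot> v" if u: "u \<in> hom C w x" and v: "v \<in> hom C w y" for u v w
    using z Comp_hom[OF u f] Comp_hom[OF v g] hom_Obj[OF u] by (auto simp: is_terminal_def)
  then show ?thesis using PQ f g by (auto simp: is_pullback_def is_product_def hom_iff)
qed

lemma locally_cartesian_closed_limits:
  assumes C: "locally_cartesian_closed C"
  shows "category_with_limits C"
proof -
  interpret category C using C by (simp add: locally_cartesian_closed_def)
  have pb: "\<exists>pq. is_pullback C f g pq" if f: "f \<in> hom C x z" and g: "g \<in> hom C y z" for f g x y z
  proof -
    have "cartesian_closed (slice C z)"
      using C hom_Obj[OF f] by (simp add: locally_cartesian_closed_def)
    moreover have "f \<in> Obj (slice C z)" "g \<in> Obj (slice C z)"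
      using f g by (auto simp: slice_def hom_iff)
    ultimately obtain PQ where "is_product (slice C z) f g PQ" unfolding cartesian_closed_def
      by blast
    then show ?thesis using slice_product_is_pullback[OF f g] by blast
  qed
  obtain z where z: "is_terminal C z" using C by (auto simp: locally_cartesian_closed_def)
  have "\<exists>pq. is_product C x y pq" if xy: "x \<in> Obj C" "y \<in> Obj C" for x y
  proof -
    obtain f g where "f \<in> hom C x z" "g \<in> hom C y z" using z xy unfolding is_terminal_def by blast
    then show ?thesis using pb pullback_over_terminal[OF z] by blast
  qed
  with pb show ?thesis by unfold_locales
qed

context category_with_limits
begin

lemma chosen_product:
  assumes "x \<in> Obj C" "y \<in> Obj C"
  shows "is_product C x y (pr1 C x y, pr2 C x y)"
  using someI_ex[OF product_exists[OF assms]] by (simp add: pr1_def pr2_def)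

lemma pr_hom:
  assumes "x \<in> Obj C" "y \<in> Obj C"
  shows "pr1 C x y \<in> hom C (prod_obj C x y) x" "pr2 C x y \<in> hom C (prod_obj C x y) y"
  using chosen_product[OF assms] by (auto simp: is_product_def prod_obj_def)

lemma pair:
  assumes f: "f \<in> hom C z x" and g: "g \<in> hom C z y"
  shows "pair C f g \<in> hom C z (prod_obj C x y)"
    "pr1 C x y \<cdot> pair C f g = f" "pr2 C x y \<cdot> pair C f g = g"
proof -
  have [simp]: "Cod C f = x" "Cod C g = y" "Dom C f = z" using f g by (auto simp: hom_iff)
  have "\<exists>!h. h \<in> hom C z (prod_obj C x y) \<and> pr1 C x y \<cdot> h = f \<and> pr2 C x y \<cdot> h = g"
    using chosen_product[OF hom_Obj(2)[OF f] hom_Obj(2)[OF g]] f g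
    by (simp add: is_product_def prod_obj_def)
  from theI'[OF this] show "pair C f g \<in> hom C z (prod_obj C x y)"
    "pr1 C x y \<cdot> pair C f g = f" "pr2 C x y \<cdot> pair C f g = g"
    by (simp_all add: pair_def)
qed

lemma product_eqI:
  assumes h: "h \<in> hom C z (prod_obj C x y)" "k \<in> hom C z (prod_obj C x y)"
  and xy: "x \<in> Obj C" "y \<in> Obj C"
    and eq: "pr1 C x y \<cdot> h = pr1 C x y \<cdot> k" "pr2 C x y \<cdot> h = pr2 C x y \<cdot> k"
  shows "h = k"
proof -
  note p = pr_hom[OF xy]
  have "\<exists>!l. l \<in> hom C z (prod_obj C x y) \<and> pr1 C x y \<cdot> l = pr1 C x y \<cdot> h \<and> pr2 C x y \<cdot> l =
      pr2 C x y \<cdot> h"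
    using chosen_product[OF xy] Comp_hom[OF h(1) p(1)] Comp_hom[OF h(1) p(2)]
    by (simp add: is_product_def prod_obj_def)
  then show ?thesis using h eq by (auto elim!: ex1E)
qed

lemma times_map:
  assumes x: "x \<in> Obj C" and f: "f \<in> hom C a b"
  shows "times_map C x f \<in> hom C (prod_obj C x a) (prod_obj C x b)"
    "pr1 C x b \<cdot> times_map C x f = pr1 C x a" "pr2 C x b \<cdot> times_map C x f = f \<cdot> pr2 C x a"
proof -
  have [simp]: "Dom C f = a" using f by (simp add: hom_iff)
  note p = pr_hom[OF x hom_Obj(1)[OF f]]
  show "times_map C x f \<in> hom C (prod_obj C x a) (prod_obj C x b)"
    "pr1 C x b \<cdot> times_map C x f = pr1 C x a" "pr2 C x b \<cdot> times_map C x f = f \<cdot> pr2 C x a"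
    using pair[OF p(1) Comp_hom[OF p(2) f]] by (simp_all add: times_map_def)
qed

lemma times_map_Ident:
  assumes x: "x \<in> Obj C" and a: "a \<in> Obj C"
  shows "times_map C x (Ident C a) = Ident C (prod_obj C x a)"
proof -
  note p = pr_hom[OF x a] and t = times_map[OF x Ident_hom[OF a]]
  show ?thesis
    by (rule product_eqI[OF t(1) Ident_hom[OF hom_Obj(1)[OF p(1)]] x a])
      (simp_all add: t(2,3) Comp_Ident[OF p(1)] Comp_Ident[OF p(2)] Ident_Comp[OF p(2)])
qed

lemma times_map_Comp:
  assumes x: "x \<in> Obj C" and f: "f \<in> hom C a b" and g: "g \<in> hom C b c"
  shows "times_map C x (g \<cdot> f) = times_map C x g \<cdot> times_map C x f"
proof -
  note o = hom_Obj[OF f] hom_Obj[OF g]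
  note tf = times_map[OF x f] and tg = times_map[OF x g] and tgf = times_map[OF x Comp_hom[OF f g]]
  have e1: "pr1 C x c \<cdot> (times_map C x g \<cdot> times_map C x f) = pr1 C x a"
    using Comp_assoc[OF tf(1) tg(1) pr_hom(1)[OF x o(4)]] tf(2) tg(2) by simp
  have e2: "pr2 C x c \<cdot> (times_map C x g \<cdot> times_map C x f) = (g \<cdot> f) \<cdot> pr2 C x a"
    using Comp_assoc[OF tf(1) tg(1) pr_hom(2)[OF x o(4)]] tf(3) tg(3)
      Comp_assoc[OF tf(1) pr_hom(2)[OF x o(3)] g] Comp_assoc[OF pr_hom(2)[OF x o(1)] f g] by simp
  show ?thesis
    by (rule product_eqI[OF tgf(1) Comp_hom[OF tf(1) tg(1)] x o(4)]) (simp_all only: tgf(2,3) e1 e2)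
qed

lemma chosen_pullback:
  assumes "f \<in> hom C x z" "g \<in> hom C y z"
  shows "is_pullback C f g (pb1 C f g, pb2 C f g)"
  using someI_ex[OF pullback_exists[OF assms]] by (simp add: pb1_def pb2_def)

lemma pb:
  assumes f: "f \<in> hom C x z" and g: "g \<in> hom C y z"
  shows "pb1 C f g \<in> hom C (pb_obj C f g) x" "pb2 C f g \<in> hom C (pb_obj C f g) y"
    "f \<cdot> pb1 C f g = g \<cdot> pb2 C f g"
  using chosen_pullback[OF assms] f g by (auto simp: is_pullback_def pb_obj_def hom_iff)

lemma pb_pair:
  assumes f: "f \<in> hom C x z" and g: "g \<in> hom C y z"
    and u: "u \<in> hom C w x" and v: "v \<in> hom C w y" and uv: "f \<cdot> u = g \<cdot> v"
  shows "pb_pair C f g u v \<in> hom C w (pb_obj C f g)"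
    "pb1 C f g \<cdot> pb_pair C f g u v = u" "pb2 C f g \<cdot> pb_pair C f g u v = v"
proof -
  have [simp]: "Dom C f = x" "Dom C g = y" "Dom C u = w" using f g u by (auto simp: hom_iff)
  have "\<exists>!h. h \<in> hom C w (pb_obj C f g) \<and> pb1 C f g \<cdot> h = u \<and> pb2 C f g \<cdot> h = v"
    using chosen_pullback[OF f g] u v uv by (simp add: is_pullback_def pb_obj_def)
  from theI'[OF this] show "pb_pair C f g u v \<in> hom C w (pb_obj C f g)"
    "pb1 C f g \<cdot> pb_pair C f g u v = u" "pb2 C f g \<cdot> pb_pair C f g u v = v"
    by (simp_all add: pb_pair_def)
qed

lemma pb_pair_unique:
  assumes f: "f \<in> hom C x z" and g: "g \<in> hom C y z" and h: "h \<in> hom C w (pb_obj C f g)"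
  shows "pb_pair C f g (pb1 C f g \<cdot> h) (pb2 C f g \<cdot> h) = h"
proof -
  note p = pb[OF f g]
  note u = Comp_hom[OF h p(1)] and v = Comp_hom[OF h p(2)]
  have [simp]: "Dom C f = x" "Dom C g = y" "Dom C (pb1 C f g \<cdot> h) = w" using f g u
    by (auto simp: hom_iff)
  have "f \<cdot> (pb1 C f g \<cdot> h) = g \<cdot> (pb2 C f g \<cdot> h)"
    using Comp_assoc[OF h p(1) f] Comp_assoc[OF h p(2) g] p(3) by simp
  then have "\<exists>!l. l \<in> hom C w (pb_obj C f g) \<and> pb1 C f g \<cdot> l = pb1 C f g \<cdot> h \<and> pb2 C f g \<cdot> l =
      pb2 C f g \<cdot> h"
    using chosen_pullback[OF f g] u v by (simp add: is_pullback_def pb_obj_def)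
  from the1_equality[OF this] show ?thesis using h by (simp add: pb_pair_def)
qed

lemma pb_pair_pb:
  assumes f: "f \<in> hom C x z" and g: "g \<in> hom C y z"
  shows "pb_pair C f g (pb1 C f g) (pb2 C f g) = Ident C (pb_obj C f g)"
  using pb_pair_unique[OF f g Ident_hom[OF hom_Obj(1)[OF pb(1)[OF f g]]]]
    Comp_Ident[OF pb(1)[OF f g]] Comp_Ident[OF pb(2)[OF f g]] by simp

lemma pb_pair_Comp:
  assumes f: "f \<in> hom C x z" and g: "g \<in> hom C y z"
    and u: "u \<in> hom C w x" and v: "v \<in> hom C w y" and uv: "f \<cdot> u = g \<cdot> v" and h: "h \<in> hom C w' w"
  shows "pb_pair C f g u v \<cdot> h = pb_pair C f g (u \<cdot> h) (v \<cdot> h)"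
proof -
  note p = pb[OF f g] and pp = pb_pair[OF f g u v uv]
  show ?thesis
    using pb_pair_unique[OF f g Comp_hom[OF h pp(1)]] Comp_assoc[OF h pp(1) p(1)]
      Comp_assoc[OF h pp(1) p(2)] pp(2,3) by simp
qed

end

section \<open>The category of polynomials\<close>

definition lenses :: "('o, 'a) category \<Rightarrow> 'a \<Rightarrow> 'a \<Rightarrow> ('a \<times> 'a) set" where
  "lenses C p q = {(f, fs). f \<in> hom C (Cod C p) (Cod C q) \<and> fs \<in> hom C (pb_obj C f q) (Dom C p) \<and>
     p \<cdot>\<^bsub>C\<^esub> fs = pb1 C f q}"

lemma Poly_cat_tagged: "Poly_cat C = tagged_cat (Arr C) (lenses C)
    (\<lambda>p. (Ident C (Cod C p), pb2 C (Ident C (Cod C p)) p))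
    (\<lambda>p q r (g, gs) (f, fs). (g \<cdot>\<^bsub>C\<^esub> f, fs \<cdot>\<^bsub>C\<^esub> base_change C f q r (g, gs)))"
  by (simp add: Poly_cat_def lenses_def[abs_def])

context category_with_limits
begin

lemma pull_section_hom:
  assumes k: "k \<in> hom C X (Cod C r)" and r: "r \<in> Arr C" and \<sigma>: "\<sigma> \<in> sections C r"
  shows "pull_section C k r \<sigma> = pb_pair C k r (Ident C X) (\<sigma> \<cdot> k)"
    "\<sigma> \<cdot> k \<in> hom C X (Dom C r)" "k \<cdot> Ident C X = r \<cdot> (\<sigma> \<cdot> k)" "Ident C X \<in> hom C X X"
proof -
  have \<sigma>': "\<sigma> \<in> hom C (Cod C r) (Dom C r)" "r \<cdot> \<sigma> = Ident C (Cod C r)" using \<sigma>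
    by (auto simp: sections_def)
  show "\<sigma> \<cdot> k \<in> hom C X (Dom C r)" "Ident C X \<in> hom C X X"
    using Comp_hom[OF k \<sigma>'(1)] Ident_hom[OF hom_Obj(1)[OF k]] .
  show "k \<cdot> Ident C X = r \<cdot> (\<sigma> \<cdot> k)"
    using Comp_assoc[OF k \<sigma>'(1) Arr_hom[OF r]] \<sigma>'(2) Ident_Comp[OF k] Comp_Ident[OF k] by simp
  show "pull_section C k r \<sigma> = pb_pair C k r (Ident C X) (\<sigma> \<cdot> k)"
    using k by (simp add: pull_section_def hom_iff)
qed

context
  fixes p q f fs
  assumes p: "p \<in> Arr C" and q: "q \<in> Arr C" and lens: "(f, fs) \<in> lenses C p q"
begin

lemma lens_hom: "f \<in> hom C (Cod C p) (Cod C q)" "fs \<in> hom C (pb_obj C f q) (Dom C p)"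
    "p \<cdot> fs = pb1 C f q"
  using lens by (auto simp: lenses_def)

lemma base_change_element:
  assumes k: "k \<in> hom C X (Cod C p)" and a: "a \<in> hom C w X" and b: "b \<in> hom C w (Dom C q)"
    and ab: "(f \<cdot> k) \<cdot> a = q \<cdot> b"
  shows "fs \<cdot> pb_pair C f q (k \<cdot> a) b \<in> hom C w (Dom C p)"
    "p \<cdot> (fs \<cdot> pb_pair C f q (k \<cdot> a) b) = k \<cdot> a"
    "pb_pair C f q (k \<cdot> a) b \<in> hom C w (pb_obj C f q)"
proof -
  note p' = Arr_hom[OF p] and q' = Arr_hom[OF q] and fh = lens_hom(1) and fsh = lens_hom(2)
  have "f \<cdot> (k \<cdot> a) = q \<cdot> b" using Comp_assoc[OF a k fh] ab by simp
  note pp = pb_pair[OF fh q' Comp_hom[OF a k] b this]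
  show "pb_pair C f q (k \<cdot> a) b \<in> hom C w (pb_obj C f q)" by (rule pp)
  show "fs \<cdot> pb_pair C f q (k \<cdot> a) b \<in> hom C w (Dom C p)" using Comp_hom[OF pp(1) fsh] .
  show "p \<cdot> (fs \<cdot> pb_pair C f q (k \<cdot> a) b) = k \<cdot> a"
    using Comp_assoc[OF pp(1) fsh p'] lens_hom(3) pp(2) by simp
qed

lemma base_change_hom:
  assumes k: "k \<in> hom C X (Cod C p)"
  shows "base_change C k p q (f, fs) \<in> hom C (pb_obj C (f \<cdot> k) q) (pb_obj C k p)"
    "pb1 C k p \<cdot> base_change C k p q (f, fs) = pb1 C (f \<cdot> k) q"
proof -
  note p' = Arr_hom[OF p] and q' = Arr_hom[OF q]
  note l = pb[OF Comp_hom[OF k lens_hom(1)] q']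
  note e = base_change_element[OF k l]
  show "base_change C k p q (f, fs) \<in> hom C (pb_obj C (f \<cdot> k) q) (pb_obj C k p)"
    "pb1 C k p \<cdot> base_change C k p q (f, fs) = pb1 C (f \<cdot> k) q"
    using pb_pair[OF k p' l(1) e(1) e(2)[symmetric]] by (simp_all add: base_change_def Let_def)
qed

text \<open>On generalized elements, \<open>k\<^sup>*\<phi>\<^sup>#\<close> is \<open>(a, b) \<mapsto> (a, \<phi>\<^sup>#(k a, b))\<close>. All identities between base
  changes reduce to this formula.\<close>

lemma base_change_pair:
  assumes k: "k \<in> hom C X (Cod C p)" and a: "a \<in> hom C w X" and b: "b \<in> hom C w (Dom C q)"
    and ab: "(f \<cdot> k) \<cdot> a = q \<cdot> b"
  shows "base_change C k p q (f, fs) \<cdot> pb_pair C (f \<cdot> k) q a b =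
    pb_pair C k p a (fs \<cdot> pb_pair C f q (k \<cdot> a) b)"
proof -
  note p' = Arr_hom[OF p] and q' = Arr_hom[OF q] and fh = lens_hom(1) and fsh = lens_hom(2)
  note lh = Comp_hom[OF k fh]
  note l = pb[OF lh q']
  note e = base_change_element[OF k l]
  note h = pb_pair[OF lh q' a b ab]
  have kl: "f \<cdot> (k \<cdot> pb1 C (f \<cdot> k) q) = q \<cdot> pb2 C (f \<cdot> k) q"
    using Comp_assoc[OF l(1) k fh] l(3) by simp
  have "pb_pair C f q (k \<cdot> pb1 C (f \<cdot> k) q) (pb2 C (f \<cdot> k) q) \<cdot> pb_pair C (f \<cdot> k) q a b =
      pb_pair C f q (k \<cdot> a) b"
    using pb_pair_Comp[OF fh q' Comp_hom[OF l(1) k] l(2) kl h(1)] h(2,3) Comp_assoc[OF h(1) l(1) k]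
      by simp
  then show ?thesis
    using pb_pair_Comp[OF k p' l(1) e(1) e(2)[symmetric] h(1)] h(2,3) Comp_assoc[OF h(1) e(3) fsh]
    by (simp add: base_change_def Let_def)
qed

lemma lens_section:
  assumes \<sigma>: "\<sigma> \<in> sections C q"
  shows "fs \<cdot> pull_section C f q \<sigma> \<in> sections C p"
proof -
  note q' = Arr_hom[OF q]
  note ps = pull_section_hom[OF lens_hom(1) q \<sigma>]
  note pp = pb_pair[OF lens_hom(1) q' ps(4,2,3)]
  show ?thesis
    using Comp_hom[OF pp(1) lens_hom(2)] Comp_assoc[OF pp(1) lens_hom(2) Arr_hom[OF p]] lens_hom(3)
        pp(2) ps(1)
    by (simp add: sections_def)
qed

text \<open>Both sides are \<open>a \<mapsto> (a, \<phi>\<^sup>#(k a, \<sigma> (f (k a))))\<close>.\<close>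

lemma base_change_section:
  assumes k: "k \<in> hom C X (Cod C p)" and \<sigma>: "\<sigma> \<in> sections C q"
  shows "base_change C k p q (f, fs) \<cdot> pull_section C (f \<cdot> k) q \<sigma> =
    pull_section C k p (fs \<cdot> pull_section C f q \<sigma>)"
proof -
  note q' = Arr_hom[OF q] and fh = lens_hom(1) and fsh = lens_hom(2)
  note lh = Comp_hom[OF k fh]
  note ps = pull_section_hom[OF fh q \<sigma>] and pk = pull_section_hom[OF lh q \<sigma>]
    and pp = pull_section_hom[OF k p lens_section[OF \<sigma>]]
  have \<sigma>': "\<sigma> \<in> hom C (Cod C q) (Dom C q)" using \<sigma> by (simp add: sections_def)
  note fp = pb_pair[OF fh q' ps(4,2,3)]
  have "(fs \<cdot> pull_section C f q \<sigma>) \<cdot> k = fs \<cdot> pb_pair C f q k (\<sigma> \<cdot> (f \<cdot> k))"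
    using Comp_assoc[OF k fp(1) fsh] pb_pair_Comp[OF fh q' ps(4,2,3) k] Ident_Comp[OF k]
      Comp_assoc[OF k fh \<sigma>'] ps(1) by simp
  then show ?thesis
    using base_change_pair[OF k pk(4,2,3)] pk(1) pp(1) Comp_Ident[OF k] by simp
qed

end

lemma identity_lens:
  assumes p: "p \<in> Arr C"
  shows "(Ident C (Cod C p), pb2 C (Ident C (Cod C p)) p) \<in> lenses C p p"
proof -
  note i = Ident_hom[OF Cod_Obj[OF p]]
  note l = pb[OF i Arr_hom[OF p]]
  show ?thesis using i l Ident_Comp[OF l(1)] by (simp add: lenses_def)
qed

lemma base_change_identity:
  assumes p: "p \<in> Arr C" and k: "k \<in> hom C X (Cod C p)"
  shows "base_change C k p p (Ident C (Cod C p), pb2 C (Ident C (Cod C p)) p) =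
      Ident C (pb_obj C k p)"
proof -
  note p' = Arr_hom[OF p] and i = Ident_hom[OF Cod_Obj[OF p]]
  note l = pb[OF k p']
  have "Ident C (Cod C p) \<cdot> (k \<cdot> pb1 C k p) = p \<cdot> pb2 C k p"
    using l Ident_Comp[OF Comp_hom[OF l(1) k]] by simp
  note pp = pb_pair[OF i p' Comp_hom[OF l(1) k] l(2) this]
  show ?thesis using pp(3) Ident_Comp[OF k] pb_pair_pb[OF k p']
    by (simp add: base_change_def Let_def)
qed

lemma lens_Comp:
  assumes pqr: "p \<in> Arr C" "q \<in> Arr C" "r \<in> Arr C"
    and \<phi>: "(f, fs) \<in> lenses C p q" and \<psi>: "(g, gs) \<in> lenses C q r"
  shows "(g \<cdot> f, fs \<cdot> base_change C f q r (g, gs)) \<in> lenses C p r"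
proof -
  note f = lens_hom[OF pqr(1,2) \<phi>] and g = lens_hom[OF pqr(2,3) \<psi>]
  note b = base_change_hom[OF pqr(2,3) \<psi> f(1)]
  show ?thesis
    using Comp_hom[OF f(1) g(1)] Comp_hom[OF b(1) f(2)] Comp_assoc[OF b(1) f(2) Arr_hom[OF pqr(1)]]
        f(3) b(2)
    by (simp add: lenses_def)
qed

text \<open>Evaluated at \<open>(a, b)\<close>, both sides give \<open>(a, \<phi>\<^sup>#(k a, \<psi>\<^sup>#(f (k a), b)))\<close>. The case where \<open>k\<close>
  is itself the first component of a morphism is associativity of composition of polynomial
  morphisms; the case where \<open>k\<close> is an output map is functoriality of reindexing.\<close>

lemma base_change_Comp:
  assumes pqr: "p \<in> Arr C" "q \<in> Arr C" "r \<in> Arr C"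
    and \<phi>: "(f, fs) \<in> lenses C p q" and \<psi>: "(g, gs) \<in> lenses C q r" and k: "k \<in> hom C X (Cod C p)"
  shows "base_change C k p r (g \<cdot> f, fs \<cdot> base_change C f q r (g, gs)) =
    base_change C k p q (f, fs) \<cdot> base_change C (f \<cdot> k) q r (g, gs)"
proof -
  note r' = Arr_hom[OF pqr(3)]
  note f = lens_hom[OF pqr(1,2) \<phi>] and g = lens_hom[OF pqr(2,3) \<psi>]
  note fk = Comp_hom[OF k f(1)]
  note l = pb[OF Comp_hom[OF fk g(1)] r']
  let ?a = "pb1 C (g \<cdot> (f \<cdot> k)) r" and ?b = "pb2 C (g \<cdot> (f \<cdot> k)) r"
  have as: "(g \<cdot> f) \<cdot> k = g \<cdot> (f \<cdot> k)" using Comp_assoc[OF k f(1) g(1)] .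
  have fka: "(f \<cdot> k) \<cdot> ?a = f \<cdot> (k \<cdot> ?a)" using Comp_assoc[OF l(1) k f(1)] .
  note ka = Comp_hom[OF l(1) k]
  have gfka: "(g \<cdot> f) \<cdot> (k \<cdot> ?a) = r \<cdot> ?b"
    using Comp_assoc[OF ka f(1) g(1)] Comp_assoc[OF l(1) fk g(1)] fka l(3) by simp
  note b1 = base_change_element[OF pqr(2,3) \<psi> fk l]
  note b2 = base_change_pair[OF pqr(2,3) \<psi> f(1) ka l(2) gfka]
  note bq = base_change_hom[OF pqr(2,3) \<psi> f(1)]
  have "(fs \<cdot> base_change C f q r (g, gs)) \<cdot> pb_pair C (g \<cdot> f) r (k \<cdot> ?a) ?b =
      fs \<cdot> pb_pair C f q (k \<cdot> ?a) (gs \<cdot> pb_pair C g r ((f \<cdot> k) \<cdot> ?a) ?b)"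
    using Comp_assoc[OF pb_pair(1)[OF Comp_hom[OF f(1) g(1)] r' ka l(2) gfka] bq(1) f(2)] b2 fka
      by simp
  then have "base_change C k p r (g \<cdot> f, fs \<cdot> base_change C f q r (g, gs)) =
      pb_pair C k p ?a (fs \<cdot> pb_pair C f q (k \<cdot> ?a) (gs \<cdot> pb_pair C g r ((f \<cdot> k) \<cdot> ?a) ?b))"
    by (simp add: base_change_def[of C k p r] Let_def as)
  also have "\<dots> = base_change C k p q (f, fs) \<cdot> base_change C (f \<cdot> k) q r (g, gs)"
    using base_change_pair[OF pqr(1,2) \<phi> k l(1) b1(1) b1(2)[symmetric]]
    by (simp add: base_change_def[of C "f \<cdot> k" q r] Let_def)
  finally show ?thesis .
qed

lemma Poly_category: "category (Poly_cat C)"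
  unfolding Poly_cat_tagged
proof (rule tagged_cat_category, goal_cases)
  case (1 p)
  then show ?case by (rule identity_lens)
next
  case (2 p q r \<phi> \<psi>)
  then show ?case by (cases \<phi>, cases \<psi>) (simp add: lens_Comp)
next
  case (3 p q \<phi>)
  obtain f fs where [simp]: "\<phi> = (f, fs)" by (cases \<phi>)
  note f = lens_hom[OF 3(1,2), of f fs]
  have \<phi>: "(f, fs) \<in> lenses C p q" using 3 by simp
  note i = Ident_hom[OF Cod_Obj[OF 3(1)]]
  note fh = f(1)[OF \<phi>]
  note l = pb[OF fh Arr_hom[OF 3(2)]]
  have fi: "f \<cdot> Ident C (Cod C p) = f" by (rule Comp_Ident[OF fh])
  have "pb2 C (Ident C (Cod C p)) p \<cdot> base_change C (Ident C (Cod C p)) p q (f, fs) =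
      fs \<cdot> pb_pair C f q (Ident C (Cod C p) \<cdot> pb1 C f q) (pb2 C f q)"
    using pb_pair(3)[OF i Arr_hom[OF 3(1)] l(1)]
      base_change_element[OF 3(1,2) \<phi> i l(1,2)] fi l(3) by (simp add: base_change_def Let_def)
  then show ?case
    using fi Ident_Comp[OF l(1)] pb_pair_pb[OF fh Arr_hom[OF 3(2)]] Comp_Ident[OF f(2)[OF \<phi>]]
      by simp
next
  case (4 p q \<phi>)
  obtain f fs where [simp]: "\<phi> = (f, fs)" by (cases \<phi>)
  have \<phi>: "(f, fs) \<in> lenses C p q" using 4 by simp
  note f = lens_hom[OF 4(1,2) \<phi>]
  show ?case
    using base_change_identity[OF 4(2) f(1)] Ident_Comp[OF f(1)] Comp_Ident[OF f(2)] by simp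
next
  case (5 p q r s \<phi> \<psi> \<chi>)
  obtain f fs g gs h hs where [simp]: "\<phi> = (f, fs)" "\<psi> = (g, gs)" "\<chi> = (h, hs)"
    by (cases \<phi>, cases \<psi>, cases \<chi>)
  have l: "(f, fs) \<in> lenses C p q" "(g, gs) \<in> lenses C q r" "(h, hs) \<in> lenses C r s" using 5 by auto
  note f = lens_hom[OF 5(1,2) l(1)] and g = lens_hom[OF 5(2,3) l(2)]
    and h = lens_hom[OF 5(3,4) l(3)]
  show ?case
    using Comp_assoc[OF f(1) g(1) h(1)] base_change_Comp[OF 5(2-4) l(2,3) f(1)]
      Comp_assoc[OF base_change_hom(1)[OF 5(3,4) l(3) Comp_hom[OF f(1) g(1)]]
        base_change_hom(1)[OF 5(2,3) l(2) f(1)] f(2)] by simp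
qed

end

section \<open>Functors to \<open>Cat\<close> that relabel objects\<close>

text \<open>\<open>Dyn\<close>, \<open>DynP\<close> and \<open>BunDyn\<close> act on objects only, as the underlying map of an arrow is kept. So
  their functoriality amounts to functoriality of the action on objects, once every map that is an
  arrow before the action is seen to be one after it.\<close>

lemma relabelling_functor:
  assumes B: "category B"
    and D: "\<And>c. c \<in> Obj B \<Longrightarrow> D c = tagged_cat (X c) (H c) (i c) (\<lambda>_ _ _. k)"
    and cat: "\<And>c. c \<in> Obj B \<Longrightarrow> category (D c)"
    and h: "\<And>f c d x. f \<in> hom B c d \<Longrightarrow> x \<in> X c \<Longrightarrow> h f x \<in> X d"
      "\<And>f c d x. f \<in> hom B c d \<Longrightarrow> x \<in> X c \<Longrightarrow> i d (h f x) = i c x"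
      "\<And>f c d x y m. f \<in> hom B c d \<Longrightarrow> x \<in> X c \<Longrightarrow> y \<in> X c \<Longrightarrow> m \<in> H c x y \<Longrightarrow> m \<in> H d (h f x) (h f y)"
    and h_Ident: "\<And>c x. c \<in> Obj B \<Longrightarrow> x \<in> X c \<Longrightarrow> h (Ident B c) x = x"
    and h_Comp: "\<And>f g c d e x. f \<in> hom B c d \<Longrightarrow> g \<in> hom B d e \<Longrightarrow> x \<in> X c \<Longrightarrow>
      h (g \<cdot>\<^bsub>B\<^esub> f) x = h g (h f x)"
  shows "is_functor \<lparr>Src = B, Tgt = Cat, OMap = (\<lambda>c \<in> Obj B. D c),
    AMap = (\<lambda>f \<in> Arr B. tagged_fun (D (Dom B f)) (D (Cod B f)) (h f))\<rparr> B Cat"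
    (is "is_functor ?F B Cat")
proof -
  interpret B: category B by fact
  have F: "is_functor (tagged_fun (D c) (D d) (h f)) (D c) (D d)" if f: "f \<in> hom B c d" for f c d
    using B.hom_Obj[OF f] by (intro tagged_fun_functor[OF D D cat cat] h[OF f])
  show ?thesis
  proof (rule is_functorI)
    fix f c d assume f: "f \<in> hom B c d"
    then have f': "f \<in> Arr B" "Dom B f = c" "Cod B f = d" by (auto simp: hom_iff)
    then show "AMap ?F f \<in> hom Cat (OMap ?F c) (OMap ?F d)"
      using F[OF f] B.hom_Obj[OF f] by simp
    fix g e assume g: "g \<in> hom B d e"
    then have g': "g \<in> Arr B" "Dom B g = d" "Cod B g = e" by (auto simp: hom_iff)
    have gf: "g \<cdot>\<^bsub>B\<^esub> f \<in> Arr B" "Dom B (g \<cdot>\<^bsub>B\<^esub> f) = c" "Cod B (g \<cdot>\<^bsub>B\<^esub> f) = e"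
      using B.Comp_hom[OF f g] by (auto simp: hom_iff)
    have "fun_comp (tagged_fun (D d) (D e) (h g)) (tagged_fun (D c) (D d) (h f)) =
        tagged_fun (D c) (D e) (h (g \<cdot>\<^bsub>B\<^esub> f))"
      by (rule tagged_fun_comp[OF F[OF f] D[OF B.hom_Obj(1)[OF f]]]) (simp add: h_Comp[OF f g])
    then show "AMap ?F (g \<cdot>\<^bsub>B\<^esub> f) = AMap ?F g \<cdot>\<^bsub>Cat\<^esub> AMap ?F f"
      using f' g' gf by simp
  next
    fix c assume c: "c \<in> Obj B"
    have "tagged_fun (D c) (D c) (h (Ident B c)) = fun_id (D c)"
      by (rule tagged_fun_id[OF D[OF c]]) (rule h_Ident[OF c])
    then show "AMap ?F (Ident B c) = Ident Cat (OMap ?F c)"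
      using c B.Ident_hom[OF c] by (simp add: hom_iff)
  qed (use cat B in \<open>auto simp: Cat_category\<close>)
qed

section \<open>Reindexing open systems\<close>

locale open_systems = category_with_limits C for C :: "('o, 'a) category" (structure) +
  fixes T :: "('o, 'a) internal_monoid"
  assumes Carrier_Obj: "Carrier T \<in> Obj C"
begin

lemma Poly_simps [simp]: "Obj (Poly_cat C) = Arr C" "Dom (Poly_cat C) = mor_src"
    "Cod (Poly_cat C) = mor_tgt"
  by (simp_all add: Poly_cat_tagged)

lemma hom_PolyE:
  assumes "\<phi> \<in> hom (Poly_cat C) p q"
  obtains f fs where "\<phi> = Mor p q (f, fs)" "p \<in> Arr C" "q \<in> Arr C" "(f, fs) \<in> lenses C p q"
  using assms by (auto simp: Poly_cat_tagged hom_tagged_cat)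

text \<open>The pulled back section \<open>i \<mapsto> \<phi>\<^sup>#(i, \<sigma> (\<phi>\<^sub>1 i))\<close>.\<close>

definition pull_lens :: "('a, 'a \<times> 'a) mor \<Rightarrow> 'a \<Rightarrow> 'a" where
  "pull_lens \<phi> \<sigma> = snd (mor_map \<phi>) \<cdot> pull_section C (fst (mor_map \<phi>)) (mor_tgt \<phi>) \<sigma>"

lemma pull_lens_section:
  assumes "\<phi> \<in> hom (Poly_cat C) p q" "\<sigma> \<in> sections C q"
  shows "pull_lens \<phi> \<sigma> \<in> sections C p"
  using assms by (auto simp: pull_lens_def lens_section elim!: hom_PolyE)

text \<open>Reindexing precomposes the update with \<open>k\<^sup>*\<phi>\<^sup>#\<close>, for \<open>k\<close> the output map, and \<open>k\<^sup>*\<phi>\<^sup>#\<close> carries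
  a pulled back section to a pulled back section.\<close>

lemma closure_reindex:
  assumes \<phi>: "\<phi> \<in> hom (Poly_cat C) p q" and \<theta>: "is_open_system C T p \<theta>" and \<sigma>: "\<sigma> \<in> sections C q"
  shows "closure C q (reindex C \<phi> \<theta>) \<sigma> = closure C p \<theta> (pull_lens \<phi> \<sigma>)"
proof -
  obtain f fs where [simp]: "\<phi> = Mor p q (f, fs)" and pq: "p \<in> Arr C" "q \<in> Arr C"
    and l: "(f, fs) \<in> lenses C p q" by (rule hom_PolyE[OF \<phi>])
  have O: "Out \<theta> \<in> hom C (prod_obj C (Carrier T) (State \<theta>)) (Cod C p)"
    and U: "Upd \<theta> \<in> hom C (pb_obj C (Out \<theta>) p) (State \<theta>)"
    using \<theta> by (auto simp: is_open_system_def)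
  note fO = Comp_hom[OF O lens_hom(1)[OF pq l]]
  note ps = pull_section_hom[OF fO pq(2) \<sigma>]
  have s: "pull_section C (f \<cdot> Out \<theta>) q \<sigma> \<in> hom C (prod_obj C (Carrier T) (State \<theta>))
      (pb_obj C (f \<cdot> Out \<theta>) q)"
    using pb_pair(1)[OF fO Arr_hom[OF pq(2)] ps(4,2,3)] ps(1) by simp
  show ?thesis
    using Comp_assoc[OF s base_change_hom(1)[OF pq l O] U] base_change_section[OF pq l O \<sigma>]
    by (simp add: closure_def reindex_def pull_lens_def)
qed

lemma State_reindex [simp]: "State (reindex C \<phi> \<theta>) = State \<theta>"
  by (simp add: reindex_def)

lemma reindex_open_system:
  assumes \<phi>: "\<phi> \<in> hom (Poly_cat C) p q" and \<theta>: "is_open_system C T p \<theta>"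
  shows "is_open_system C T q (reindex C \<phi> \<theta>)"
proof -
  obtain f fs where [simp]: "\<phi> = Mor p q (f, fs)" and pq: "p \<in> Arr C" "q \<in> Arr C"
    and l: "(f, fs) \<in> lenses C p q" by (rule hom_PolyE[OF \<phi>])
  have O: "Out \<theta> \<in> hom C (prod_obj C (Carrier T) (State \<theta>)) (Cod C p)"
    and U: "Upd \<theta> \<in> hom C (pb_obj C (Out \<theta>) p) (State \<theta>)"
    using \<theta> by (auto simp: is_open_system_def)
  have "Out (reindex C \<phi> \<theta>) \<in> hom C (prod_obj C (Carrier T) (State \<theta>)) (Cod C q)"
    "Upd (reindex C \<phi> \<theta>) \<in> hom C (pb_obj C (Out (reindex C \<phi> \<theta>)) q) (State \<theta>)"
    using Comp_hom[OF O lens_hom(1)[OF pq l]] Comp_hom[OF base_change_hom(1)[OF pq l O] U]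
    by (simp_all add: reindex_def)
  moreover have "is_action C T (State \<theta>) (closure C q (reindex C \<phi> \<theta>) \<sigma>)" if "\<sigma> \<in> sections C q"
    for \<sigma>
    using \<theta> pull_lens_section[OF \<phi> that] closure_reindex[OF \<phi> \<theta> that]
      by (simp add: is_open_system_def)
  ultimately show ?thesis using \<theta> by (simp add: is_open_system_def)
qed

lemma reindex_Ident:
  assumes p: "p \<in> Arr C" and \<theta>: "is_open_system C T p \<theta>"
  shows "reindex C (Ident (Poly_cat C) p) \<theta> = \<theta>"
proof -
  have O: "Out \<theta> \<in> hom C (prod_obj C (Carrier T) (State \<theta>)) (Cod C p)"
    and U: "Upd \<theta> \<in> hom C (pb_obj C (Out \<theta>) p) (State \<theta>)"
    using \<theta> by (auto simp: is_open_system_def)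
  show ?thesis
    using base_change_identity[OF p O] Comp_Ident[OF U] Ident_Comp[OF O]
    by (cases \<theta>) (simp add: reindex_def Poly_cat_tagged)
qed

lemma reindex_Comp:
  assumes \<phi>: "\<phi> \<in> hom (Poly_cat C) p q" and \<psi>: "\<psi> \<in> hom (Poly_cat C) q r"
  and \<theta>: "is_open_system C T p \<theta>"
  shows "reindex C (\<psi> \<cdot>\<^bsub>Poly_cat C\<^esub> \<phi>) \<theta> = reindex C \<psi> (reindex C \<phi> \<theta>)"
proof -
  obtain f fs where [simp]: "\<phi> = Mor p q (f, fs)" and pq: "p \<in> Arr C" "q \<in> Arr C"
    and l: "(f, fs) \<in> lenses C p q" by (rule hom_PolyE[OF \<phi>])
  from \<psi> obtain g gs where [simp]: "\<psi> = Mor q r (g, gs)" and r: "r \<in> Arr C"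
    and m: "(g, gs) \<in> lenses C q r" by (rule hom_PolyE)
  have O: "Out \<theta> \<in> hom C (prod_obj C (Carrier T) (State \<theta>)) (Cod C p)"
    and U: "Upd \<theta> \<in> hom C (pb_obj C (Out \<theta>) p) (State \<theta>)"
    using \<theta> by (auto simp: is_open_system_def)
  note f = lens_hom[OF pq l] and g = lens_hom[OF pq(2) r m]
  show ?thesis
    using base_change_Comp[OF pq r l m O] Comp_assoc[OF O f(1) g(1)]
      Comp_assoc[OF base_change_hom(1)[OF pq(2) r m Comp_hom[OF O f(1)]] base_change_hom(1)[OF pq l
          O] U]
    by (simp add: reindex_def Poly_cat_tagged)
qed

lemma closure_hom:
  assumes "is_open_system C T p \<theta>" "\<sigma> \<in> sections C p"
  shows "closure C p \<theta> \<sigma> \<in> hom C (prod_obj C (Carrier T) (State \<theta>)) (State \<theta>)"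
  using assms by (simp add: is_open_system_def is_action_def)

lemma equivariant_Ident:
  assumes \<theta>: "is_open_system C T p \<theta>" and \<sigma>: "\<sigma> \<in> sections C p"
  shows "equivariant C T (closure C p \<theta> \<sigma>) (closure C p \<theta> \<sigma>) (Ident C (State \<theta>))"
proof -
  note c = closure_hom[OF \<theta> \<sigma>]
  show ?thesis
    using Ident_Comp[OF c] Comp_Ident[OF c] times_map_Ident[OF Carrier_Obj] hom_Obj[OF c]
    by (simp add: equivariant_def)
qed

lemma equivariant_Comp:
  assumes \<alpha>: "\<alpha> \<in> hom C (prod_obj C (Carrier T) R) R"
  and \<beta>: "\<beta> \<in> hom C (prod_obj C (Carrier T) S) S"
    and \<gamma>: "\<gamma> \<in> hom C (prod_obj C (Carrier T) S') S'"
    and f: "f \<in> hom C R S" and g: "g \<in> hom C S S'"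
    and eq: "equivariant C T \<alpha> \<beta> f" "equivariant C T \<beta> \<gamma> g"
  shows "equivariant C T \<alpha> \<gamma> (g \<cdot> f)"
proof -
  note tf = times_map(1)[OF Carrier_Obj f] and tg = times_map(1)[OF Carrier_Obj g]
  have "(g \<cdot> f) \<cdot> \<alpha> = g \<cdot> (\<beta> \<cdot> times_map C (Carrier T) f)"
    using Comp_assoc[OF \<alpha> f g] eq(1) by (simp add: equivariant_def)
  also have "\<dots> = (\<gamma> \<cdot> times_map C (Carrier T) g) \<cdot> times_map C (Carrier T) f"
    using Comp_assoc[OF tf \<beta> g] eq(2) by (simp add: equivariant_def)
  also have "\<dots> = \<gamma> \<cdot> times_map C (Carrier T) (g \<cdot> f)"
    using Comp_assoc[OF tf tg \<gamma>] times_map_Comp[OF Carrier_Obj f g] by simp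
  finally show ?thesis by (simp add: equivariant_def)
qed

lemma Dyn_hom_Ident: "is_open_system C T p \<theta> \<Longrightarrow> Ident C (State \<theta>) \<in> Dyn_hom C T p \<theta> \<theta>"
  using equivariant_Ident Ident_hom by (auto simp: Dyn_hom_def is_open_system_def)

lemma Dyn_hom_Comp:
  assumes "is_open_system C T p \<theta>" "is_open_system C T p \<psi>" "is_open_system C T p \<rho>"
    and f: "f \<in> Dyn_hom C T p \<theta> \<psi>" and g: "g \<in> Dyn_hom C T p \<psi> \<rho>"
  shows "g \<cdot> f \<in> Dyn_hom C T p \<theta> \<rho>"
  using f g Comp_hom equivariant_Comp[OF closure_hom[OF assms(1)] closure_hom[OF assms(2)]
      closure_hom[OF assms(3)]]
  by (auto simp: Dyn_hom_def)

lemma Dyn_hom_reindex: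
  assumes \<phi>: "\<phi> \<in> hom (Poly_cat C) p q" and "is_open_system C T p \<theta>" "is_open_system C T p \<psi>"
    and "f \<in> Dyn_hom C T p \<theta> \<psi>"
  shows "f \<in> Dyn_hom C T q (reindex C \<phi> \<theta>) (reindex C \<phi> \<psi>)"
  using assms by (simp add: Dyn_hom_def closure_reindex pull_lens_section[OF \<phi>])

lemma Dyn_category: "category (Dyn_cat C T p)"
  unfolding Dyn_cat_def
  by (rule concrete_category[where U = State])
    (auto simp: category_axioms Dyn_hom_Ident intro: Dyn_hom_Comp, auto simp: Dyn_hom_def)

lemma Dyn_functor: "is_functor (Dyn C T) (Poly_cat C) Cat"
proof -
  have "Dyn C T = \<lparr>Src = Poly_cat C, Tgt = Cat, OMap = (\<lambda>p \<in> Obj (Poly_cat C). Dyn_cat C T p),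
     AMap = (\<lambda>\<phi> \<in> Arr (Poly_cat C). tagged_fun (Dyn_cat C T (Dom (Poly_cat C) \<phi>))
       (Dyn_cat C T (Cod (Poly_cat C) \<phi>)) (reindex C \<phi>))\<rparr>"
    by (simp add: Dyn_def)
  also have "is_functor \<dots> (Poly_cat C) Cat"
    by (rule relabelling_functor[OF Poly_category Dyn_cat_def Dyn_category])
      (auto simp: reindex_open_system reindex_Ident reindex_Comp Dyn_hom_reindex
          simp del: tagged_cat_simps)
  finally show ?thesis .
qed

section \<open>Open bundle systems\<close>

lemma BunDyn_category:
  assumes \<theta>: "is_open_system C T b \<theta>"
  shows "category (BunDyn_cat C T p b \<theta>)"
  unfolding BunDyn_cat_def
proof (rule concrete_category[where U = "\<lambda>x. State (snd x)"], goal_cases)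
  case (4 x)
  then show ?case
    using equivariant_Ident[of p "snd x"] Comp_Ident Ident_hom by (auto simp: is_open_system_def)
next
  case (5 x y z f g)
  obtain \<pi> \<upsilon> \<pi>' \<omega> \<pi>'' \<xi> where [simp]: "x = (\<pi>, \<upsilon>)" "y = (\<pi>', \<omega>)" "z = (\<pi>'', \<xi>)"
    by (cases x, cases y, cases z)
  have s: "is_open_system C T p \<upsilon>" "is_open_system C T p \<omega>" "is_open_system C T p \<xi>"
    and \<pi>'': "\<pi>'' \<in> hom C (State \<xi>) (State \<theta>)"
    and f: "f \<in> hom C (State \<upsilon>) (State \<omega>)" and g: "g \<in> hom C (State \<omega>) (State \<xi>)"
    using 5 by auto
  show ?case
    using 5 Comp_assoc[OF f g \<pi>''] Comp_hom[OF f g]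
      equivariant_Comp[OF closure_hom[OF s(1)] closure_hom[OF s(2)] closure_hom[OF s(3)] f g]
        by auto
qed (auto simp: category_axioms)

text \<open>An index arrow moves \<open>(\<pi>, \<upsilon>)\<close> to \<open>(f \<cdot> \<pi>, reindex C \<phi> \<upsilon>)\<close>. Equivariance of \<open>f \<cdot> \<pi>\<close> at
  sections \<open>\<sigma>\<close> of \<open>q\<close> and \<open>\<tau>\<close> of \<open>c\<close> is that of \<open>\<pi>\<close> at the sections of \<open>p\<close> and \<open>b\<close> to which they
  pull back, followed by that of \<open>f\<close> at \<open>\<tau>\<close>.\<close>

lemma BunDyn_functor: "is_functor (BunDyn C T) (prod_cat (Poly_cat C) (groth (Dyn C T))) Cat"
proof -
  interpret D: indexed_category "Dyn C T" "Poly_cat C" by unfold_locales (rule Dyn_functor)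
  let ?B = "prod_cat (Poly_cat C) (groth (Dyn C T))"
  let ?D = "\<lambda>(p, (b, \<theta>)). BunDyn_cat C T p b \<theta>"
  let ?h = "\<lambda>(\<phi>, m) (\<pi>, \<upsilon>). (mor_map (snd (mor_map m)) \<cdot> \<pi>, reindex C \<phi> \<upsilon>)"
  have Dyn_Obj: "OMap (Dyn C T) b = Dyn_cat C T b" if "b \<in> Arr C" for b using that
    by (simp add: Dyn_def)
  \<comment> \<open>The fibre component of an arrow of the total category of \<open>Dyn\<close> starts at the reindexed system.\<close>
  have arrE: thesis if "x \<in> hom ?B u v"
    and "\<And>\<phi> p q b \<theta> c \<rho> \<chi> f. \<lbrakk>u = (p, (b, \<theta>)); v = (q, (c, \<rho>)); x =
        (\<phi>, Mor (b, \<theta>) (c, \<rho>) (\<chi>, Mor (reindex C \<chi> \<theta>) \<rho> f));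
      \<phi> \<in> hom (Poly_cat C) p q; \<chi> \<in> hom (Poly_cat C) b c; b \<in> Arr C; c \<in> Arr C; is_open_system C T b
          \<theta>;
      is_open_system C T c \<rho>; f \<in> Dyn_hom C T c (reindex C \<chi> \<theta>) \<rho>\<rbrakk> \<Longrightarrow> thesis" for x u v thesis
  proof -
    obtain \<phi> m p B q C' where [simp]: "x = (\<phi>, m)" "u = (p, B)" "v = (q, C')"
      by (cases x, cases u, cases v)
    from that(1) have \<phi>: "\<phi> \<in> hom (Poly_cat C) p q" and m: "m \<in> hom (groth (Dyn C T)) B C'" by auto
    from m obtain b \<theta> c \<rho> \<chi> g where m': "B = (b, \<theta>)" "C' = (c, \<rho>)" "m = Mor (b, \<theta>) (c, \<rho>) (\<chi>, g)"
      and \<chi>: "\<chi> \<in> hom (Poly_cat C) b c"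
      and g: "g \<in> hom (OMap (Dyn C T) c) (OMap (AMap (Dyn C T) \<chi>) \<theta>) \<rho>"
      and o: "\<theta> \<in> Obj (OMap (Dyn C T) b)" "\<rho> \<in> Obj (OMap (Dyn C T) c)" "b \<in> Obj (Poly_cat C)"
        "c \<in> Obj (Poly_cat C)"
      by (rule D.groth_homE)
    have \<theta>: "is_open_system C T b \<theta>" "is_open_system C T c \<rho>" using o
      by (auto simp: Dyn_Obj Dyn_cat_def)
    have "OMap (AMap (Dyn C T) \<chi>) \<theta> = reindex C \<chi> \<theta>"
      using \<chi> o by (auto simp: Dyn_def hom_iff)
    then obtain f where "g = Mor (reindex C \<chi> \<theta>) \<rho> f" "f \<in> Dyn_hom C T c (reindex C \<chi> \<theta>) \<rho>"
      using g o by (auto simp: Dyn_Obj Dyn_cat_def hom_tagged_cat)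
    then show thesis using that(2) \<phi> m' \<chi> o \<theta> by simp
  qed
  have "BunDyn C T = \<lparr>Src = ?B, Tgt = Cat, OMap = (\<lambda>c \<in> Obj ?B. ?D c),
    AMap = (\<lambda>x \<in> Arr ?B. tagged_fun (?D (Dom ?B x)) (?D (Cod ?B x)) (?h x))\<rparr>"
    by (auto simp: BunDyn_def case_prod_unfold intro!: restrict_ext)
  also have "is_functor \<dots> ?B Cat"
  proof (rule relabelling_functor[where
      X = "\<lambda>(p, (b, \<theta>)). {(\<pi>, \<upsilon>). is_open_system C T p \<upsilon> \<and> \<pi> \<in> hom C (State \<upsilon>) (State \<theta>) \<and>
        (\<forall>\<sigma> \<in> sections C p. \<forall>\<tau> \<in> sections C b.
           equivariant C T (closure C p \<upsilon> \<sigma>) (closure C b \<theta> \<tau>) \<pi>)}" and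
      H = "\<lambda>(p, (b, \<theta>)) (\<pi>, \<upsilon>) (\<pi>', \<omega>). {f \<in> hom C (State \<upsilon>) (State \<omega>). \<pi>' \<cdot>\<^bsub>C\<^esub> f = \<pi> \<and>
        (\<forall>\<sigma> \<in> sections C p. \<forall>\<tau> \<in> sections C b.
           equivariant C T (closure C p \<upsilon> \<sigma>) (closure C p \<omega> \<sigma>) f)}" and
      i = "\<lambda>_ (\<pi>, \<upsilon>). Ident C (State \<upsilon>)" and k = "\<lambda>g f. g \<cdot> f"], goal_cases)
    case 1
    show ?case by (rule prod_cat_category[OF Poly_category D.groth_category])
  next
    case (2 c)
    then show ?case by (auto simp: BunDyn_cat_def)
  next
    case (3 c)
    then show ?case by (auto simp: Dyn_Obj Dyn_cat_def intro!: BunDyn_category)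
  next
    case (4 x u v y)
    from 4(1) show ?case
    proof (rule arrE)
      fix \<phi> p q b \<theta> c \<rho> \<chi> f
      assume [simp]: "u = (p, (b, \<theta>))" "v = (q, (c, \<rho>))"
          "x = (\<phi>, Mor (b, \<theta>) (c, \<rho>) (\<chi>, Mor (reindex C \<chi> \<theta>) \<rho> f))"
        and \<phi>: "\<phi> \<in> hom (Poly_cat C) p q" and \<chi>: "\<chi> \<in> hom (Poly_cat C) b c"
        and \<theta>: "is_open_system C T b \<theta>" and \<rho>: "is_open_system C T c \<rho>"
        and f: "f \<in> Dyn_hom C T c (reindex C \<chi> \<theta>) \<rho>"
      obtain \<pi> \<upsilon> where [simp]: "y = (\<pi>, \<upsilon>)" by (cases y)
      from 4(2) have \<upsilon>: "is_open_system C T p \<upsilon>" and \<pi>: "\<pi> \<in> hom C (State \<upsilon>) (State \<theta>)"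
        and eq: "\<And>\<sigma> \<tau>. \<sigma> \<in> sections C p \<Longrightarrow> \<tau> \<in> sections C b \<Longrightarrow>
          equivariant C T (closure C p \<upsilon> \<sigma>) (closure C b \<theta> \<tau>) \<pi>" by auto
      have f': "f \<in> hom C (State \<theta>) (State \<rho>)" using f by (simp add: Dyn_hom_def)
      have "equivariant C T (closure C q (reindex C \<phi> \<upsilon>) \<sigma>) (closure C c \<rho> \<tau>) (f \<cdot> \<pi>)"
        if \<sigma>: "\<sigma> \<in> sections C q" and \<tau>: "\<tau> \<in> sections C c" for \<sigma> \<tau>
      proof (rule equivariant_Comp)
        let ?\<beta> = "closure C c (reindex C \<chi> \<theta>) \<tau>"
        show "equivariant C T (closure C q (reindex C \<phi> \<upsilon>) \<sigma>) ?\<beta> \<pi>"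
          using eq[OF pull_lens_section[OF \<phi> \<sigma>] pull_lens_section[OF \<chi> \<tau>]]
          by (simp add: closure_reindex[OF \<phi> \<upsilon> \<sigma>] closure_reindex[OF \<chi> \<theta> \<tau>])
        show "equivariant C T ?\<beta> (closure C c \<rho> \<tau>) f" using f \<tau> by (simp add: Dyn_hom_def)
        show "closure C q (reindex C \<phi> \<upsilon>) \<sigma> \<in> hom C (prod_obj C (Carrier T) (State \<upsilon>)) (State \<upsilon>)"
          "?\<beta> \<in> hom C (prod_obj C (Carrier T) (State \<theta>)) (State \<theta>)"
          "closure C c \<rho> \<tau> \<in> hom C (prod_obj C (Carrier T) (State \<rho>)) (State \<rho>)"
          using closure_hom[OF reindex_open_system[OF \<phi> \<upsilon>] \<sigma>]
              closure_hom[OF reindex_open_system[OF \<chi> \<theta>] \<tau>]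
            closure_hom[OF \<rho> \<tau>] by simp_all
      qed (rule \<pi> f')+
      then show ?case using reindex_open_system[OF \<phi> \<upsilon>] Comp_hom[OF \<pi> f'] by simp
    qed
  next
    case (5 x u v y)
    then show ?case by (auto elim!: arrE)
  next
    case (6 x u v y z m)
    from 6(1) show ?case
    proof (rule arrE)
      fix \<phi> p q b \<theta> c \<rho> \<chi> f
      assume [simp]: "u = (p, (b, \<theta>))" "v = (q, (c, \<rho>))"
          "x = (\<phi>, Mor (b, \<theta>) (c, \<rho>) (\<chi>, Mor (reindex C \<chi> \<theta>) \<rho> f))"
        and \<phi>: "\<phi> \<in> hom (Poly_cat C) p q" and \<chi>: "\<chi> \<in> hom (Poly_cat C) b c"
        and \<theta>: "is_open_system C T b \<theta>" and \<rho>: "is_open_system C T c \<rho>"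
        and f: "f \<in> Dyn_hom C T c (reindex C \<chi> \<theta>) \<rho>"
      obtain \<pi> \<upsilon> \<pi>' \<omega> where [simp]: "y = (\<pi>, \<upsilon>)" "z = (\<pi>', \<omega>)" by (cases y, cases z)
      have f': "f \<in> hom C (State \<theta>) (State \<rho>)" using f by (simp add: Dyn_hom_def)
      have s: "is_open_system C T p \<upsilon>" "is_open_system C T p \<omega>"
        and \<pi>': "\<pi>' \<in> hom C (State \<omega>) (State \<theta>)"
        and m: "m \<in> hom C (State \<upsilon>) (State \<omega>)" "\<pi>' \<cdot> m = \<pi>"
        and eq: "\<And>\<sigma> \<tau>. \<sigma> \<in> sections C p \<Longrightarrow> \<tau> \<in> sections C b \<Longrightarrow>
          equivariant C T (closure C p \<upsilon> \<sigma>) (closure C p \<omega> \<sigma>) m"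
        using 6(2-4) by auto
      \<comment> \<open>Equivariance of \<open>m\<close> is quantified over sections of the base polynomial too, which is \<open>b\<close>
        in the hypothesis and \<open>c\<close> in the goal. The section of \<open>c\<close> pulls back to one of \<open>b\<close>.\<close>
      have "equivariant C T (closure C q (reindex C \<phi> \<upsilon>) \<sigma>) (closure C q (reindex C \<phi> \<omega>) \<sigma>) m"
        if \<sigma>: "\<sigma> \<in> sections C q" and \<tau>: "\<tau> \<in> sections C c" for \<sigma> \<tau>
        using eq[OF pull_lens_section[OF \<phi> \<sigma>] pull_lens_section[OF \<chi> \<tau>]]
        by (simp add: closure_reindex[OF \<phi> s(1) \<sigma>] closure_reindex[OF \<phi> s(2) \<sigma>])
      then show ?case using m Comp_assoc[OF m(1) \<pi>' f'] by auto
    qed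
  next
    case (7 c y)
    obtain p b \<theta> \<pi> \<upsilon> where [simp]: "c = (p, (b, \<theta>))" "y = (\<pi>, \<upsilon>)" by (cases c, cases y, auto)
    have o: "p \<in> Arr C" "b \<in> Arr C" and \<pi>: "\<pi> \<in> hom C (State \<upsilon>) (State \<theta>)"
      and \<upsilon>: "is_open_system C T p \<upsilon>"
      using 7 by auto
    show ?case
      using reindex_Ident[OF o(1) \<upsilon>] Ident_Comp[OF \<pi>] o by (simp add: Dyn_Obj Dyn_cat_def)
  next
    case (8 x x' u v w y)
    from 8(1) show ?case
    proof (rule arrE)
      fix \<phi> p q b \<theta> c \<rho> \<chi> f
      assume e1 [simp]: "u = (p, (b, \<theta>))" "v = (q, (c, \<rho>))"
          "x = (\<phi>, Mor (b, \<theta>) (c, \<rho>) (\<chi>, Mor (reindex C \<chi> \<theta>) \<rho> f))"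
        and \<phi>: "\<phi> \<in> hom (Poly_cat C) p q" and \<chi>: "\<chi> \<in> hom (Poly_cat C) b c"
        and \<theta>: "is_open_system C T b \<theta>"
        and f: "f \<in> Dyn_hom C T c (reindex C \<chi> \<theta>) \<rho>" and \<rho>: "is_open_system C T c \<rho>"
      from 8(2) show ?case
      proof (rule arrE)
        fix \<phi>' q' r c' \<rho>' d \<kappa> \<chi>' f'
        assume e2: "v = (q', (c', \<rho>'))" "w = (r, (d, \<kappa>))"
            "x' = (\<phi>', Mor (c', \<rho>') (d, \<kappa>) (\<chi>', Mor (reindex C \<chi>' \<rho>') \<kappa> f'))"
          and \<phi>': "\<phi>' \<in> hom (Poly_cat C) q' r" and \<chi>': "\<chi>' \<in> hom (Poly_cat C) c' d"
          and d: "d \<in> Arr C"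
          and f': "f' \<in> Dyn_hom C T d (reindex C \<chi>' \<rho>') \<kappa>"
        have [simp]: "q' = q" "c' = c" "\<rho>' = \<rho>" using e1 e2(1) by auto
        note [simp] = e2(2,3)
        obtain \<pi> \<upsilon> where [simp]: "y = (\<pi>, \<upsilon>)" by (cases y)
        have \<upsilon>: "is_open_system C T p \<upsilon>" and \<pi>: "\<pi> \<in> hom C (State \<upsilon>) (State \<theta>)" using 8(3) by auto
        have fs: "f \<in> hom C (State \<theta>) (State \<rho>)" "f' \<in> hom C (State \<rho>) (State \<kappa>)"
          using f f' by (auto simp: Dyn_hom_def)
        have c: "c \<in> Obj (Poly_cat C)" using \<chi> by (auto elim!: hom_PolyE)
        have \<chi>'A: "\<chi>' \<in> Arr (Poly_cat C)" "mor_src \<chi>' = c" using \<chi>' by (auto simp: hom_iff)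
        have "Mor (reindex C \<chi> \<theta>) \<rho> f \<in> Arr (Dyn_cat C T c)"
          using f \<rho> reindex_open_system[OF \<chi> \<theta>] by (simp add: Dyn_cat_def)
        then have "mor_map (AMap (AMap (Dyn C T) \<chi>') (Mor (reindex C \<chi> \<theta>) \<rho> f)) = f"
          using \<chi>'A by (simp add: Dyn_def)
        then show ?case
          using reindex_Comp[OF \<phi> \<phi>'[simplified] \<upsilon>] Comp_assoc[OF \<pi> fs] d
            by (simp add: Dyn_Obj Dyn_cat_def)
      qed
    qed
  qed
  finally show ?thesis .
qed

end

section \<open>Restriction to measure-preserving base systems\<close>

locale measured_open_systems = open_systems C T for C :: "('o, 'a) category" (structure) and T +
  fixes P :: "('o, 'a, 'o, 'a) func"
  assumes P: "is_functor P C C"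
begin

lemma DynP_category: "category (DynP_cat C T P b)"
  unfolding DynP_cat_def
proof (rule concrete_category[where U = "\<lambda>x. State (fst x)"], goal_cases)
  case (4 x)
  obtain \<theta> \<nu> where [simp]: "x = (\<theta>, \<nu>)" by (cases x)
  have \<theta>: "is_open_system C T b \<theta>" and \<nu>: "\<nu> \<in> hom C (one C) (OMap P (State \<theta>))"
    using 4 by (auto simp: is_measure_preserving_def)
  have "State \<theta> \<in> Obj C" using \<theta> by (simp add: is_open_system_def)
  then show ?case
    using Dyn_hom_Ident[OF \<theta>] is_functorD(7)[OF P] Ident_Comp[OF \<nu>] by simp
next
  case (5 x y z f g)
  obtain \<theta> \<nu> \<psi> \<kappa> \<rho> \<xi> where [simp]: "x = (\<theta>, \<nu>)" "y = (\<psi>, \<kappa>)" "z = (\<rho>, \<xi>)"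
    by (cases x, cases y, cases z)
  have s: "is_open_system C T b \<theta>" "is_open_system C T b \<psi>" "is_open_system C T b \<rho>"
    and \<nu>: "\<nu> \<in> hom C (one C) (OMap P (State \<theta>))"
    and fg: "f \<in> Dyn_hom C T b \<theta> \<psi>" "g \<in> Dyn_hom C T b \<psi> \<rho>" "AMap P f \<cdot> \<nu> = \<kappa>" "AMap P g \<cdot> \<kappa> = \<xi>"
    using 5 by (auto simp: is_measure_preserving_def)
  have f: "f \<in> hom C (State \<theta>) (State \<psi>)" and g: "g \<in> hom C (State \<psi>) (State \<rho>)"
    using fg by (auto simp: Dyn_hom_def)
  show ?case
    using Dyn_hom_Comp[OF s fg(1,2)] is_functorD(8)[OF P f g] fg(3,4)
      Comp_assoc[OF \<nu> is_functorD(6)[OF P f] is_functorD(6)[OF P g]] by simp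
qed (auto simp: category_axioms Dyn_hom_def)

lemma measure_preserving_open_system:
  "is_measure_preserving C T P b \<theta>\<nu> \<Longrightarrow> is_open_system C T b (fst \<theta>\<nu>)"
  by (auto simp: is_measure_preserving_def)

text \<open>The time-\<open>t\<close> maps of the reindexed system are among those of the original one.\<close>

lemma measure_preserving_reindex:
  assumes \<chi>: "\<chi> \<in> hom (Poly_cat C) b c" and \<theta>: "is_measure_preserving C T P b (\<theta>, \<nu>)"
  shows "is_measure_preserving C T P c (reindex C \<chi> \<theta>, \<nu>)"
proof -
  have "is_open_system C T b \<theta>" using \<theta> by (simp add: is_measure_preserving_def)
  then show ?thesis
    using \<theta> by (simp add: is_measure_preserving_def closure_reindex[OF \<chi>] pull_lens_section[OF \<chi>]
        reindex_open_system[OF \<chi>])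
qed

lemma DynP_functor: "is_functor (DynP C T P) (Poly_cat C) Cat"
proof -
  have "DynP C T P = \<lparr>Src = Poly_cat C, Tgt = Cat, OMap = (\<lambda>b \<in> Obj (Poly_cat C). DynP_cat C T P b),
     AMap = (\<lambda>\<chi> \<in> Arr (Poly_cat C). tagged_fun (DynP_cat C T P (Dom (Poly_cat C) \<chi>))
       (DynP_cat C T P (Cod (Poly_cat C) \<chi>)) (map_prod (reindex C \<chi>) id))\<rparr>"
    by (simp add: DynP_def)
  also have "is_functor \<dots> (Poly_cat C) Cat"
  proof (rule relabelling_functor[OF Poly_category DynP_cat_def DynP_category], goal_cases)
    case (3 \<chi> b c x y m)
    then show ?case by (auto simp: is_measure_preserving_def Dyn_hom_reindex)
  qed (auto simp: measure_preserving_reindex reindex_Ident reindex_Comp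
      dest: measure_preserving_open_system simp del: tagged_cat_simps)
  finally show ?thesis .
qed

lemma forget_measure_functor: "is_functor (forget_measure C T P b) (DynP_cat C T P b)
    (Dyn_cat C T b)"
  unfolding forget_measure_def
  by (rule tagged_fun_functor[OF DynP_cat_def Dyn_cat_def DynP_category Dyn_category])
    (auto simp: is_measure_preserving_def)

lemma forget_measure_natural: "strictly_natural (DynP C T P) (Dyn C T) (forget_measure C T P)"
proof -
  have D: "OMap (Dyn C T) b = Dyn_cat C T b" "OMap (DynP C T P) b = DynP_cat C T P b" if "b \<in> Arr C"
    for b
    using that by (simp_all add: Dyn_def DynP_def)
  have "fun_comp (forget_measure C T P c) (AMap (DynP C T P) \<chi>) =
      fun_comp (AMap (Dyn C T) \<chi>) (forget_measure C T P b)"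
    if \<chi>: "\<chi> \<in> hom (Poly_cat C) b c" for \<chi> b c
  proof -
    have \<chi>': "\<chi> \<in> Arr (Poly_cat C)" "mor_src \<chi> = b" "mor_tgt \<chi> = c" "b \<in> Arr C" "c \<in> Arr C"
      using \<chi> by (auto simp: hom_iff Poly_cat_tagged)
    have A: "AMap (DynP C T P) \<chi> =
        tagged_fun (DynP_cat C T P b) (DynP_cat C T P c) (map_prod (reindex C \<chi>) id)"
      "AMap (Dyn C T) \<chi> = tagged_fun (Dyn_cat C T b) (Dyn_cat C T c) (reindex C \<chi>)"
      using \<chi>' by (simp_all add: DynP_def Dyn_def)
    have "is_functor (AMap (DynP C T P) \<chi>) (DynP_cat C T P b) (DynP_cat C T P c)"
      using is_functorD(6)[OF DynP_functor \<chi>] D \<chi>' by simp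
    then have "fun_comp (forget_measure C T P c) (AMap (DynP C T P) \<chi>) =
        tagged_fun (DynP_cat C T P b) (Dyn_cat C T c) (reindex C \<chi> \<circ> fst)"
      unfolding A forget_measure_def by (rule tagged_fun_comp[OF _ DynP_cat_def]) simp
    moreover have "fun_comp (AMap (Dyn C T) \<chi>) (forget_measure C T P b) =
        tagged_fun (DynP_cat C T P b) (Dyn_cat C T c) (reindex C \<chi> \<circ> fst)"
      using forget_measure_functor[of b] unfolding A forget_measure_def
      by (rule tagged_fun_comp[OF _ DynP_cat_def]) simp
    ultimately show ?thesis by simp
  qed
  then show ?thesis
    using is_functorD(1)[OF DynP_functor] forget_measure_functor Arr_hom[of _ "Poly_cat C"]
    by (simp add: strictly_natural_def D)
qed

sublocale measured: restricted_indexed "Dyn C T" "DynP C T P" "Poly_cat C" "forget_measure C T P"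
    "BunDyn C T"
  by unfold_locales (rule Dyn_functor DynP_functor BunDyn_functor forget_measure_natural)+

lemma RBDyn_restricted: "RBDyn C T P = measured.restricted"
  by (simp add: RBDyn_def measured.restricted_def)

end

theorem proposition3p38:
  fixes E :: "('o, 'a) category"
    and P :: "('o, 'a, 'o, 'a) func" and \<eta> \<mu> :: "'o \<Rightarrow> 'a"
    and T :: "('o, 'a) internal_monoid"
  assumes "locally_cartesian_closed E"
    and "is_monad E P \<eta> \<mu>"
    and "is_monoid E T"
  shows "is_functor (RBDyn E T P) (prod_cat (Poly_cat E) (groth (DynP E T P))) Cat \<and>
    is_functor (int_RBDyn E T P) (Poly_cat E)
      (Pi_cat (Obj (Poly_cat E)) (\<lambda>b. Fib (DynP_cat E T P b))) \<and>
    (\<forall>p \<in> Obj (Poly_cat E). \<forall>b \<in> Obj (Poly_cat E).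
      is_cat_pullback (OMap (int_RBDyn E T P) p b) (int_forget_measure E T P p b)
        (forget_measure E T P b) (OMap (int_BunDyn E T) p b)) \<and>
    (\<forall>\<phi> \<in> Arr (Poly_cat E). \<forall>b \<in> Obj (Poly_cat E).
      fun_comp (int_forget_measure E T P (Cod (Poly_cat E) \<phi>) b)
          (mor_map (AMap (int_RBDyn E T P) \<phi> b)) =
        fun_comp (mor_map (AMap (int_BunDyn E T) \<phi> b))
          (int_forget_measure E T P (Dom (Poly_cat E) \<phi>) b))"
proof -
  interpret category_with_limits E by (rule locally_cartesian_closed_limits) fact
  interpret measured_open_systems E T P
    using assms(2,3) by unfold_locales (auto simp: is_monoid_def is_monad_def)
  \<comment> \<open>The families \<open>OMap (DynP E T P)\<close> and \<open>DynP_cat E T P\<close> agree on the objects of \<open>Poly_cat E\<close>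
    only, which is all that the product category depends on.\<close>
  have "Tgt (int_RBDyn E T P) = Pi_cat (Obj (Poly_cat E)) (\<lambda>b. Fib (DynP_cat E T P b))"
    unfolding int_RBDyn_def RBDyn_restricted is_functorD(2)[OF measured.R.fibrewise_groth_functor]
    by (rule Pi_cat_cong) (simp add: DynP_def)
  moreover have "is_functor (int_RBDyn E T P) (Poly_cat E) (Tgt (int_RBDyn E T P))"
    using measured.R.fibrewise_groth_functor
    by (simp add: int_RBDyn_def RBDyn_restricted is_functor_def)
  ultimately have "is_functor (int_RBDyn E T P) (Poly_cat E)
      (Pi_cat (Obj (Poly_cat E)) (\<lambda>b. Fib (DynP_cat E T P b)))" by simp
  moreover have "is_functor (RBDyn E T P) (prod_cat (Poly_cat E) (groth (DynP E T P))) Cat"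
    unfolding RBDyn_restricted by (rule measured.restricted_functor)
  moreover have "is_cat_pullback (OMap (int_RBDyn E T P) p b) (int_forget_measure E T P p b)
      (forget_measure E T P b) (OMap (int_BunDyn E T) p b)"
    if "p \<in> Obj (Poly_cat E)" "b \<in> Obj (Poly_cat E)" for p b
    unfolding int_RBDyn_def int_BunDyn_def int_forget_measure_def RBDyn_restricted
    using that by (rule measured.restricted_pullback)
  moreover have "fun_comp (int_forget_measure E T P (Cod (Poly_cat E) \<phi>) b)
      (mor_map (AMap (int_RBDyn E T P) \<phi> b)) =
      fun_comp (mor_map (AMap (int_BunDyn E T) \<phi> b)) (int_forget_measure E T P (Dom (Poly_cat E) \<phi>)
          b)"
    if "\<phi> \<in> Arr (Poly_cat E)" "b \<in> Obj (Poly_cat E)" for \<phi> b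
    unfolding int_RBDyn_def int_BunDyn_def int_forget_measure_def RBDyn_restricted
    using Arr_hom[OF that(1)] that(2) by (rule measured.restricted_square)
  ultimately show ?thesis by blast
qed

end
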